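(* Let the integral system $S[R_1,R_2]$ be singular and limit circle at $b$, and let $m(\lambda,b,\infty)=\dfrac{s_2(b,\lambda)}{c_2(b,\lambda)}$ be its Neumann $m$-function. Then: (i) $T_N$ is a symmetric nonnegative linear relation in $L^2(R_2)$ with deficiency indices $(1,1)$. (ii) The triple $\Pi^N=(\mathbb{C},\Gamma_0^N,\Gamma_1^N)$, where $\Gamma_0^N\mathbf{u}=u_2(0)$, $\Gamma_1^N\mathbf{u}=-u_1(0)$ for $\mathbf{u}\in T_N^*$, is a boundary triple for $T_N^*$. (iii) The Weyl function $m_N(\lambda)$ of $T_N$ corresponding to the boundary triple $\Pi^N$ coincides with the Neumann $m$-function $m(\lambda,b,\infty)$. (iv) The Weyl function $m_N(\lambda)$ of $T_N$ coincides with the principal Titchmarsh-Weyl coefficient $q(\lambda)$ of the system $S[R_1,R_2]$, belongs to the Stieltjes class $\mathcal{S}$, and $$\lim_{\lambda\to-\infty}m_N(\lambda)=R_{1+}(a),\qquad\text{where } a=\inf\operatorname{supp}dR_2 .$$ (v) The Weyl function $m_N(\lambda)$ of $T_N$ admits the representation $$m_N(\lambda)=-\frac{1}{R_2(b)\cdot\lambda}+\widetilde m(\lambda),$$ where $\widetilde m$ is a function from $\mathcal{S}$ such that $\lim_{y\to0}y\,\widetilde m(iy)=0$.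
   Context: **Integral systems.** Let $0<b\le\infty$ and let $R_1,R_2:[0,b)\to\mathbb{R}$ be nondecreasing left-continuous functions with $R_1(0)=R_2(0)=0$; put $R_j(b):=\lim_{x\to b}R_j(x)\in[0,\infty]$ and $R_{1+}(x):=\lim_{t\downarrow x}R_1(t)$. $dR_j$ is the Lebesgue-Stieltjes measure of $R_j$ on $[0,b)$ (so $dR_j(\{x\})$ is the jump $\lim_{t\downarrow x}R_j(t)-R_j(x)$). Convention: $\int_a^x f\,d\sigma:=\int_{[a,x)}f\,d\sigma$. The integral system $S[R_1,R_2]$ with spectral parameter $\lambda\in\mathbb{C}$ is $$u_1(x)=u_1(0)+\int_0^x u_2\,dR_1,\qquad u_2(x)=u_2(0)-\lambda\int_0^x u_1\,dR_2,\qquad x\in[0,b).$$ $c(\cdot,\lambda)=[c_1\ c_2]^T$ and $s(\cdot,\lambda)=[s_1\ s_2]^T$ are its unique solutions with $c_1(0,\lambda)=1$, $c_2(0,\lambda)=0$, $s_1(0,\lambda)=0$, $s_2(0,\lambda)=1$. The system is regular (at $b$) if $R_1(b)+R_2(b)<\infty$, and singular otherwise. The principal Titchmarsh-Weyl coefficient is $q(\lambda):=\lim_{x\to b}s_1(x,\lambda)/c_1(x,\lambda)$, $\lambda\in\mathbb{C}\setminus[0,\infty)$. **Standing assumptions.** $R_1$ and $R_2$ have no common points of discontinuity; and there is an interval $[0,b_0)\subseteq[0,b)$ such that the classes of $1$ and $R_1$ in $L^2(R_2,[0,b_0))$ are linearly independent. **Linear relations.** $\mathcal{L}^2(R_2)$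 is the space of complex functions with $\int_{[0,b)}|f|^2dR_2<\infty$, $L^2(R_2)$ its quotient modulo $dR_2$-a.e. equality, with quotient map $\pi$. $\mathcal{T}$ is the set of triples $(u_1,u_2,f)$ with $f,u_1\in\mathcal{L}^2(R_2)$ and $u_1(x)=u_1(0)+\int_0^xu_2\,dR_1$, $u_2(x)=u_2(0)-\int_0^xf\,dR_2$ for all $x\in[0,b)$. $T_{\max}=\{[\pi u_1\ \pi f]^T:(u_1,u_2,f)\in\mathcal{T}\}$. Under the standing assumptions $u_1(x),u_2(x)$ are uniquely determined by $[\pi u_1\ \pi f]^T\in T_{\max}$. For $\lambda\in\mathbb{C}\setminus\mathbb{R}$, the system is limit point at $b$ if $\dim\ker(T_{\max}-\lambda I)=1$ and limit circle at $b$ if $\dim\ker(T_{\max}-\lambda I)=2$ (one of the two holds, independently of $\lambda$). In the limit circle case $u_2(b):=\lim_{x\to b}u_2(x)$ exists for every element of $T_{\max}$; in particular $c_2(b,\lambda)$, $s_2(b,\lambda)$ exist. The Neumann $m$-function $m(\lambda,b,\infty)$ is the coefficient for which $\psi=s-m(\lambda,b,\infty)c$ satisfies $\psi_2(b,\lambda)=0$. Define $$T_N=\{[\pi u_1\ \pi f]^T:(u_1,u_2,f)\in\mathcal{T},\ u_1(0)=u_2(0)=u_2(b)=0\};$$ its adjoint is $T_N^*=\{[\pi u_1\ \pi f]^T:(u_1,u_2,f)\in\mathcal{T},\ u_2(b)=0\}$. A linear relation $T$ in a Hilbert space $\mathfrak H$ is symmetric if $T\subseteq T^*$, nonnegative if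 $\langle f,u\rangle\ge0$ for all $[u\ f]^T\in T$; its deficiency indices are $n_\pm(T)=\dim\ker(T^*\mp iI)$. **Boundary triples.** For a symmetric relation $T$ with deficiency indices $(1,1)$, a boundary triple for $T^*$ is $(\mathbb{C},\Gamma_0,\Gamma_1)$ with linear maps $\Gamma_0,\Gamma_1:T^*\to\mathbb{C}$ such that $\langle f,v\rangle-\langle u,g\rangle=\Gamma_1\mathbf{u}\overline{\Gamma_0\mathbf{v}}-\Gamma_0\mathbf{u}\overline{\Gamma_1\mathbf{v}}$ for all $\mathbf{u}=[u\ f]^T,\mathbf{v}=[v\ g]^T\in T^*$, and $[\Gamma_0\ \Gamma_1]^T:T^*\to\mathbb{C}^2$ is surjective. The corresponding Weyl function $m$ is defined by $m(\lambda)\Gamma_0\mathbf{u}_\lambda=\Gamma_1\mathbf{u}_\lambda$ for all $\mathbf{u}_\lambda=[u_\lambda\ \lambda u_\lambda]^T\in T^*$, $\lambda\in\rho(\ker\Gamma_0)$. **Stieltjes class $\mathcal{S}$.** Functions $m$ holomorphic on $\mathbb{C}\setminus\mathbb{R}$ with $\operatorname{Im}m(\lambda)\ge0$ for $\operatorname{Im}\lambda>0$ and $m(\overline\lambda)=\overline{m(\lambda)}$, that admit a holomorphic continuation to $\mathbb{R}_-=(-\infty,0)$ and take nonnegative values there. *)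

theory Defs
  imports "HOL-Analysis.Analysis"
begin

section \<open>Lebesgue-Stieltjes measures on \<open>[0,b)\<close>\<close>

definition Ico0 :: "ereal \<Rightarrow> real set" where
  "Ico0 b = {x. 0 \<le> x \<and> ereal x < b}"

text \<open>The filter \<open>x \<rightarrow> b\<close>, \<open>x < b\<close>, for a finite or infinite right endpoint \<open>b\<close>.\<close>

definition at_end :: "ereal \<Rightarrow> real filter" where
  "at_end b = filtermap real_of_ereal (at_left b)"

lemma at_end_PInf: "at_end \<infinity> = at_top"
  by (simp add: at_end_def at_left_PInf filtermap_filtermap)

lemma at_end_ereal: "at_end (ereal c) = at_left c"
  by (simp add: at_end_def at_left_ereal filtermap_filtermap)

text \<open>
  The library's \<open>interval_measure\<close> is for right-continuous functions on the whole line. Here \<open>R\<close>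
  is left-continuous, only its values on \<open>[0,b)\<close> matter, and it may be unbounded near a finite \<open>b\<close>;
  hence the measure has \<open>[0,b)\<close> as its space and extends \<open>[x,y) \<mapsto> R(y) - R(x)\<close>.
\<close>

definition dR :: "ereal \<Rightarrow> (real \<Rightarrow> real) \<Rightarrow> real measure" where
  "dR b R = extend_measure (Ico0 b) {(x, y). 0 \<le> x \<and> x \<le> y \<and> ereal y < b}
     (\<lambda>(x, y). {x..<y}) (\<lambda>(x, y). ennreal (R y - R x))"

definition R_end :: "ereal \<Rightarrow> (real \<Rightarrow> real) \<Rightarrow> ereal" where
  "R_end b R = Lim (at_end b) (\<lambda>x. ereal (R x))"

definition R_plus :: "(real \<Rightarrow> real) \<Rightarrow> real \<Rightarrow> real" where
  "R_plus R x = Lim (at_right x) R"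

definition supp_dR :: "ereal \<Rightarrow> (real \<Rightarrow> real) \<Rightarrow> real set" where
  "supp_dR b R = {x \<in> Ico0 b. \<forall>e>0. emeasure (dR b R) (ball x e \<inter> Ico0 b) > 0}"

text \<open>
  Left continuity at \<open>0\<close> is void, since \<open>R\<close> is regarded as a function on \<open>[0,b)\<close>.
\<close>

definition stieltjes_integrator :: "ereal \<Rightarrow> (real \<Rightarrow> real) \<Rightarrow> bool" where
  "stieltjes_integrator b R \<longleftrightarrow>
     mono_on (Ico0 b) R \<and> (\<forall>x\<in>Ico0 b. 0 < x \<longrightarrow> continuous (at_left x) R) \<and> R 0 = 0"

lemma space_dR [simp]: "space (dR b R) = Ico0 b"
proof -
  have "(\<lambda>(x, y). {x..<y}) ` {(x, y). 0 \<le> x \<and> x \<le> y \<and> ereal y < b} \<subseteq> Pow (Ico0 b)"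
    by (auto simp: Ico0_def) (metis ereal_less_eq(3) le_less_trans less_imp_le)
  then show ?thesis
    unfolding dR_def by (simp add: space_extend_measure)
qed

text \<open>Existence of the extension: push Lebesgue measure forward along a generalized inverse.\<close>

lemma emeasure_dR_Ico:
  assumes R: "stieltjes_integrator b R" and xy: "0 \<le> x" "x \<le> y" "ereal y < b"
  shows "emeasure (dR b R) {x..<y} = ennreal (R y - R x)"
proof -
  let ?G = "\<lambda>(x::real, y). {x..<y}" and ?I = "{(x, y). 0 \<le> x \<and> x \<le> y \<and> ereal y < b}"
  let ?D = "{t. 0 \<le> t \<and> (\<exists>y\<in>Ico0 b. t < R y)}"
  define g where "g t = Sup {x \<in> Ico0 b. R x \<le> t}" for t
  have mono: "R x \<le> R y" if "0 \<le> x" "x \<le> y" "ereal y < b" for x y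
  proof -
    have "ereal x < b" using that(2,3) by (meson ereal_less_eq(3) le_less_trans)
    with that R show ?thesis
      by (auto simp: stieltjes_integrator_def Ico0_def monotone_on_def)
  qed
  have lc: "continuous (at_left x) R" if "0 < x" "ereal x < b" for x
    using R that by (auto simp: stieltjes_integrator_def Ico0_def)
  have R0: "R 0 = 0" using R by (simp add: stieltjes_integrator_def)
  have bdd: "bdd_above {x \<in> Ico0 b. R x \<le> t}" if t: "t \<in> ?D" for t
  proof -
    obtain y where y: "y \<in> Ico0 b" "t < R y" using t by auto
    have "x \<le> y" if "x \<in> Ico0 b" "R x \<le> t" for x
    proof (rule ccontr)
      assume "\<not> x \<le> y"
      then have "R y \<le> R x" using mono[of y x] y(1) that(1) by (auto simp: Ico0_def)
      with y(2) that(2) show False by simp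
    qed
    then show ?thesis by (auto intro!: bdd_aboveI)
  qed
  have zero: "0 \<in> {x \<in> Ico0 b. R x \<le> t}" if t: "t \<in> ?D" for t
    using t R0 by (auto simp: Ico0_def) (metis ereal_less_eq(3) le_less_trans)
  have le_g: "x \<le> g t \<longleftrightarrow> R x \<le> t" if t: "t \<in> ?D" and x: "0 \<le> x" "ereal x < b" for x t
  proof
    assume "R x \<le> t"
    then show "x \<le> g t" unfolding g_def
      using x by (intro cSup_upper bdd[OF t]) (auto simp: Ico0_def)
  next
    assume xg: "x \<le> g t"
    show "R x \<le> t"
    proof (cases "x = 0")
      case True then show ?thesis using R0 t by auto
    next
      case False
      then have x0: "0 < x" using x by simp
      have "R w \<le> t" if w: "0 \<le> w" "w < x" for w
      proof -
        have "w < Sup {x \<in> Ico0 b. R x \<le> t}" using xg w(2) unfolding g_def by linarith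
        then obtain v where v: "v \<in> Ico0 b" "R v \<le> t" "w < v"
          using zero[OF t] bdd[OF t] by (subst (asm) less_cSup_iff) auto
        then show ?thesis using mono[of w v] w(1) by (auto simp: Ico0_def)
      qed
      then have "eventually (\<lambda>w. R w \<le> t) (at_left x)"
        using x0 by (intro eventually_at_leftI[of 0]) auto
      moreover have "(R \<longlongrightarrow> R x) (at_left x)"
        using lc[OF x0 x(2)] by (simp add: continuous_within)
      ultimately show ?thesis
        by (intro tendsto_upperbound) (auto simp: trivial_limit_at_left_real)
    qed
  qed
  have g_mono: "mono_on ?D g"
  proof (rule mono_onI)
    fix r s assume rs: "r \<in> ?D" "s \<in> ?D" "r \<le> s"
    show "g r \<le> g s" unfolding g_def
      using zero[OF rs(1)] bdd[OF rs(2)] rs(3) by (intro cSup_subset_mono) auto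
  qed
  have gI: "g t \<in> Ico0 b" if t: "t \<in> ?D" for t
  proof -
    obtain y where y: "y \<in> Ico0 b" "t < R y" using t by auto
    have "g t < y" using le_g[OF t, of y] y by (auto simp: Ico0_def)
    moreover have "0 \<le> g t" using zero[OF t] bdd[OF t] unfolding g_def by (intro cSup_upper) auto
    ultimately show ?thesis using y(1) by (auto simp: Ico0_def) (metis ereal_less(2) less_ereal.simps(1) less_trans)
  qed
  have "?D = {0..} \<inter> (\<Union>y\<in>Ico0 b. {..<R y})" by auto
  moreover have "open (\<Union>y\<in>Ico0 b. {..<R y})" by auto
  ultimately have D: "?D \<in> sets borel" by (metis (no_types, lifting) atLeast_borel borel_open sets.Int)
  have g_meas: "g \<in> borel_measurable (restrict_space borel ?D)"
    using g_mono by (rule borel_measurable_mono_on_fnc)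
  define N where "N = distr (restrict_space lborel ?D) (restrict_space borel (Ico0 b)) g"
  have g_meas': "g \<in> restrict_space lborel ?D \<rightarrow>\<^sub>M restrict_space borel (Ico0 b)"
    using g_meas gI by (intro measurable_restrict_space2)
      (auto simp: space_restrict_space measurable_cong_sets[OF sets_restrict_space_cong[OF sets_lborel] refl])
  have GI: "?G ` ?I \<subseteq> Pow (Ico0 b)"
    by (auto simp: Ico0_def) (metis ereal_less_eq(3) le_less_trans less_imp_le)
  have N_Ico: "emeasure N {x..<y} = ennreal (R y - R x)" if xy: "(x, y) \<in> ?I" for x y
  proof -
    have x: "0 \<le> x" "ereal x < b" and y: "0 \<le> y" "ereal y < b"
      using xy by (auto) (metis ereal_less_eq(3) le_less_trans)
    have "{x..<y} \<in> sets (restrict_space borel (Ico0 b))"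
    proof -
      have "{x..<y} \<subseteq> Ico0 b" using GI xy by auto
      then have "{x..<y} = Ico0 b \<inter> {x..<y}" by auto
      then show ?thesis unfolding sets_restrict_space by (rule image_eqI) auto
    qed
    then have "emeasure N {x..<y} = emeasure (restrict_space lborel ?D) (g -` {x..<y} \<inter> ?D)"
      unfolding N_def using g_meas' by (subst emeasure_distr) (auto simp: space_restrict_space)
    also have "g -` {x..<y} \<inter> ?D = {R x..<R y}"
    proof -
      have "t \<in> {R x..<R y}" if "t \<in> g -` {x..<y} \<inter> ?D" for t
        using that le_g[of t x] le_g[of t y] x y by force
      moreover have "t \<in> g -` {x..<y} \<inter> ?D" if "t \<in> {R x..<R y}" for t
      proof -
        have "0 \<le> R x" using mono[of 0 x] x R0 by simp
        then have "t \<in> ?D" using that y by (auto simp: Ico0_def)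
        then show ?thesis using that le_g[of t x] le_g[of t y] x y by force
      qed
      ultimately show ?thesis by blast
    qed
    also have "emeasure (restrict_space lborel ?D) {R x..<R y} = emeasure lborel {R x..<R y}"
    proof (rule emeasure_restrict_space)
      show "?D \<inter> space lborel \<in> sets lborel" using D by simp
      have "0 \<le> R x" using mono[of 0 x] x R0 by simp
      then show "{R x..<R y} \<subseteq> ?D" using y by (auto simp: Ico0_def)
    qed
    also have "\<dots> = ennreal (R y - R x)"
      using mono[of x y] xy by simp
    finally show ?thesis .
  qed
  show ?thesis
  proof (cases "\<forall>i\<in>?I. (case i of (x, y) \<Rightarrow> ennreal (R y - R x)) = 0")
    case True
    then have "dR b R = measure_of (Ico0 b) (?G ` ?I) (\<lambda>_. 0)"
      unfolding dR_def extend_measure_def by auto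
    then have "emeasure (dR b R) {x..<y} = 0"
      by (simp add: emeasure_sigma)
    also have "0 = ennreal (R y - R x)" using True xy by force
    finally show ?thesis .
  next
    case False
    have sub: "sets (dR b R) \<subseteq> sets N"
    proof -
      have "?G ` ?I \<subseteq> sets N"
      proof
        fix A assume "A \<in> ?G ` ?I"
        then have "A \<in> sets borel" "A \<subseteq> Ico0 b" using GI by auto
        then show "A \<in> sets N"
          unfolding N_def sets_distr sets_restrict_space by (intro image_eqI[of _ _ A]) auto
      qed
      moreover have "space N = Ico0 b" by (simp add: N_def space_restrict_space)
      ultimately show ?thesis
        unfolding dR_def sets_extend_measure[OF GI]
        using sets.sigma_sets_subset[of "?G ` ?I" N] by simp
    qed
    show ?thesis
    proof (rule emeasure_extend_measure_Pair[where I = "\<lambda>x y. 0 \<le> x \<and> x \<le> y \<and> ereal y < b" and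
            G = "\<lambda>x y. {x..<y}" and \<mu> = "\<lambda>x y. ennreal (R y - R x)" and \<mu>' = "emeasure N"])
      show "dR b R = extend_measure (Ico0 b) {(x, y). 0 \<le> x \<and> x \<le> y \<and> ereal y < b}
         (\<lambda>(x, y). {x..<y}) (\<lambda>(x, y). ennreal (R y - R x))"
        by (rule dR_def)
      show "positive (sets (dR b R)) (emeasure N)" by (simp add: positive_def)
      show "countably_additive (sets (dR b R)) (emeasure N)"
        using sub by (auto simp: countably_additive_def intro!: suminf_emeasure)
    qed (use GI N_Ico xy in auto)
  qed
qed


section \<open>The Hilbert space \<open>L\<^sup>2(M)\<close>\<close>

text \<open>
  A complex inner product space on an explicit carrier. (The space \<open>L\<^sup>2(dR\<^sub>2)\<close> depends on
  \<open>R\<^sub>2\<close>, so it cannot be a type.) The inner product is linear in its first argument.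
\<close>

record 'v cips =
  Carrier :: "'v set"
  Zero :: "'v"
  Add :: "'v \<Rightarrow> 'v \<Rightarrow> 'v"
  Scale :: "complex \<Rightarrow> 'v \<Rightarrow> 'v"
  Inner :: "'v \<Rightarrow> 'v \<Rightarrow> complex"

definition L2_fun :: "'a measure \<Rightarrow> ('a \<Rightarrow> complex) set" where
  "L2_fun M = {f \<in> borel_measurable M. integrable M (\<lambda>x. (cmod (f x))\<^sup>2)}"

definition L2_rel :: "'a measure \<Rightarrow> (('a \<Rightarrow> complex) \<times> ('a \<Rightarrow> complex)) set" where
  "L2_rel M = {(f, g). f \<in> L2_fun M \<and> g \<in> L2_fun M \<and> (AE x in M. f x = g x)}"

definition L2_class :: "'a measure \<Rightarrow> ('a \<Rightarrow> complex) \<Rightarrow> ('a \<Rightarrow> complex) set" where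
  "L2_class M f = L2_rel M `` {f}"

definition L2_rep :: "('a \<Rightarrow> complex) set \<Rightarrow> 'a \<Rightarrow> complex" where
  "L2_rep X = (SOME f. f \<in> X)"

definition L2 :: "'a measure \<Rightarrow> ('a \<Rightarrow> complex) set cips" where
  "L2 M = \<lparr>Carrier = L2_fun M // L2_rel M,
           Zero = L2_class M (\<lambda>x. 0),
           Add = (\<lambda>X Y. L2_class M (\<lambda>x. L2_rep X x + L2_rep Y x)),
           Scale = (\<lambda>c X. L2_class M (\<lambda>x. c * L2_rep X x)),
           Inner = (\<lambda>X Y. LINT x|M. L2_rep X x * cnj (L2_rep Y x))\<rparr>"

lemma equiv_L2_rel: "equiv (L2_fun M) (L2_rel M)"
  by (auto simp: equiv_def refl_on_def sym_def trans_def L2_rel_def elim: AE_mp)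

lemma L2_rep_class:
  assumes "f \<in> L2_fun M"
  shows "L2_rep (L2_class M f) \<in> L2_fun M" "AE x in M. L2_rep (L2_class M f) x = f x"
proof -
  have "f \<in> L2_class M f" using assms by (auto simp: L2_class_def L2_rel_def)
  then have "L2_rep (L2_class M f) \<in> L2_class M f" unfolding L2_rep_def
    by (rule someI[where P = "\<lambda>h. h \<in> L2_class M f"])
  then show "L2_rep (L2_class M f) \<in> L2_fun M" "AE x in M. L2_rep (L2_class M f) x = f x"
    by (auto simp: L2_class_def L2_rel_def elim: AE_mp)
qed

lemma L2_class_eq_iff:
  assumes "f \<in> L2_fun M" "g \<in> L2_fun M"
  shows "L2_class M f = L2_class M g \<longleftrightarrow> (AE x in M. f x = g x)"
  unfolding L2_class_def using assms eq_equiv_class_iff[OF equiv_L2_rel assms]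
  by (simp add: L2_rel_def)

lemma L2_fun_scale: "f \<in> L2_fun M \<Longrightarrow> (\<lambda>x. c * f x) \<in> L2_fun M"
  by (auto simp: L2_fun_def norm_mult power_mult_distrib)

lemma L2_fun_add:
  assumes f: "f \<in> L2_fun M" and g: "g \<in> L2_fun M"
  shows "(\<lambda>x. f x + g x) \<in> L2_fun M"
proof -
  have m [measurable]: "f \<in> borel_measurable M" "g \<in> borel_measurable M"
    using f g by (auto simp: L2_fun_def)
  have le: "(cmod (z + w))\<^sup>2 \<le> 2 * (cmod z)\<^sup>2 + 2 * (cmod w)\<^sup>2" for z w
  proof -
    have "(cmod (z + w))\<^sup>2 \<le> (cmod z + cmod w)\<^sup>2" by (simp add: norm_triangle_ineq power_mono)
    moreover have "0 \<le> (cmod z - cmod w)\<^sup>2" by simp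
    ultimately show ?thesis by (simp add: power2_sum power2_diff)
  qed
  have "integrable M (\<lambda>x. 2 * (cmod (f x))\<^sup>2 + 2 * (cmod (g x))\<^sup>2)"
    using f g by (auto simp: L2_fun_def)
  then have "integrable M (\<lambda>x. (cmod (f x + g x))\<^sup>2)"
    by (rule Bochner_Integration.integrable_bound) (auto intro!: AE_I2 le)
  then show ?thesis by (simp add: L2_fun_def)
qed

lemma L2_ops_class:
  assumes f: "f \<in> L2_fun M" and g: "g \<in> L2_fun M"
  shows "Add (L2 M) (L2_class M f) (L2_class M g) = L2_class M (\<lambda>x. f x + g x)"
    and "Scale (L2 M) c (L2_class M f) = L2_class M (\<lambda>x. c * f x)"
    and "Inner (L2 M) (L2_class M f) (L2_class M g) = (LINT x|M. f x * cnj (g x))"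
proof -
  note r = L2_rep_class[OF f] L2_rep_class[OF g]
  show "Add (L2 M) (L2_class M f) (L2_class M g) = L2_class M (\<lambda>x. f x + g x)"
    unfolding L2_def cips.simps
    by (subst L2_class_eq_iff) (use r f g in \<open>auto intro!: L2_fun_add elim: AE_mp\<close>)
  show "Scale (L2 M) c (L2_class M f) = L2_class M (\<lambda>x. c * f x)"
    unfolding L2_def cips.simps
    by (subst L2_class_eq_iff) (use r f g in \<open>auto intro!: L2_fun_scale elim: AE_mp\<close>)
  have [measurable]: "f \<in> borel_measurable M" "g \<in> borel_measurable M"
     "L2_rep (L2_class M f) \<in> borel_measurable M" "L2_rep (L2_class M g) \<in> borel_measurable M"
    using r f g by (auto simp: L2_fun_def)
  have [measurable]: "cnj \<in> borel_measurable borel"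
    by (intro borel_measurable_continuous_onI continuous_intros)
  show "Inner (L2 M) (L2_class M f) (L2_class M g) = (LINT x|M. f x * cnj (g x))"
    unfolding L2_def cips.simps
    by (rule integral_cong_AE) (measurable, use r in \<open>auto elim: AE_mp\<close>)
qed

section \<open>Linear relations\<close>

text \<open>A linear relation is a linear subspace of \<open>H \<times> H\<close>; its elements \<open>[u f]\<^sup>T\<close> are pairs.\<close>

definition linear_relation :: "'v cips \<Rightarrow> ('v \<times> 'v) set \<Rightarrow> bool" where
  "linear_relation H T \<longleftrightarrow>
     T \<subseteq> Carrier H \<times> Carrier H \<and> (Zero H, Zero H) \<in> T \<and>
     (\<forall>u f v g. (u, f) \<in> T \<longrightarrow> (v, g) \<in> T \<longrightarrow> (Add H u v, Add H f g) \<in> T) \<and>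
     (\<forall>c u f. (u, f) \<in> T \<longrightarrow> (Scale H c u, Scale H c f) \<in> T)"

definition adjoint_rel :: "'v cips \<Rightarrow> ('v \<times> 'v) set \<Rightarrow> ('v \<times> 'v) set" where
  "adjoint_rel H T = {(v, g). v \<in> Carrier H \<and> g \<in> Carrier H \<and>
     (\<forall>(u, f)\<in>T. Inner H f v = Inner H u g)}"

definition symmetric_rel :: "'v cips \<Rightarrow> ('v \<times> 'v) set \<Rightarrow> bool" where
  "symmetric_rel H T \<longleftrightarrow> T \<subseteq> adjoint_rel H T"

definition nonnegative_rel :: "'v cips \<Rightarrow> ('v \<times> 'v) set \<Rightarrow> bool" where
  "nonnegative_rel H T \<longleftrightarrow> (\<forall>(u, f)\<in>T. Inner H f u \<in> \<real>\<^sub>\<ge>\<^sub>0)"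

text \<open>\<open>T - zI\<close> and kernel of a relation.\<close>

definition shift_rel :: "'v cips \<Rightarrow> ('v \<times> 'v) set \<Rightarrow> complex \<Rightarrow> ('v \<times> 'v) set" where
  "shift_rel H T z = {(u, Add H f (Scale H (- z) u)) | u f. (u, f) \<in> T}"

definition ker_rel :: "'v cips \<Rightarrow> ('v \<times> 'v) set \<Rightarrow> 'v set" where
  "ker_rel H T = {u. (u, Zero H) \<in> T}"

definition lincomb :: "'v cips \<Rightarrow> complex list \<Rightarrow> 'v list \<Rightarrow> 'v" where
  "lincomb H as vs = foldr (\<lambda>(a, v) w. Add H (Scale H a v) w) (zip as vs) (Zero H)"

definition lin_indep :: "'v cips \<Rightarrow> 'v list \<Rightarrow> bool" where
  "lin_indep H vs \<longleftrightarrow>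
     (\<forall>as. length as = length vs \<longrightarrow> lincomb H as vs = Zero H \<longrightarrow> (\<forall>a\<in>set as. a = 0))"

text \<open>\<open>V\<close> has a basis of \<open>n\<close> elements.\<close>

definition has_dim :: "'v cips \<Rightarrow> 'v set \<Rightarrow> nat \<Rightarrow> bool" where
  "has_dim H V n \<longleftrightarrow> (\<exists>vs. length vs = n \<and> set vs \<subseteq> V \<and> lin_indep H vs \<and>
     V = {lincomb H as vs | as. length as = n})"

definition deficiency_indices :: "'v cips \<Rightarrow> ('v \<times> 'v) set \<Rightarrow> nat \<Rightarrow> nat \<Rightarrow> bool" where
  "deficiency_indices H T p n \<longleftrightarrow>
     has_dim H (ker_rel H (shift_rel H (adjoint_rel H T) \<i>)) p \<and>
     has_dim H (ker_rel H (shift_rel H (adjoint_rel H T) (- \<i>))) n"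

text \<open>\<open>z\<close> such that \<open>(T - zI)\<inverse>\<close> is (the graph of) a bounded operator defined on all of \<open>H\<close>.\<close>

definition resolvent_set :: "'v cips \<Rightarrow> ('v \<times> 'v) set \<Rightarrow> complex set" where
  "resolvent_set H T = {z.
     (\<forall>g\<in>Carrier H. \<exists>!u. (u, g) \<in> shift_rel H T z) \<and>
     (\<exists>K. \<forall>(u, g)\<in>shift_rel H T z. sqrt (Re (Inner H u u)) \<le> K * sqrt (Re (Inner H g g)))}"

text \<open>The triple \<open>(\<complex>, \<Gamma>\<^sub>0, \<Gamma>\<^sub>1)\<close> for \<open>T\<^sup>*\<close>; only the values of \<open>\<Gamma>\<^sub>0, \<Gamma>\<^sub>1\<close> on \<open>T\<^sup>*\<close> matter.\<close>

definition boundary_triple ::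
    "'v cips \<Rightarrow> ('v \<times> 'v) set \<Rightarrow> ('v \<times> 'v \<Rightarrow> complex) \<Rightarrow> ('v \<times> 'v \<Rightarrow> complex) \<Rightarrow> bool" where
  "boundary_triple H T \<Gamma>0 \<Gamma>1 \<longleftrightarrow>
     symmetric_rel H T \<and> deficiency_indices H T 1 1 \<and>
     (\<forall>\<Gamma>\<in>{\<Gamma>0, \<Gamma>1}.
        (\<forall>(u, f)\<in>adjoint_rel H T. \<forall>(v, g)\<in>adjoint_rel H T.
            \<Gamma> (Add H u v, Add H f g) = \<Gamma> (u, f) + \<Gamma> (v, g)) \<and>
        (\<forall>c. \<forall>(u, f)\<in>adjoint_rel H T. \<Gamma> (Scale H c u, Scale H c f) = c * \<Gamma> (u, f))) \<and>
     (\<forall>(u, f)\<in>adjoint_rel H T. \<forall>(v, g)\<in>adjoint_rel H T.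
        Inner H f v - Inner H u g
          = \<Gamma>1 (u, f) * cnj (\<Gamma>0 (v, g)) - \<Gamma>0 (u, f) * cnj (\<Gamma>1 (v, g))) \<and>
     (\<lambda>w. (\<Gamma>0 w, \<Gamma>1 w)) ` adjoint_rel H T = UNIV"

definition ker_bdry ::
    "'v cips \<Rightarrow> ('v \<times> 'v) set \<Rightarrow> ('v \<times> 'v \<Rightarrow> complex) \<Rightarrow> ('v \<times> 'v) set" where
  "ker_bdry H T \<Gamma> = {w \<in> adjoint_rel H T. \<Gamma> w = 0}"

text \<open>Meaningful for \<open>z\<close> in the resolvent set of \<open>ker \<Gamma>\<^sub>0\<close>.\<close>

definition weyl_function ::
    "'v cips \<Rightarrow> ('v \<times> 'v) set \<Rightarrow> ('v \<times> 'v \<Rightarrow> complex) \<Rightarrow> ('v \<times> 'v \<Rightarrow> complex)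
      \<Rightarrow> complex \<Rightarrow> complex" where
  "weyl_function H T \<Gamma>0 \<Gamma>1 z =
     (THE m. \<forall>u. (u, Scale H z u) \<in> adjoint_rel H T \<longrightarrow>
        m * \<Gamma>0 (u, Scale H z u) = \<Gamma>1 (u, Scale H z u))"

section \<open>Integral systems\<close>

text \<open>
  \<open>u\<^sub>1(x) = u\<^sub>1(0) + \<integral>\<^bsub>[0,x)\<^esub> u\<^sub>2 dR\<^sub>1\<close> and \<open>u\<^sub>2(x) = u\<^sub>2(0) - \<integral>\<^bsub>[0,x)\<^esub> f dR\<^sub>2\<close> on \<open>[0,b)\<close>. The
  integrability conditions are explicit because the library integral of a non-integrable
  function is \<open>0\<close>.
\<close>

definition integral_pair ::
    "ereal \<Rightarrow> (real \<Rightarrow> real) \<Rightarrow> (real \<Rightarrow> real) \<Rightarrow> (real \<Rightarrow> complex) \<Rightarrow> (real \<Rightarrow> complex)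
      \<Rightarrow> (real \<Rightarrow> complex) \<Rightarrow> bool" where
  "integral_pair b R1 R2 u1 u2 f \<longleftrightarrow> (\<forall>x\<in>Ico0 b.
     set_integrable (dR b R1) {0..<x} u2 \<and> set_integrable (dR b R2) {0..<x} f \<and>
     u1 x = u1 0 + (LINT t:{0..<x}|dR b R1. u2 t) \<and>
     u2 x = u2 0 - (LINT t:{0..<x}|dR b R2. f t))"

definition solves_system ::
    "ereal \<Rightarrow> (real \<Rightarrow> real) \<Rightarrow> (real \<Rightarrow> real) \<Rightarrow> complex \<Rightarrow> (real \<Rightarrow> complex) \<Rightarrow> (real \<Rightarrow> complex)
      \<Rightarrow> bool" where
  "solves_system b R1 R2 z u1 u2 \<longleftrightarrow> (\<forall>x\<in>Ico0 b.
     set_integrable (dR b R1) {0..<x} u2 \<and> set_integrable (dR b R2) {0..<x} u1 \<and>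
     u1 x = u1 0 + (LINT t:{0..<x}|dR b R1. u2 t) \<and>
     u2 x = u2 0 - z * (LINT t:{0..<x}|dR b R2. u1 t))"

text \<open>The solution with given initial values; it is unique on \<open>[0,b)\<close>, and arbitrary elsewhere.\<close>

definition system_solution ::
    "ereal \<Rightarrow> (real \<Rightarrow> real) \<Rightarrow> (real \<Rightarrow> real) \<Rightarrow> complex \<Rightarrow> complex \<Rightarrow> complex
      \<Rightarrow> (real \<Rightarrow> complex) \<times> (real \<Rightarrow> complex)" where
  "system_solution b R1 R2 p1 p2 z =
     (SOME (u1, u2). solves_system b R1 R2 z u1 u2 \<and> u1 0 = p1 \<and> u2 0 = p2)"

definition c1_sol where "c1_sol b R1 R2 x z = fst (system_solution b R1 R2 1 0 z) x"
definition c2_sol where "c2_sol b R1 R2 x z = snd (system_solution b R1 R2 1 0 z) x"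
definition s1_sol where "s1_sol b R1 R2 x z = fst (system_solution b R1 R2 0 1 z) x"
definition s2_sol where "s2_sol b R1 R2 x z = snd (system_solution b R1 R2 0 1 z) x"

definition regular_system :: "ereal \<Rightarrow> (real \<Rightarrow> real) \<Rightarrow> (real \<Rightarrow> real) \<Rightarrow> bool" where
  "regular_system b R1 R2 \<longleftrightarrow> R_end b R1 + R_end b R2 < \<infinity>"

definition titchmarsh_weyl ::
    "ereal \<Rightarrow> (real \<Rightarrow> real) \<Rightarrow> (real \<Rightarrow> real) \<Rightarrow> complex \<Rightarrow> complex" where
  "titchmarsh_weyl b R1 R2 z = Lim (at_end b) (\<lambda>x. s1_sol b R1 R2 x z / c1_sol b R1 R2 x z)"

definition neumann_m ::
    "ereal \<Rightarrow> (real \<Rightarrow> real) \<Rightarrow> (real \<Rightarrow> real) \<Rightarrow> complex \<Rightarrow> complex" where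
  "neumann_m b R1 R2 z =
     Lim (at_end b) (\<lambda>x. s2_sol b R1 R2 x z) / Lim (at_end b) (\<lambda>x. c2_sol b R1 R2 x z)"

lemma neumann_m_coefficient:
  assumes "((\<lambda>x. s2_sol b R1 R2 x z) \<longlongrightarrow> s) (at_end b)" "((\<lambda>x. c2_sol b R1 R2 x z) \<longlongrightarrow> c) (at_end b)"
    and "c \<noteq> 0" "0 < b"
  shows "((\<lambda>x. s2_sol b R1 R2 x z - m * c2_sol b R1 R2 x z) \<longlongrightarrow> 0) (at_end b) \<longleftrightarrow> m = neumann_m b R1 R2 z"
proof -
  have nt: "at_end b \<noteq> bot"
    using \<open>0 < b\<close> by (cases b) (auto simp: at_end_PInf at_end_ereal trivial_limit_at_left_real)
  have "((\<lambda>x. s2_sol b R1 R2 x z - m * c2_sol b R1 R2 x z) \<longlongrightarrow> s - m * c) (at_end b)"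
    by (intro tendsto_intros assms)
  then have "((\<lambda>x. s2_sol b R1 R2 x z - m * c2_sol b R1 R2 x z) \<longlongrightarrow> 0) (at_end b) \<longleftrightarrow> s - m * c = 0"
    using tendsto_unique[OF nt] by metis
  also have "neumann_m b R1 R2 z = s / c"
    unfolding neumann_m_def using tendsto_Lim[OF nt] assms(1,2) by metis
  then have "s - m * c = 0 \<longleftrightarrow> m = neumann_m b R1 R2 z"
    using \<open>c \<noteq> 0\<close> by (auto simp: field_simps)
  finally show ?thesis .
qed

definition standing_assumptions :: "ereal \<Rightarrow> (real \<Rightarrow> real) \<Rightarrow> (real \<Rightarrow> real) \<Rightarrow> bool" where
  "standing_assumptions b R1 R2 \<longleftrightarrow>
     (\<forall>x\<in>Ico0 b. continuous (at x within Ico0 b) R1 \<or> continuous (at x within Ico0 b) R2) \<and>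
     (\<exists>b0. 0 < b0 \<and> b0 \<le> b \<and>
        (\<lambda>x. 1) \<in> L2_fun (dR b0 R2) \<and> (\<lambda>x. complex_of_real (R1 x)) \<in> L2_fun (dR b0 R2) \<and>
        lin_indep (L2 (dR b0 R2))
          [L2_class (dR b0 R2) (\<lambda>x. 1), L2_class (dR b0 R2) (\<lambda>x. complex_of_real (R1 x))])"

definition triples :: "ereal \<Rightarrow> (real \<Rightarrow> real) \<Rightarrow> (real \<Rightarrow> real) \<Rightarrow>
    ((real \<Rightarrow> complex) \<times> (real \<Rightarrow> complex) \<times> (real \<Rightarrow> complex)) set" where
  "triples b R1 R2 = {(u1, u2, f).
     f \<in> L2_fun (dR b R2) \<and> u1 \<in> L2_fun (dR b R2) \<and> integral_pair b R1 R2 u1 u2 f}"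

definition T_max :: "ereal \<Rightarrow> (real \<Rightarrow> real) \<Rightarrow> (real \<Rightarrow> real) \<Rightarrow>
    ((real \<Rightarrow> complex) set \<times> (real \<Rightarrow> complex) set) set" where
  "T_max b R1 R2 = {(L2_class (dR b R2) u1, L2_class (dR b R2) f) | u1 u2 f.
     (u1, u2, f) \<in> triples b R1 R2}"

definition limit_circle :: "ereal \<Rightarrow> (real \<Rightarrow> real) \<Rightarrow> (real \<Rightarrow> real) \<Rightarrow> bool" where
  "limit_circle b R1 R2 \<longleftrightarrow>
     (\<forall>z. z \<notin> \<real> \<longrightarrow> has_dim (L2 (dR b R2))
        (ker_rel (L2 (dR b R2)) (shift_rel (L2 (dR b R2)) (T_max b R1 R2) z)) 2)"

definition T_N :: "ereal \<Rightarrow> (real \<Rightarrow> real) \<Rightarrow> (real \<Rightarrow> real) \<Rightarrow>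
    ((real \<Rightarrow> complex) set \<times> (real \<Rightarrow> complex) set) set" where
  "T_N b R1 R2 = {(L2_class (dR b R2) u1, L2_class (dR b R2) f) | u1 u2 f.
     (u1, u2, f) \<in> triples b R1 R2 \<and> u1 0 = 0 \<and> u2 0 = 0 \<and> (u2 \<longlongrightarrow> 0) (at_end b)}"

text \<open>
  \<open>u\<^sub>2(0)\<close> and \<open>-u\<^sub>1(0)\<close> as functions of the element \<open>[\<pi>u\<^sub>1 \<pi>f]\<^sup>T\<close> of \<open>T_max\<close>, by which they are uniquely
  determined under the standing assumptions.
\<close>

definition Gamma0_N :: "ereal \<Rightarrow> (real \<Rightarrow> real) \<Rightarrow> (real \<Rightarrow> real) \<Rightarrow>
    (real \<Rightarrow> complex) set \<times> (real \<Rightarrow> complex) set \<Rightarrow> complex" where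
  "Gamma0_N b R1 R2 w = (THE y. \<exists>u1 u2 f. (u1, u2, f) \<in> triples b R1 R2 \<and>
     w = (L2_class (dR b R2) u1, L2_class (dR b R2) f) \<and> y = u2 0)"

definition Gamma1_N :: "ereal \<Rightarrow> (real \<Rightarrow> real) \<Rightarrow> (real \<Rightarrow> real) \<Rightarrow>
    (real \<Rightarrow> complex) set \<times> (real \<Rightarrow> complex) set \<Rightarrow> complex" where
  "Gamma1_N b R1 R2 w = (THE y. \<exists>u1 u2 f. (u1, u2, f) \<in> triples b R1 R2 \<and>
     w = (L2_class (dR b R2) u1, L2_class (dR b R2) f) \<and> y = - u1 0)"

definition m_N :: "ereal \<Rightarrow> (real \<Rightarrow> real) \<Rightarrow> (real \<Rightarrow> real) \<Rightarrow> complex \<Rightarrow> complex" where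
  "m_N b R1 R2 =
     weyl_function (L2 (dR b R2)) (T_N b R1 R2) (Gamma0_N b R1 R2) (Gamma1_N b R1 R2)"

section \<open>Stieltjes class\<close>

text \<open>
  A function of the class is identified with its holomorphic continuation to
  \<open>\<complex> - [0,\<infinity>)\<close>; its values on \<open>[0,\<infinity>)\<close> are irrelevant.
\<close>

definition stieltjes_class :: "(complex \<Rightarrow> complex) set" where
  "stieltjes_class = {m.
     m holomorphic_on (- \<real>\<^sub>\<ge>\<^sub>0) \<and>
     (\<forall>z. Im z > 0 \<longrightarrow> Im (m z) \<ge> 0) \<and>
     (\<forall>z. z \<notin> \<real> \<longrightarrow> m (cnj z) = cnj (m z)) \<and>
     (\<forall>x::real. x < 0 \<longrightarrow> m (complex_of_real x) \<in> \<real>\<^sub>\<ge>\<^sub>0)}"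

end

theory Submission
  imports Defs
begin

text \<open>
  The hypotheses say that \<open>dR\<^sub>2\<close> is finite, that \<open>R\<^sub>1\<close> is square-integrable for it, and that
  \<open>R\<^sub>1(x) \<rightarrow> \<infinity>\<close>. For \<open>\<lambda> = 0\<close> the first components are spanned by \<open>1\<close> and \<open>R\<^sub>1\<close>, so this is
  the limit circle case at \<open>0\<close>; it has to be reached from non-real parameters. For \<open>\<lambda> = \<i>\<close> the moduli
  \<open>\<bar>c\<^sub>1\<bar>\<close> and \<open>\<bar>s\<^sub>1\<bar>\<close> are nondecreasing, and constancy of the Wronskian prevents \<open>c\<^sub>2\<close> and \<open>s\<^sub>2\<close>
  from both vanishing at \<open>b\<close>; hence one of \<open>\<bar>c\<^sub>1\<bar>\<close>, \<open>\<bar>s\<^sub>1\<bar>\<close> grows at least like a multiple of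
  \<open>R\<^sub>1\<close> (\<open>limit_circle_imp\<close>). If \<open>R\<^sub>1\<close> were bounded, the system would be regular.

  With these facts the differential expression behaves as on a compact interval. Every
  \<open>f\<close> in \<open>L\<^sup>2(R\<^sub>2)\<close> with any initial values gives an element of \<open>T\<^sub>m\<^sub>a\<^sub>x\<close>; the second component has
  the limit \<open>u\<^sub>2(b) = u\<^sub>2(0) - \<integral>f dR\<^sub>2\<close>; and \<open>u\<^sub>1(x) v\<^sub>2(x) \<rightarrow> 0\<close> as soon as \<open>v\<^sub>2(b) = 0\<close>
  (\<open>boundary_term\<close>). Integration by parts on \<open>[0,x)\<close>, where the absence of common jumps enters,
  then yields Green's formula without a contribution from \<open>b\<close>. The range of \<open>T\<^sub>N\<close> consists of all
  \<open>f\<close> of mean zero, which identifies the adjoint (\<open>adjoint_T_N\<close>). Together with Green's formula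
  this gives symmetry, nonnegativity, the boundary triple and, by solving an inhomogeneous problem,
  the resolvent set of the Neumann extension.

  The deficiency spaces are spanned by \<open>\<psi> = s - m c\<close> with \<open>\<psi>\<^sub>2(b) = 0\<close>. Its initial values are
  \<open>(-m, 1)\<close>, so the Weyl function is \<open>m = s\<^sub>2(b)/c\<^sub>2(b)\<close>; and this is also the limit of
  \<open>s\<^sub>1/c\<^sub>1\<close>, since a first component grows like \<open>u\<^sub>2(b) R\<^sub>1\<close>. Holomorphy comes from the Volterra
  series, which makes \<open>c\<^sub>2(b,\<lambda>)\<close> and \<open>s\<^sub>2(b,\<lambda>)\<close> entire. The remaining claims follow from one energy
  identity (\<open>neumann_coefficient_energy\<close>),
  \<open>m(\<lambda>) = \<integral>\<bar>\<psi>\<^sub>2\<bar>\<^sup>2 dR\<^sub>1 - cnj \<lambda> \<cdot> \<integral>\<bar>\<psi>\<^sub>1\<bar>\<^sup>2 dR\<^sub>2\<close>.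
  It shows that \<open>m\<close> is a Stieltjes function. The mean of \<open>\<psi>\<^sub>1\<close> is \<open>1/(\<lambda> R\<^sub>2(b))\<close>, and splitting
  it off splits \<open>-1/(\<lambda> R\<^sub>2(b))\<close> off \<open>m\<close>, leaving an identity of the same shape. For
  \<open>\<lambda> = -t \<rightarrow> -\<infinity>\<close> the first integral alone is at least \<open>dR\<^sub>1([0,a])\<close>, because \<open>\<psi>\<^sub>2 = 1\<close> on
  \<open>[0,a]\<close>, and comparison with a flux that is absorbed on \<open>[0,y)\<close>, \<open>y > a\<close>, bounds \<open>m\<close> by
  \<open>R\<^sub>1(y) + 1/(t R\<^sub>2(y))\<close>.
\<close>

section \<open>The interval \<open>[0,b)\<close> and its right end\<close>

lemma Ico0_zero: "0 < b \<Longrightarrow> 0 \<in> Ico0 b"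
  by (simp add: Ico0_def zero_ereal_def)

lemma Ico0_down: "y \<in> Ico0 b \<Longrightarrow> 0 \<le> x \<Longrightarrow> x \<le> y \<Longrightarrow> x \<in> Ico0 b"
  by (auto simp: Ico0_def) (meson ereal_less_eq(3) le_less_trans)

lemma Ico0_nonneg: "x \<in> Ico0 b \<Longrightarrow> 0 \<le> x"
  by (simp add: Ico0_def)

lemma Ico0_subset: "y \<in> Ico0 b \<Longrightarrow> {0..<y} \<subseteq> Ico0 b"
  by (auto intro: Ico0_down)

lemma Ico0_next: assumes "x \<in> Ico0 b" obtains y where "y \<in> Ico0 b" "x < y"
proof -
  obtain r where "ereal x < ereal r" "ereal r < b"
    using assms ereal_dense2[of "ereal x" b] by (auto simp: Ico0_def)
  with assms that[of r] show ?thesis by (auto simp: Ico0_def)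
qed

lemma eventually_at_end:
  assumes "0 < b"
  shows "eventually P (at_end b) \<longleftrightarrow> (\<exists>y\<in>Ico0 b. \<forall>x\<in>Ico0 b. y \<le> x \<longrightarrow> P x)"
proof (cases b)
  case (real c)
  then have c: "0 < c" using assms by simp
  have "eventually P (at_end b) \<longleftrightarrow> (\<exists>y<c. \<forall>x>y. x < c \<longrightarrow> P x)"
    unfolding real at_end_ereal by (rule eventually_at_left[OF c])
  also have "\<dots> \<longleftrightarrow> (\<exists>y\<in>Ico0 b. \<forall>x\<in>Ico0 b. y \<le> x \<longrightarrow> P x)"
  proof
    assume "\<exists>y<c. \<forall>x>y. x < c \<longrightarrow> P x"
    then obtain y where y: "y < c" "\<And>x. x > y \<Longrightarrow> x < c \<Longrightarrow> P x" by blast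
    have "(max 0 y + c) / 2 \<in> Ico0 b" using y c by (auto simp: Ico0_def real)
    moreover have "\<forall>x\<in>Ico0 b. (max 0 y + c) / 2 \<le> x \<longrightarrow> P x"
      using y c by (auto simp: Ico0_def real intro!: y(2))
    ultimately show "\<exists>y\<in>Ico0 b. \<forall>x\<in>Ico0 b. y \<le> x \<longrightarrow> P x" by blast
  next
    assume "\<exists>y\<in>Ico0 b. \<forall>x\<in>Ico0 b. y \<le> x \<longrightarrow> P x"
    then obtain y where "y \<in> Ico0 b" "\<forall>x\<in>Ico0 b. y \<le> x \<longrightarrow> P x" by blast
    then show "\<exists>y<c. \<forall>x>y. x < c \<longrightarrow> P x"
      by (intro exI[of _ y] conjI allI impI) (simp_all add: Ico0_def real)
  qed
  finally show ?thesis .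
next
  case PInf
  have "(\<exists>N. \<forall>n\<ge>N. P n) \<longleftrightarrow> (\<exists>y\<ge>0. \<forall>x\<ge>0. y \<le> x \<longrightarrow> P x)"
  proof
    assume "\<exists>N. \<forall>n\<ge>N. P n"
    then obtain N where "\<forall>n\<ge>N. P n" by blast
    then show "\<exists>y\<ge>0. \<forall>x\<ge>0. y \<le> x \<longrightarrow> P x" by (intro exI[of _ "max 0 N"]) auto
  next
    assume "\<exists>y\<ge>0. \<forall>x\<ge>0. y \<le> x \<longrightarrow> P x"
    then show "\<exists>N. \<forall>n\<ge>N. P n" by (metis order_trans)
  qed
  then show ?thesis
    unfolding PInf at_end_PInf eventually_at_top_linorder by (simp add: Ico0_def Bex_def Ball_def)
qed (use assms in auto)

lemma at_end_neq_bot: "0 < b \<Longrightarrow> at_end b \<noteq> bot"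
  using eventually_at_end[of b "\<lambda>x. False"] by auto

lemma eventually_at_end_Ico0: "0 < b \<Longrightarrow> eventually (\<lambda>x. x \<in> Ico0 b) (at_end b)"
  by (auto simp: eventually_at_end intro: Ico0_zero)

lemma eventually_at_end_ge: "0 < b \<Longrightarrow> y \<in> Ico0 b \<Longrightarrow> eventually (\<lambda>x. y \<le> x) (at_end b)"
  by (auto simp: eventually_at_end)

lemma Ico0_exhaustion:
  assumes "0 < b"
  obtains y :: "nat \<Rightarrow> real" where "\<And>n. y n \<in> Ico0 b"
    "\<And>x. x \<in> Ico0 b \<Longrightarrow> eventually (\<lambda>n. x < y n) sequentially"
proof (cases b)
  case (real c)
  then have c: "0 < c" using assms by simp
  let ?y = "\<lambda>n::nat. c - c / real (Suc n)"
  have "?y \<longlonglongrightarrow> c - 0" by (intro tendsto_intros lim_const_over_n LIMSEQ_Suc[where f="\<lambda>n. c / real n"])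
  then have "eventually (\<lambda>n. x < ?y n) sequentially" if "x \<in> Ico0 b" for x
    using that by (intro order_tendstoD(1)) (auto simp: Ico0_def real)
  moreover have "?y n \<in> Ico0 b" for n
    using c by (auto simp: Ico0_def real field_simps)
  ultimately show ?thesis using that[of ?y] by blast
next
  case PInf
  have "eventually (\<lambda>n. x < real n) sequentially" for x
    using filterlim_real_sequentially by (simp add: filterlim_at_top_dense)
  then show ?thesis by (intro that[of real]) (auto simp: Ico0_def PInf)
qed (use assms in auto)

section \<open>Locally finite Borel measures on \<open>[0,b)\<close>\<close>

text \<open>
  Solutions of the system, their products and the terms of the Volterra series are all built from the
  left-continuous integral function below, for one of the two measures on \<open>[0,b)\<close>.
\<close>

definition cum :: "real measure \<Rightarrow> (real \<Rightarrow> complex) \<Rightarrow> real \<Rightarrow> complex" where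
  "cum M f x = (LINT t:{0..<x}|M. f t)"

definition locally_integrable :: "ereal \<Rightarrow> real measure \<Rightarrow> (real \<Rightarrow> complex) \<Rightarrow> bool" where
  "locally_integrable b M f \<longleftrightarrow> (\<forall>x\<in>Ico0 b. set_integrable M {0..<x} f)"

text \<open>
  Products are integrated by parts for two such measures, which may be \<open>dR\<^sub>1\<close> and \<open>dR\<^sub>2\<close>, or twice
  \<open>dR\<^sub>1\<close>.
\<close>

locale ico_measure =
  fixes b :: ereal and M :: "real measure"
  assumes b_pos: "0 < b"
    and space_M: "space M = Ico0 b"
    and id_meas [measurable]: "(\<lambda>x. x) \<in> borel_measurable M"
    and fin: "x \<in> Ico0 b \<Longrightarrow> emeasure M {0..<x} < \<infinity>"
begin

lemma borel_Int_sets: "A \<in> sets borel \<Longrightarrow> A \<inter> Ico0 b \<in> sets M"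
  using measurable_sets[OF id_meas, of A] by (simp add: space_M vimage_def Int_def)

lemma borel_sets: "A \<in> sets borel \<Longrightarrow> A \<subseteq> Ico0 b \<Longrightarrow> A \<in> sets M"
  using borel_Int_sets[of A] by (simp add: Int_absorb2)

lemma Ico_sets [simp]: "x \<in> Ico0 b \<Longrightarrow> {0..<x} \<in> sets M"
  by (intro borel_sets) (auto intro: Ico0_down)

lemma borel_measurable_M: "f \<in> borel_measurable borel \<Longrightarrow> f \<in> borel_measurable M"
  using measurable_compose[OF id_meas] by auto

sublocale sigma_finite_measure M
proof
  obtain y where y: "\<And>n. y n \<in> Ico0 b" "\<And>x. x \<in> Ico0 b \<Longrightarrow> eventually (\<lambda>n. x < y n) sequentially"
    using Ico0_exhaustion[OF b_pos] by blast
  show "\<exists>A. countable A \<and> A \<subseteq> sets M \<and> \<Union> A = space M \<and> (\<forall>a\<in>A. emeasure M a \<noteq> \<infinity>)"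
  proof (intro exI[of _ "range (\<lambda>n. {0..<y n})"] conjI)
    show "\<Union> (range (\<lambda>n. {0..<y n})) = space M"
    proof
      show "\<Union> (range (\<lambda>n. {0..<y n})) \<subseteq> space M" using y(1) Ico0_subset by (auto simp: space_M)
      show "space M \<subseteq> \<Union> (range (\<lambda>n. {0..<y n}))"
      proof
        fix x assume "x \<in> space M"
        then have "eventually (\<lambda>n. x < y n) sequentially" "0 \<le> x" using y(2) by (auto simp: space_M Ico0_def)
        then obtain n where "x < y n" by (auto simp: eventually_sequentially)
        with \<open>0 \<le> x\<close> show "x \<in> \<Union> (range (\<lambda>n. {0..<y n}))" by auto
      qed
    qed
  qed (use y fin in \<open>auto simp: less_top\<close>)
qed

lemma locally_integrableD: "locally_integrable b M f \<Longrightarrow> x \<in> Ico0 b \<Longrightarrow> set_integrable M {0..<x} f"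
  by (simp add: locally_integrable_def)

lemma locally_integrable_measurable:
  assumes "locally_integrable b M f"
  shows "f \<in> borel_measurable M"
proof -
  obtain y where y: "\<And>n. y n \<in> Ico0 b" "\<And>x. x \<in> Ico0 b \<Longrightarrow> eventually (\<lambda>n. x < y n) sequentially"
    using Ico0_exhaustion[OF b_pos] by blast
  show ?thesis
  proof (rule borel_measurable_LIMSEQ_metric[where f = "\<lambda>n x. indicator {0..<y n} x *\<^sub>R f x"])
    show "(\<lambda>x. indicat_real {0..<y n} x *\<^sub>R f x) \<in> borel_measurable M" for n
      using locally_integrableD[OF assms y(1)] by (simp add: set_integrable_def borel_measurable_integrable)
    show "(\<lambda>n. indicat_real {0..<y n} x *\<^sub>R f x) \<longlonglongrightarrow> f x" if "x \<in> space M" for x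
    proof (rule tendsto_eventually)
      show "\<forall>\<^sub>F n in sequentially. indicat_real {0..<y n} x *\<^sub>R f x = f x"
        using y(2)[of x] that by (auto elim!: eventually_mono simp: space_M Ico0_def)
    qed
  qed
qed

lemma locally_integrable_bounded:
  assumes [measurable]: "f \<in> borel_measurable M"
    and bd: "\<And>x. x \<in> Ico0 b \<Longrightarrow> \<exists>B. \<forall>t. 0 \<le> t \<longrightarrow> t < x \<longrightarrow> cmod (f t) \<le> B"
  shows "locally_integrable b M f"
  unfolding locally_integrable_def
proof
  fix x assume x: "x \<in> Ico0 b"
  then obtain B where B: "\<And>t. 0 \<le> t \<Longrightarrow> t < x \<Longrightarrow> cmod (f t) \<le> B" using bd by blast
  have [measurable]: "{0..<x} \<in> sets M" using x by simp
  have "integrable M (\<lambda>t. indicator {0..<x} t * \<bar>B\<bar>)"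
    using fin[OF x] by (intro integrable_mult_left integrable_real_indicator) auto
  then show "set_integrable M {0..<x} f" unfolding set_integrable_def
    by (rule Bochner_Integration.integrable_bound) (use B in \<open>auto simp: indicator_def intro!: AE_I2 order_trans[OF B]\<close>)
qed

lemma locally_integrable_mult_bounded:
  assumes f: "locally_integrable b M f" and g [measurable]: "g \<in> borel_measurable M"
    and bd: "\<And>x. x \<in> Ico0 b \<Longrightarrow> \<exists>B. \<forall>t. 0 \<le> t \<longrightarrow> t < x \<longrightarrow> cmod (g t) \<le> B"
  shows "locally_integrable b M (\<lambda>t. f t * g t)"
  unfolding locally_integrable_def
proof
  fix x assume x: "x \<in> Ico0 b"
  then obtain B where B: "\<And>t. 0 \<le> t \<Longrightarrow> t < x \<Longrightarrow> cmod (g t) \<le> B" using bd by blast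
  have [measurable]: "{0..<x} \<in> sets M" using x by simp
  have [measurable]: "f \<in> borel_measurable M" by (rule locally_integrable_measurable[OF f])
  have "integrable M (\<lambda>t. \<bar>B\<bar> *\<^sub>R (indicator {0..<x} t *\<^sub>R f t))"
    using locally_integrableD[OF f x] unfolding set_integrable_def by (rule integrable_scaleR_right)
  then show "set_integrable M {0..<x} (\<lambda>t. f t * g t)" unfolding set_integrable_def
  proof (rule Bochner_Integration.integrable_bound)
    show "AE t in M. norm (indicat_real {0..<x} t *\<^sub>R (f t * g t)) \<le> norm (\<bar>B\<bar> *\<^sub>R indicat_real {0..<x} t *\<^sub>R f t)"
    proof (intro AE_I2)
      fix t
      show "norm (indicat_real {0..<x} t *\<^sub>R (f t * g t)) \<le> norm (\<bar>B\<bar> *\<^sub>R indicat_real {0..<x} t *\<^sub>R f t)"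
        using B[of t] mult_right_mono[of "cmod (g t)" "\<bar>B\<bar>" "cmod (f t)"]
        by (auto simp: indicator_def norm_mult mult.commute)
    qed
  qed measurable
qed

lemma integrable_locally: "integrable M f \<Longrightarrow> locally_integrable b M f"
  unfolding locally_integrable_def set_integrable_def
  by (auto intro!: integrable_mult_indicator)

lemma locally_integrable_add:
  "locally_integrable b M f \<Longrightarrow> locally_integrable b M g \<Longrightarrow> locally_integrable b M (\<lambda>t. f t + g t)"
  unfolding locally_integrable_def by auto

lemma locally_integrable_diff:
  "locally_integrable b M f \<Longrightarrow> locally_integrable b M g \<Longrightarrow> locally_integrable b M (\<lambda>t. f t - g t)"
  unfolding locally_integrable_def by auto

lemma locally_integrable_scale:
  "locally_integrable b M f \<Longrightarrow> locally_integrable b M (\<lambda>t. c * f t)"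
  unfolding locally_integrable_def by auto

lemma locally_integrable_const: "locally_integrable b M (\<lambda>t. c)"
  by (rule locally_integrable_bounded) auto

lemma locally_integrable_cnj:
  "locally_integrable b M f \<Longrightarrow> locally_integrable b M (\<lambda>t. cnj (f t))"
proof -
  assume f: "locally_integrable b M f"
  have "integrable M (\<lambda>t. cnj (indicator {0..<x} t *\<^sub>R f t))" if "x \<in> Ico0 b" for x
    using locally_integrableD[OF f that] unfolding set_integrable_def by (rule integrable_cnj)
  then show ?thesis unfolding locally_integrable_def set_integrable_def by simp
qed

lemma cum_add:
  assumes "locally_integrable b M f" "locally_integrable b M g" "x \<in> Ico0 b"
  shows "cum M (\<lambda>t. f t + g t) x = cum M f x + cum M g x"
  using assms unfolding cum_def by (simp add: locally_integrable_def)

lemma cum_diff: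
  assumes "locally_integrable b M f" "locally_integrable b M g" "x \<in> Ico0 b"
  shows "cum M (\<lambda>t. f t - g t) x = cum M f x - cum M g x"
  using assms unfolding cum_def by (simp add: locally_integrable_def)

lemma cum_scale: "cum M (\<lambda>t. c * f t) x = c * cum M f x"
  unfolding cum_def by simp

lemma cum_cnj: "cum M (\<lambda>t. cnj (f t)) x = cnj (cum M f x)"
proof -
  have "(\<integral>t. cnj (indicator {0..<x} t *\<^sub>R f t) \<partial>M) = cnj (\<integral>t. indicator {0..<x} t *\<^sub>R f t \<partial>M)"
    by (rule Bochner_Integration.integral_cnj)
  then show ?thesis unfolding cum_def set_lebesgue_integral_def by simp
qed

lemma cum_0 [simp]: "cum M f 0 = 0"
  unfolding cum_def set_lebesgue_integral_def by simp

lemma cum_cong: "x \<in> Ico0 b \<Longrightarrow> (\<And>t. t \<in> Ico0 b \<Longrightarrow> t < x \<Longrightarrow> f t = g t) \<Longrightarrow> cum M f x = cum M g x"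
  unfolding cum_def using Ico0_subset[of x b] by (intro set_lebesgue_integral_cong) auto

lemma locally_integrable_cong:
  "(\<And>t. t \<in> Ico0 b \<Longrightarrow> f t = g t) \<Longrightarrow> locally_integrable b M f \<longleftrightarrow> locally_integrable b M g"
proof -
  assume eq: "\<And>t. t \<in> Ico0 b \<Longrightarrow> f t = g t"
  have "integrable M (\<lambda>t. indicator {0..<x} t *\<^sub>R f t) \<longleftrightarrow> integrable M (\<lambda>t. indicator {0..<x} t *\<^sub>R g t)" for x
    by (rule Bochner_Integration.integrable_cong) (auto simp: eq space_M)
  then show ?thesis by (simp add: locally_integrable_def set_integrable_def)
qed

lemma cum_AE_cong:
  assumes "AE t in M. f t = g t" "f \<in> borel_measurable M" "g \<in> borel_measurable M" "x \<in> Ico0 b"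
  shows "cum M f x = cum M g x"
  unfolding cum_def set_lebesgue_integral_def
  using assms by (intro integral_cong_AE) (auto elim!: AE_mp)

lemma norm_cum_le_cum:
  assumes f: "locally_integrable b M f" and x: "x \<in> Ico0 b"
  shows "cmod (cum M f x) \<le> (LINT t:{0..<x}|M. cmod (f t))"
  unfolding cum_def
  using set_integral_norm_bound[OF locally_integrableD[OF f x]] .

lemma cum_norm_mono:
  assumes f: "locally_integrable b M f" and x: "x \<in> Ico0 b" and y: "0 \<le> y" "y \<le> x"
  shows "cmod (cum M f y) \<le> (LINT t:{0..<x}|M. cmod (f t))"
proof -
  have yI: "y \<in> Ico0 b" using x y by (rule Ico0_down)
  have "cmod (cum M f y) \<le> (LINT t:{0..<y}|M. cmod (f t))" by (rule norm_cum_le_cum[OF f yI])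
  also have "\<dots> \<le> (LINT t:{0..<x}|M. cmod (f t))"
  proof -
    have "set_integrable M {0..<x} (\<lambda>t. cmod (f t))" 
      using locally_integrableD[OF f x] by (rule set_integrable_norm)
    moreover have "set_integrable M {0..<y} (\<lambda>t. cmod (f t))" 
      using locally_integrableD[OF f yI] by (rule set_integrable_norm)
    ultimately show ?thesis unfolding set_lebesgue_integral_def set_integrable_def
      using y by (intro integral_mono) (auto simp: indicator_def)
  qed
  finally show ?thesis .
qed

lemma cum_locally_bounded:
  assumes f: "locally_integrable b M f" and x: "x \<in> Ico0 b"
  shows "\<exists>B. \<forall>t. 0 \<le> t \<longrightarrow> t < x \<longrightarrow> cmod (k + cum M f t) \<le> B"
proof (intro exI allI impI)
  fix t :: real assume "0 \<le> t" "t < x"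
  then show "cmod (k + cum M f t) \<le> cmod k + (LINT t:{0..<x}|M. cmod (f t))"
    using cum_norm_mono[OF f x, of t] norm_triangle_ineq[of k "cum M f t"] by linarith
qed

lemma cum_measurable:
  assumes [measurable]: "f \<in> borel_measurable M" and N: "ico_measure b N"
  shows "cum M f \<in> borel_measurable N"
proof -
  interpret N: ico_measure b N by fact
  have "(\<lambda>x. \<integral>t. (if 0 \<le> t \<and> t < x then f t else 0) \<partial>M) \<in> borel_measurable N"
    by measurable
  moreover have "cum M f = (\<lambda>x. \<integral>t. (if 0 \<le> t \<and> t < x then f t else 0) \<partial>M)"
    unfolding cum_def set_lebesgue_integral_def by (intro ext Bochner_Integration.integral_cong) (auto simp: indicator_def)
  ultimately show ?thesis by simp
qed

subsection \<open>Limits at the right end\<close>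

text \<open>
  The tails decrease in \<open>x\<close>, so dominated convergence along one exhausting sequence suffices.
\<close>

lemma tail_tendsto:
  fixes f :: "real \<Rightarrow> real"
  assumes f: "integrable M f" and nn: "\<And>t. 0 \<le> f t"
  shows "((\<lambda>x. \<integral>t. indicator {x..} t * f t \<partial>M) \<longlongrightarrow> 0) (at_end b)"
proof -
  have [measurable]: "f \<in> borel_measurable M" using f by auto
  let ?T = "\<lambda>x. \<integral>t. indicator {x..} t * f t \<partial>M"
  have int: "integrable M (\<lambda>t. indicator {x..} t * f t)" for x
    by (rule Bochner_Integration.integrable_bound[OF f]) (auto simp: indicator_def)
  have anti: "?T y \<le> ?T x" if "x \<le> y" for x y
    using that nn by (intro integral_mono int) (auto simp: indicator_def)
  have pos: "0 \<le> ?T x" for x using nn by (intro integral_nonneg_AE) auto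
  obtain y where y: "\<And>n. y n \<in> Ico0 b" "\<And>x. x \<in> Ico0 b \<Longrightarrow> eventually (\<lambda>n. x < y n) sequentially"
    using Ico0_exhaustion[OF b_pos] by blast
  have "(\<lambda>n. ?T (y n)) \<longlonglongrightarrow> (\<integral>t. 0 \<partial>M)"
  proof (rule integral_dominated_convergence[where w = f])
    show "AE t in M. (\<lambda>n. indicat_real {y n..} t * f t) \<longlonglongrightarrow> 0"
    proof (intro AE_I2)
      fix t assume "t \<in> space M"
      then have "eventually (\<lambda>n. t < y n) sequentially" using y(2) by (simp add: space_M)
      then show "(\<lambda>n. indicat_real {y n..} t * f t) \<longlonglongrightarrow> 0"
        by (intro tendsto_eventually) (auto elim!: eventually_mono)
    qed
  qed (use f nn in \<open>auto simp: indicator_def\<close>)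
  then have lim: "(\<lambda>n. ?T (y n)) \<longlonglongrightarrow> 0" by simp
  show ?thesis
  proof (rule order_tendstoI)
    fix e :: real assume "0 < e"
    then have "eventually (\<lambda>n. ?T (y n) < e) sequentially" using lim by (intro order_tendstoD)
    then obtain n where n: "?T (y n) < e" by (auto simp: eventually_sequentially)
    show "\<forall>\<^sub>F x in at_end b. ?T x < e"
      using eventually_at_end_ge[OF b_pos y(1)[of n]] 
      by eventually_elim (use anti n in \<open>meson le_less_trans\<close>)
  next
    fix e :: real assume "e < 0"
    then have "e < ?T x" for x using pos[of x] by linarith
    then show "\<forall>\<^sub>F x in at_end b. e < ?T x" by simp
  qed
qed

lemma integral_split_at:
  assumes f: "integrable M f" and x: "x \<in> Ico0 b"
  shows "(\<integral>t. f t \<partial>M) = cum M f x + (\<integral>t. indicator {x..} t *\<^sub>R f t \<partial>M)"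
proof -
  have [measurable]: "f \<in> borel_measurable M" using f by auto
  have i1: "integrable M (\<lambda>t. indicator {x..} t *\<^sub>R f t)"
    by (rule Bochner_Integration.integrable_bound[OF f]) (auto simp: indicator_def)
  have i2: "integrable M (\<lambda>t. indicator {0..<x} t *\<^sub>R f t)"
    by (rule Bochner_Integration.integrable_bound[OF f]) (auto simp: indicator_def)
  have "(\<integral>t. f t \<partial>M) = (\<integral>t. indicator {0..<x} t *\<^sub>R f t + indicator {x..} t *\<^sub>R f t \<partial>M)"
    by (intro Bochner_Integration.integral_cong) (auto simp: indicator_def space_M Ico0_def)
  then show ?thesis using i1 i2 by (simp add: cum_def set_lebesgue_integral_def)
qed

lemma tail_norm_le:
  assumes f: "integrable M f" and x: "x \<in> Ico0 b"
  shows "cmod ((\<integral>t. f t \<partial>M) - cum M f x) \<le> (\<integral>t. indicator {x..} t * cmod (f t) \<partial>M)"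
proof -
  have "cmod (\<integral>t. indicator {x..} t *\<^sub>R f t \<partial>M) \<le> (\<integral>t. norm (indicator {x..} t *\<^sub>R f t) \<partial>M)"
    by (rule integral_norm_bound)
  then show ?thesis using integral_split_at[OF f x] by (simp add: mult_ac)
qed

lemma cum_tendsto:
  assumes f: "integrable M f"
  shows "(cum M f \<longlongrightarrow> (\<integral>t. f t \<partial>M)) (at_end b)"
proof -
  have "((\<lambda>x. \<integral>t. indicator {x..} t * cmod (f t) \<partial>M) \<longlongrightarrow> 0) (at_end b)"
    using f by (intro tail_tendsto) auto
  then have "((\<lambda>x. (\<integral>t. f t \<partial>M) - cum M f x) \<longlongrightarrow> 0) (at_end b)"
    by (rule Lim_null_comparison[rotated])
      (use eventually_at_end_Ico0[OF b_pos] in eventually_elim, rule tail_norm_le[OF f])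
  from tendsto_diff[OF tendsto_const this, of "\<integral>t. f t \<partial>M"] show ?thesis by simp
qed

end

subsection \<open>Integration by parts\<close>

locale ico_pair = M: ico_measure b M + N: ico_measure b N for b M N
begin

sublocale pair_sigma_finite M N ..

lemma integrable_mult:
  assumes "integrable M f" "integrable N g"
  shows "integrable (M \<Otimes>\<^sub>M N) (\<lambda>(s, t). f s * (g t :: complex))"
proof (rule Fubini_integrable)
  have [measurable]: "f \<in> borel_measurable M" "g \<in> borel_measurable N" using assms by auto
  show "(\<lambda>(s, t). f s * g t) \<in> borel_measurable (M \<Otimes>\<^sub>M N)" by measurable
  show "integrable M (\<lambda>s. \<integral>t. norm (case (s, t) of (s, t) \<Rightarrow> f s * g t) \<partial>N)"
    using assms by (simp add: norm_mult)
  show "AE s in M. integrable N (\<lambda>t. case (s, t) of (s, t) \<Rightarrow> f s * g t)"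
    using assms by simp
qed

lemma point_integral:
  assumes "s \<in> Ico0 b"
  shows "(\<integral>t. (if t = s then g t else 0) \<partial>N) = g s * complex_of_real (measure N {s})"
proof -
  have s: "{s} \<in> sets N" using assms by (intro N.borel_sets) auto
  obtain y where y: "y \<in> Ico0 b" "s < y" by (rule Ico0_next[OF assms])
  have "emeasure N {s} \<le> emeasure N {0..<y}"
    using y Ico0_nonneg[OF assms] by (intro emeasure_mono N.Ico_sets) auto
  then have fin: "emeasure N {s} < \<infinity>" using N.fin[OF y(1)] by (rule le_less_trans)
  have "(\<integral>t. (if t = s then g t else 0) \<partial>N) = (\<integral>t. indicator {s} t *\<^sub>R g s \<partial>N)"
    by (rule Bochner_Integration.integral_cong) (auto simp: indicator_def)
  also have "\<dots> = measure N {s} *\<^sub>R g s"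
    by (subst integral_scaleR_left) (use integrable_real_indicator[OF s fin] s assms in \<open>auto simp: N.space_M\<close>)
  finally show ?thesis by (simp add: scaleR_conv_of_real mult.commute)
qed

text \<open>
  Split the rectangle \<open>[0,x) \<times> [0,x)\<close> into the parts below and above the diagonal and the diagonal
  itself, and apply Fubini's theorem to each. The diagonal contributes the common atoms.
\<close>

lemma cum_mult:
  assumes f: "locally_integrable b M f" and g: "locally_integrable b N g" and x: "x \<in> Ico0 b"
  shows "cum M f x * cum N g x = cum M (\<lambda>s. f s * cum N g s) x + cum N (\<lambda>t. cum M f t * g t) x
    + cum M (\<lambda>s. f s * (g s * complex_of_real (measure N {s}))) x"
proof -
  define f' where "f' s = indicator {0..<x} s *\<^sub>R f s" for s
  define g' where "g' t = indicator {0..<x} t *\<^sub>R g t" for t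
  have f'i: "integrable M f'" and g'i: "integrable N g'"
    using M.locally_integrableD[OF f x] N.locally_integrableD[OF g x]
    by (simp_all add: f'_def[abs_def] g'_def[abs_def] set_integrable_def)
  have [measurable]: "f' \<in> borel_measurable M" "g' \<in> borel_measurable N" using f'i g'i by auto
  define V where "V s = (\<integral>t. (if t < s then g' t else 0) \<partial>N)" for s
  define D where "D s = (\<integral>t. (if t = s then g' t else 0) \<partial>N)" for s
  define U where "U s = (\<integral>t. (if s < t then g' t else 0) \<partial>N)" for s
  have [measurable]: "(\<lambda>x. x) \<in> borel_measurable M" "(\<lambda>x. x) \<in> borel_measurable N"
    by (rule M.id_meas N.id_meas)+
  have [measurable]: "V \<in> borel_measurable M" "D \<in> borel_measurable M" "U \<in> borel_measurable M"
    unfolding V_def[abs_def] D_def[abs_def] U_def[abs_def] by measurable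
  have gi: "integrable N (\<lambda>t. if t < s then g' t else 0)" "integrable N (\<lambda>t. if t = s then g' t else 0)"
     "integrable N (\<lambda>t. if s < t then g' t else 0)" for s
    by (rule Bochner_Integration.integrable_bound[OF g'i]; auto)+
  let ?B = "\<integral>t. norm (g' t) \<partial>N"
  have bound: "norm (V s) \<le> ?B" "norm (D s) \<le> ?B" "norm (U s) \<le> ?B" for s
    unfolding V_def D_def U_def
    by (rule order_trans[OF integral_norm_bound integral_mono];
        use gi[of s] g'i in \<open>auto intro!: integrable_norm\<close>)+
  have int: "integrable M (\<lambda>s. f' s * h s)" 
    if [measurable]: "h \<in> borel_measurable M" and "\<And>s. norm (h s) \<le> ?B" for h
  proof (rule Bochner_Integration.integrable_bound)
    show "integrable M (\<lambda>s. ?B *\<^sub>R f' s)" using f'i by simp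
    have "0 \<le> ?B" by simp
    then show "AE s in M. norm (f' s * h s) \<le> norm (?B *\<^sub>R f' s)"
      using that(2) by (auto intro!: AE_I2 simp: norm_mult mult.commute[of "norm (f' _)"] mult_right_mono)
  qed measurable
  have "cum M f x * cum N g x = (\<integral>s. f' s * (\<integral>t. g' t \<partial>N) \<partial>M)"
    unfolding cum_def set_lebesgue_integral_def f'_def[symmetric] g'_def[symmetric]
    by simp
  also have "\<dots> = (\<integral>s. f' s * V s + f' s * U s + f' s * D s \<partial>M)"
  proof (intro Bochner_Integration.integral_cong refl)
    fix s
    have "(\<integral>t. g' t \<partial>N) = (\<integral>t. (if t < s then g' t else 0) + (if s < t then g' t else 0) + (if t = s then g' t else 0) \<partial>N)"
      by (intro Bochner_Integration.integral_cong) auto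
    also have "\<dots> = V s + U s + D s" using gi[of s] by (simp add: V_def D_def U_def)
    finally show "f' s * (\<integral>t. g' t \<partial>N) = f' s * V s + f' s * U s + f' s * D s" by (simp add: algebra_simps)
  qed
  also have "\<dots> = (\<integral>s. f' s * V s \<partial>M) + (\<integral>s. f' s * U s \<partial>M) + (\<integral>s. f' s * D s \<partial>M)"
    using int[of V] int[of U] int[of D] bound by simp
  also have "(\<integral>s. f' s * V s \<partial>M) = cum M (\<lambda>s. f s * cum N g s) x"
    unfolding cum_def[of M] set_lebesgue_integral_def
  proof (intro Bochner_Integration.integral_cong refl)
    fix s
    have "V s = cum N g s" if "s < x"
      unfolding V_def cum_def set_lebesgue_integral_def g'_def using that
      by (intro Bochner_Integration.integral_cong) (auto simp: indicator_def N.space_M Ico0_def)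
    then show "f' s * V s = indicat_real {0..<x} s *\<^sub>R (f s * cum N g s)"
      by (auto simp: f'_def indicator_def)
  qed
  also have "(\<integral>s. f' s * U s \<partial>M) = (\<integral>s. (\<integral>t. (if s < t then f' s * g' t else 0) \<partial>N) \<partial>M)"
  proof (intro Bochner_Integration.integral_cong refl)
    fix s
    have "(\<integral>t. (if s < t then f' s * g' t else 0) \<partial>N) = (\<integral>t. f' s * (if s < t then g' t else 0) \<partial>N)"
      by (intro Bochner_Integration.integral_cong) auto
    then show "f' s * U s = (\<integral>t. (if s < t then f' s * g' t else 0) \<partial>N)" by (simp add: U_def)
  qed
  also have "\<dots> = (\<integral>t. (\<integral>s. (if s < t then f' s * g' t else 0) \<partial>M) \<partial>N)"
  proof (rule Fubini_integral[symmetric], rule Bochner_Integration.integrable_bound[OF integrable_mult[OF f'i g'i]])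
    show "(\<lambda>(s, t). if s < t then f' s * g' t else 0) \<in> borel_measurable (M \<Otimes>\<^sub>M N)" by measurable
  qed auto
  also have "\<dots> = (\<integral>t. (\<integral>s. (if s < t then f' s else 0) \<partial>M) * g' t \<partial>N)"
  proof (intro Bochner_Integration.integral_cong refl)
    fix t
    have "(\<integral>s. (if s < t then f' s * g' t else 0) \<partial>M) = (\<integral>s. (if s < t then f' s else 0) * g' t \<partial>M)"
      by (intro Bochner_Integration.integral_cong) auto
    then show "(\<integral>s. (if s < t then f' s * g' t else 0) \<partial>M) = (\<integral>s. (if s < t then f' s else 0) \<partial>M) * g' t"
      by simp
  qed
  also have "\<dots> = cum N (\<lambda>t. cum M f t * g t) x"
    unfolding cum_def[of N] set_lebesgue_integral_def
  proof (intro Bochner_Integration.integral_cong refl)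
    fix t
    have "(\<integral>s. (if s < t then f' s else 0) \<partial>M) = cum M f t" if "t < x"
      unfolding cum_def set_lebesgue_integral_def f'_def using that
      by (intro Bochner_Integration.integral_cong) (auto simp: indicator_def M.space_M Ico0_def)
    then show "(\<integral>s. (if s < t then f' s else 0) \<partial>M) * g' t = indicat_real {0..<x} t *\<^sub>R (cum M f t * g t)"
      by (auto simp: g'_def indicator_def)
  qed
  also have "(\<integral>s. f' s * D s \<partial>M) = cum M (\<lambda>s. f s * (g s * complex_of_real (measure N {s}))) x"
    unfolding cum_def set_lebesgue_integral_def
  proof (intro Bochner_Integration.integral_cong refl)
    fix s assume s: "s \<in> space M"
    then have "D s = g' s * complex_of_real (measure N {s})"
      unfolding D_def M.space_M by (rule point_integral)
    then show "f' s * D s = indicat_real {0..<x} s *\<^sub>R (f s * (g s * complex_of_real (measure N {s})))"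
      by (auto simp: f'_def g'_def indicator_def)
  qed
  finally show ?thesis .
qed

text \<open>
  There are only countably many atoms of the second measure, and each is a null set of the first; so
  the diagonal carries no mass.
\<close>

lemma integration_by_parts:
  assumes f: "locally_integrable b M f" and g: "locally_integrable b N g" and x: "x \<in> Ico0 b"
    and F: "\<And>x. x \<in> Ico0 b \<Longrightarrow> F x = F 0 + cum M f x"
    and G: "\<And>x. x \<in> Ico0 b \<Longrightarrow> G x = G 0 + cum N g x"
    and no_common_atoms: "\<And>s. s \<in> Ico0 b \<Longrightarrow> measure M {s} = 0 \<or> measure N {s} = 0"
  shows "F x * G x = F 0 * G 0 + cum M (\<lambda>s. f s * G s) x + cum N (\<lambda>t. F t * g t) x"
proof -
  have [measurable]: "cum N g \<in> borel_measurable M" "cum M f \<in> borel_measurable N"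
    using N.locally_integrable_measurable[OF g] M.locally_integrable_measurable[OF f]
    by (auto intro: N.cum_measurable M.cum_measurable M.ico_measure_axioms N.ico_measure_axioms)
  have 1: "locally_integrable b M (\<lambda>s. f s * cum N g s)"
    using N.cum_locally_bounded[OF g, of _ 0] by (intro M.locally_integrable_mult_bounded f) auto
  have 2: "locally_integrable b N (\<lambda>t. cum M f t * g t)"
    using N.locally_integrable_mult_bounded[OF g, of "cum M f"] M.cum_locally_bounded[OF f, of _ 0]
    by (simp add: mult.commute)
  have f0: "locally_integrable b M (\<lambda>s. G 0 * f s)" and g0: "locally_integrable b N (\<lambda>s. F 0 * g s)"
    by (intro M.locally_integrable_scale N.locally_integrable_scale f g)+
  have d: "cum M (\<lambda>s. f s * (g s * complex_of_real (measure N {s}))) x = 0"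
  proof -
    let ?A = "{s \<in> Ico0 b \<inter> {0..<x}. measure N {s} \<noteq> 0}"
    have cA: "countable ?A"
    proof -
      let ?N = "restrict_space N {0..<x}"
      have xs: "{0..<x} \<inter> space N \<in> sets N" "{0..<x} \<subseteq> space N"
        using x Ico0_subset[OF x] by (auto simp: N.space_M Int_absorb2)
      have "finite_measure ?N"
        by (rule finite_measureI) (use xs N.fin[OF x] in \<open>auto simp: space_restrict_space Int_absorb2 emeasure_restrict_space less_top\<close>)
      then have "countable {s. measure ?N {s} \<noteq> 0}" by (rule finite_measure.countable_support)
      moreover have "?A \<subseteq> {s. measure ?N {s} \<noteq> 0}"
        using xs by (auto simp: measure_restrict_space)
      ultimately show ?thesis by (rule countable_subset[rotated])
    qed
    have "?A = (\<Union>s\<in>?A. {s})" by auto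
    also have "(\<Union>s\<in>?A. {s}) \<in> null_sets M"
    proof (rule null_sets_UN'[OF cA])
      fix s assume s: "s \<in> ?A"
      then have "measure M {s} = 0" using no_common_atoms by auto
      moreover obtain y where y: "y \<in> Ico0 b" "s < y" using s Ico0_next by auto
      have "emeasure M {s} \<le> emeasure M {0..<y}"
        using y s by (intro emeasure_mono M.Ico_sets) auto
      then have "emeasure M {s} \<noteq> \<infinity>" using M.fin[OF y(1)] by (auto simp: top_unique)
      ultimately have "emeasure M {s} = 0" by (simp add: emeasure_eq_ennreal_measure)
      moreover have "{s} \<in> sets M" using s by (intro M.borel_sets) auto
      ultimately show "{s} \<in> null_sets M" by auto
    qed
    finally have "AE s in M. s \<notin> ?A" by (rule AE_not_in)
    then have "AE s in M. indicator {0..<x} s *\<^sub>R (f s * (g s * complex_of_real (measure N {s}))) = 0"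
      by (rule AE_mp) (auto intro!: AE_I2 simp: indicator_def M.space_M)
    then show ?thesis unfolding cum_def set_lebesgue_integral_def by (rule integral_eq_zero_AE)
  qed
  have "cum M (\<lambda>s. f s * G s) x = cum M (\<lambda>s. G 0 * f s + f s * cum N g s) x"
    by (intro M.cum_cong[OF x]) (simp add: G algebra_simps)
  also have "\<dots> = G 0 * cum M f x + cum M (\<lambda>s. f s * cum N g s) x"
    by (simp add: M.cum_add[OF f0 1 x] M.cum_scale)
  finally have 3: "cum M (\<lambda>s. f s * G s) x = G 0 * cum M f x + cum M (\<lambda>s. f s * cum N g s) x" .
  have "cum N (\<lambda>t. F t * g t) x = cum N (\<lambda>t. F 0 * g t + cum M f t * g t) x"
    by (intro N.cum_cong[OF x]) (simp add: F algebra_simps)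
  also have "\<dots> = F 0 * cum N g x + cum N (\<lambda>t. cum M f t * g t) x"
    by (simp add: N.cum_add[OF g0 2 x] N.cum_scale)
  finally show ?thesis
    using 3 cum_mult[OF f g x] d by (simp add: F[OF x] G[OF x] algebra_simps)
qed

end

text \<open>
  Integrate \<open>F \<cdot> cnj F\<close> by parts, keeping the common atoms. The density of \<open>\<bar>F\<bar>\<^sup>2\<close> is then twice the
  real part of \<open>cnj F \<cdot> f\<close> plus \<open>\<bar>f\<bar>\<^sup>2\<close> at the atoms, and both are nonnegative.
\<close>

lemma (in ico_measure) norm_nondecreasing:
  assumes f: "locally_integrable b M f"
    and F: "\<And>x. x \<in> Ico0 b \<Longrightarrow> F x = F 0 + cum M f x"
    and nn: "\<And>t. t \<in> Ico0 b \<Longrightarrow> 0 \<le> Re (cnj (F t) * f t)"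
    and x: "x \<in> Ico0 b" and y: "y \<in> Ico0 b" "x \<le> y"
  shows "cmod (F x) \<le> cmod (F y)"
proof -
  interpret ico_pair b M M ..
  have m: "cum M f \<in> borel_measurable M"
    using locally_integrable_measurable[OF f] ico_measure_axioms by (rule cum_measurable)
  define h where "h s = 2 * Re (cnj (F s) * f s) + (cmod (f s))\<^sup>2 * measure M {s}" for s
  have hnn: "0 \<le> h s" if "s \<in> Ico0 b" for s using nn[OF that] by (simp add: h_def)
  have sq: "complex_of_real ((cmod (F x))\<^sup>2) = complex_of_real ((cmod (F 0))\<^sup>2) + cum M (\<lambda>s. complex_of_real (h s)) x"
    and hi: "set_integrable M {0..<x} (\<lambda>s. complex_of_real (h s))"
    if x: "x \<in> Ico0 b" for x
  proof -
    note f' = locally_integrable_cnj[OF f]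
    have p1: "locally_integrable b M (\<lambda>s. f s * cum M (\<lambda>t. cnj (f t)) s)"
      by (rule locally_integrable_mult_bounded[OF f])
        (use cum_locally_bounded[OF f', of _ 0] cum_measurable[OF locally_integrable_measurable[OF f'] ico_measure_axioms] in auto)
    have p2: "locally_integrable b M (\<lambda>s. cum M f s * cnj (f s))"
      using locally_integrable_mult_bounded[OF f' m] cum_locally_bounded[OF f, of _ 0] by (simp add: mult.commute)
    define q where "q s = f s * (cnj (f s) * complex_of_real (measure M {s}))" for s
    have "locally_integrable b M (\<lambda>s. f s * (\<integral>t. (if t = s then cnj (f t) else 0) \<partial>M))"
    proof -
      have [measurable]: "f \<in> borel_measurable M" by (rule locally_integrable_measurable[OF f])
      show ?thesis
      proof (rule locally_integrable_mult_bounded[OF f])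
        have [measurable]: "(\<lambda>t. cnj (f t)) \<in> borel_measurable M" by (rule locally_integrable_measurable[OF f'])
        show "(\<lambda>s. \<integral>t. (if t = s then cnj (f t) else 0) \<partial>M) \<in> borel_measurable M" by measurable
        fix x assume x: "x \<in> Ico0 b"
        show "\<exists>B. \<forall>t\<ge>0. t < x \<longrightarrow> cmod (\<integral>s. (if s = t then cnj (f s) else 0) \<partial>M) \<le> B"
        proof (intro exI allI impI)
          fix t assume t: "0 \<le> t" "t < x"
          have "cmod (\<integral>s. (if s = t then cnj (f s) else 0) \<partial>M) \<le> (\<integral>s. norm (if s = t then cnj (f s) else 0) \<partial>M)"
            by (rule integral_norm_bound)
          also have "\<dots> \<le> (\<integral>s. norm (indicator {0..<x} s *\<^sub>R f s) \<partial>M)"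
          proof (rule integral_mono)
            have i: "integrable M (\<lambda>s. indicator {0..<x} s *\<^sub>R f s)"
              using locally_integrableD[OF f x] by (simp only: set_integrable_def)
            show "integrable M (\<lambda>s. norm (indicat_real {0..<x} s *\<^sub>R f s))" using i by (rule integrable_norm)
            show "integrable M (\<lambda>s. norm (if s = t then cnj (f s) else 0))"
              by (rule integrable_norm, rule Bochner_Integration.integrable_bound[OF i])
                (measurable, use t in \<open>auto simp: indicator_def\<close>)
          qed (use t in \<open>auto simp: indicator_def\<close>)
          finally show "cmod (\<integral>s. (if s = t then cnj (f s) else 0) \<partial>M) \<le> (\<integral>s. norm (indicator {0..<x} s *\<^sub>R f s) \<partial>M)" .
        qed
      qed
    qed
    then have p3: "locally_integrable b M q"
      using locally_integrable_cong[of q "\<lambda>s. f s * (\<integral>t. (if t = s then cnj (f t) else 0) \<partial>M)"]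
      by (simp add: point_integral q_def)
    have f0: "locally_integrable b M (\<lambda>s. cnj (F 0) * f s)" "locally_integrable b M (\<lambda>s. F 0 * cnj (f s))"
      by (intro locally_integrable_scale f f')+
    define A where "A s = (cnj (F 0) * f s + F 0 * cnj (f s)) + (f s * cum M (\<lambda>t. cnj (f t)) s + cum M f s * cnj (f s)) + q s" for s
    have Ai: "locally_integrable b M A" unfolding A_def
      by (intro locally_integrable_add f0 p1 p2 p3)
    have Ah: "A s = complex_of_real (h s)" if "s \<in> Ico0 b" for s
    proof -
      have "A s = (f s * cnj (F s) + cnj (f s) * F s) + f s * cnj (f s) * complex_of_real (measure M {s})"
        using F[OF that] by (simp add: A_def q_def cum_cnj algebra_simps)
      then show ?thesis unfolding h_def
        by (simp add: complex_eq_iff cmod_def power2_eq_square)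
    qed
    show "set_integrable M {0..<x} (\<lambda>s. complex_of_real (h s))"
      using locally_integrableD[OF Ai x] locally_integrable_cong[of A "\<lambda>s. complex_of_real (h s)"] Ah Ai x
      by (simp add: locally_integrableD)
    have "cum M (\<lambda>s. complex_of_real (h s)) x = cum M A x"
      by (intro cum_cong[OF x]) (simp add: Ah)
    also have "\<dots> = cnj (F 0) * cum M f x + F 0 * cnj (cum M f x) + cum M f x * cum M (\<lambda>t. cnj (f t)) x"
      unfolding A_def cum_mult[OF f f' x] q_def[symmetric]
      by (simp only: cum_add locally_integrable_add f0 p1 p2 p3 x cum_scale cum_cnj[of f x] add.assoc)
    finally show "complex_of_real ((cmod (F x))\<^sup>2) = complex_of_real ((cmod (F 0))\<^sup>2) + cum M (\<lambda>s. complex_of_real (h s)) x"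
      unfolding complex_norm_square F[OF x] by (simp add: cum_cnj algebra_simps)
  qed
  have sq': "(cmod (F x))\<^sup>2 = (cmod (F 0))\<^sup>2 + (LINT s:{0..<x}|M. h s)" if "x \<in> Ico0 b" for x
  proof -
    have "complex_of_real ((cmod (F x))\<^sup>2) = complex_of_real ((cmod (F 0))\<^sup>2 + (LINT s:{0..<x}|M. h s))"
      using sq[OF that] by (simp add: cum_def set_integral_complex_of_real)
    then show ?thesis by (simp only: of_real_eq_iff)
  qed
  have hr: "integrable M (\<lambda>s. indicator {0..<x} s *\<^sub>R h s)" if "x \<in> Ico0 b" for x
  proof -
    have "integrable M (\<lambda>s. Re (indicator {0..<x} s *\<^sub>R complex_of_real (h s)))"
      using hi[OF that] unfolding set_integrable_def by (rule integrable_Re)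
    then show ?thesis by simp
  qed
  have "(LINT s:{0..<x}|M. h s) \<le> (LINT s:{0..<y}|M. h s)"
    unfolding set_lebesgue_integral_def
    using hnn y by (intro integral_mono hr x) (auto simp: indicator_def space_M)
  then have "(cmod (F x))\<^sup>2 \<le> (cmod (F y))\<^sup>2" using sq' x y by simp
  then show ?thesis by (rule power2_le_imp_le) simp
qed

subsection \<open>Stieltjes measures\<close>

lemma Ico0_between: "x \<in> Ico0 b \<Longrightarrow> y \<in> Ico0 b \<Longrightarrow> x \<le> w \<Longrightarrow> w \<le> y \<Longrightarrow> w \<in> Ico0 b"
  by (rule Ico0_down) (auto simp: Ico0_def)

lemma eventually_at_right_Ico0:
  assumes x: "x \<in> Ico0 b"
  shows "eventually (\<lambda>y. y \<in> Ico0 b \<and> x < y) (at_right x)"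
proof -
  obtain z where z: "z \<in> Ico0 b" "x < z" by (rule Ico0_next[OF x])
  show ?thesis unfolding eventually_at_right[OF z(2)]
    using z Ico0_between[OF x z(1)] by (auto intro!: exI[of _ z])
qed

locale stieltjes =
  fixes b :: ereal and R :: "real \<Rightarrow> real"
  assumes b_pos: "0 < b" and R: "stieltjes_integrator b R"
begin

lemma mono: "x \<in> Ico0 b \<Longrightarrow> y \<in> Ico0 b \<Longrightarrow> x \<le> y \<Longrightarrow> R x \<le> R y"
  using R by (auto simp: stieltjes_integrator_def monotone_on_def)

lemma zero: "R 0 = 0"
  using R by (simp add: stieltjes_integrator_def)

lemma nonneg: "x \<in> Ico0 b \<Longrightarrow> 0 \<le> R x"
  using mono[of 0 x] zero Ico0_zero[OF b_pos] by (simp add: Ico0_nonneg)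

lemma sets_dR_le: "A \<in> sets (dR b R) \<Longrightarrow> A \<in> sets borel"
proof -
  have GI: "(\<lambda>(x, y). {x..<y}) ` {(x, y). 0 \<le> x \<and> x \<le> y \<and> ereal y < b} \<subseteq> Pow (Ico0 b)"
    by (auto simp: Ico0_def) (metis ereal_less_eq(3) le_less_trans less_imp_le)
  have "Ico0 b \<in> sets borel"
    unfolding Ico0_def by measurable
  then have "sets (dR b R) \<subseteq> sets borel"
    unfolding dR_def sets_extend_measure[OF GI] by (intro sets.sigma_sets_subset') auto
  then show "A \<in> sets (dR b R) \<Longrightarrow> A \<in> sets borel" by auto
qed

sublocale ico_measure b "dR b R"
proof
  have GI: "(\<lambda>(x, y). {x..<y}) ` {(x, y). 0 \<le> x \<and> x \<le> y \<and> ereal y < b} \<subseteq> Pow (Ico0 b)"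
    by (auto simp: Ico0_def) (metis ereal_less_eq(3) le_less_trans less_imp_le)
  show "0 < b" by (rule b_pos)
  show "space (dR b R) = Ico0 b" by simp
  show "(\<lambda>x. x) \<in> borel_measurable (dR b R)"
  proof (rule borel_measurableI_less)
    fix a :: real
    have "{x \<in> Ico0 b. x < a} \<in> sets (dR b R)"
    proof (cases "0 \<le> a \<and> ereal a < b")
      case True
      then have "{x \<in> Ico0 b. x < a} = {0..<a}"
        by (auto simp: Ico0_def) (meson ereal_less_eq(3) le_less_trans less_imp_le)
      also have "\<dots> \<in> sets (dR b R)"
        unfolding dR_def sets_extend_measure[OF GI]
        by (rule sigma_sets.Basic, rule image_eqI[of _ _ "(0, a)"]) (use True in auto)
      finally show ?thesis .
    next
      case False
      then have "{x \<in> Ico0 b. x < a} = (if a < 0 then {} else space (dR b R))"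
        by (auto simp: Ico0_def) (metis ereal_less_eq(3) less_le_trans not_less)+
      then show ?thesis by (metis sets.empty_sets sets.top)
    qed
    then show "{x \<in> space (dR b R). x < a} \<in> sets (dR b R)" by simp
  qed
  show "emeasure (dR b R) {0..<x} < \<infinity>" if "x \<in> Ico0 b" for x
    using emeasure_dR_Ico[OF R, of 0 x] that by (simp add: Ico0_def)
qed

lemma emeasure_Ico: "y \<in> Ico0 b \<Longrightarrow> 0 \<le> x \<Longrightarrow> x \<le> y \<Longrightarrow> emeasure (dR b R) {x..<y} = ennreal (R y - R x)"
  using emeasure_dR_Ico[OF R, of x y] by (simp add: Ico0_def)

lemma measure_Ico: "y \<in> Ico0 b \<Longrightarrow> 0 \<le> x \<Longrightarrow> x \<le> y \<Longrightarrow> measure (dR b R) {x..<y} = R y - R x"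
  using emeasure_Ico[of y x] mono[of x y] by (simp add: measure_def Ico0_down)

lemma cum_const: "x \<in> Ico0 b \<Longrightarrow> cum (dR b R) (\<lambda>t. c) x = c * complex_of_real (R x)"
  unfolding cum_def using measure_Ico[of x 0] fin[of x]
  by (subst set_integral_const)
     (auto simp: Ico0_nonneg zero scaleR_conv_of_real mult.commute less_top)

lemma atom_le: "y \<in> Ico0 b \<Longrightarrow> 0 \<le> x \<Longrightarrow> x < y \<Longrightarrow> measure (dR b R) {x} \<le> R y - R x"
proof -
  assume *: "y \<in> Ico0 b" "0 \<le> x" "x < y"
  have s: "{x..<y} \<in> sets (dR b R)" using * by (intro borel_sets) (auto intro: Ico0_down)
  have "emeasure (dR b R) {x} \<le> emeasure (dR b R) {x..<y}" using s * by (intro emeasure_mono) auto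
  also have "\<dots> = ennreal (R y - R x)" using * by (intro emeasure_Ico) auto
  finally have "enn2real (emeasure (dR b R) {x}) \<le> enn2real (ennreal (R y - R x))"
    by (intro enn2real_mono) auto
  then show ?thesis using * mono[of x y] by (simp add: measure_def Ico0_down)
qed

lemma right_limit:
  assumes x: "x \<in> Ico0 b"
  shows "(R \<longlongrightarrow> R_plus R x) (at_right x)"
    and "y \<in> Ico0 b \<Longrightarrow> x < y \<Longrightarrow> R_plus R x \<le> R y"
    and "R x \<le> R_plus R x"
proof -
  obtain z where z: "z \<in> Ico0 b" "x < z" by (rule Ico0_next[OF x])
  define L where "L = Inf (R ` ({x<..} \<inter> Ico0 b))"
  have bdd: "bdd_below (R ` ({x<..} \<inter> Ico0 b))"
    by (rule bdd_belowI2[of _ "R x"]) (use mono x in auto)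
  have up: "L \<le> R y" if "y \<in> Ico0 b" "x < y" for y
    unfolding L_def using that by (intro cINF_lower[OF bdd]) auto
  have low: "R x \<le> L"
    unfolding L_def using z by (intro cINF_greatest) (auto intro: mono x)
  have "(R \<longlongrightarrow> L) (at_right x)"
  proof (rule order_tendstoI)
    fix e assume "e < L"
    moreover note eventually_at_right_Ico0[OF x]
    ultimately show "eventually (\<lambda>y. e < R y) (at_right x)"
      by (elim eventually_mono) (use up in \<open>auto intro: less_le_trans\<close>)
  next
    fix e assume "L < e"
    then obtain w where w: "w \<in> Ico0 b" "x < w" "R w < e"
      using z unfolding L_def by (subst (asm) cInf_less_iff) (auto simp: bdd)
    show "eventually (\<lambda>y. R y < e) (at_right x)"
      unfolding eventually_at_right[OF z(2)]
    proof (intro exI[of _ w] conjI allI impI)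
      fix y assume y: "x < y" "y < w"
      then have "R y \<le> R w" using w Ico0_between[OF x w(1), of y] by (intro mono) auto
      then show "R y < e" using w by simp
    qed (use w in auto)
  qed
  then have eq: "R_plus R x = L"
    unfolding R_plus_def by (intro tendsto_Lim) (auto simp: trivial_limit_at_right_real)
  show "(R \<longlongrightarrow> R_plus R x) (at_right x)" unfolding eq by fact
  show "y \<in> Ico0 b \<Longrightarrow> x < y \<Longrightarrow> R_plus R x \<le> R y" unfolding eq by (rule up)
  show "R x \<le> R_plus R x" unfolding eq by (rule low)
qed

lemma no_atom:
  assumes x: "x \<in> Ico0 b" and c: "continuous (at x within Ico0 b) R"
  shows "measure (dR b R) {x} = 0"
proof -
  obtain z where z: "z \<in> Ico0 b" "x < z" by (rule Ico0_next[OF x])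
  note ev = eventually_at_right_Ico0[OF x]
  have "(R \<longlongrightarrow> R x) (at x within Ico0 b)" using c by (simp add: continuous_within)
  then have "(R \<longlongrightarrow> R x) (at x within {x..z})"
    by (rule tendsto_within_subset) (use Ico0_between[OF x z(1)] in auto)
  then have "(R \<longlongrightarrow> R x) (at_right x)"
    using at_within_Icc_at_right[OF z(2)] by simp
  then have "((\<lambda>y. R y - R x) \<longlongrightarrow> 0) (at_right x)"
    by (auto intro: tendsto_eq_intros)
  moreover have "eventually (\<lambda>y. measure (dR b R) {x} \<le> R y - R x) (at_right x)"
    using ev by eventually_elim (use x in \<open>auto intro!: atom_le Ico0_nonneg\<close>)
  ultimately have "measure (dR b R) {x} \<le> 0"
    by (rule tendsto_lowerbound) (auto simp: trivial_limit_at_right_real)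
  then show ?thesis by (simp add: measure_le_0_iff)
qed

lemma emeasure_Icc:
  assumes a: "a \<in> Ico0 b"
  shows "emeasure (dR b R) {0..a} = ennreal (R_plus R a)"
proof -
  obtain z where z: "z \<in> Ico0 b" "a < z" by (rule Ico0_next[OF a])
  define y where "y n = a + (z - a) / real (Suc n)" for n
  have yz: "y n \<le> z" "a < y n" for n
  proof -
    have "(z - a) / real (Suc n) \<le> (z - a) / 1" using z by (intro divide_left_mono) auto
    then show "y n \<le> z" by (simp add: y_def)
  qed (use z in \<open>simp add: y_def\<close>)
  have yI: "y n \<in> Ico0 b" for n
    using yz[of n] z a Ico0_nonneg[OF a] by (auto intro: Ico0_down)
  have ylim: "filterlim y (at_right a) sequentially"
    unfolding filterlim_at
  proof
    have "y \<longlonglongrightarrow> a + 0" unfolding y_def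
      by (intro tendsto_intros LIMSEQ_Suc[where f = "\<lambda>n. (z - a) / real n"] lim_const_over_n)
    then show "y \<longlonglongrightarrow> a" by simp
    show "\<forall>\<^sub>F n in sequentially. y n \<in> {a<..} \<and> y n \<noteq> a"
      using yz(2) by (auto simp: less_imp_neq[symmetric])
  qed
  have "(\<lambda>n. emeasure (dR b R) {0..<y n}) \<longlonglongrightarrow> emeasure (dR b R) (\<Inter>n. {0..<y n})"
  proof (rule Lim_emeasure_decseq)
    have "y n \<le> y m" if "m \<le> n" for m n
      unfolding y_def using that z by (intro add_left_mono divide_left_mono) auto
    then show "decseq (\<lambda>n. {0..<y n})"
      unfolding decseq_def by (intro allI impI ivl_subset[THEN iffD2]) auto
  qed (use yI fin in \<open>auto simp: less_top\<close>)
  also have "(\<Inter>n. {0..<y n}) = {0..a}"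
  proof
    show "{0..a} \<subseteq> (\<Inter>n. {0..<y n})" by (auto intro: le_less_trans[OF _ yz(2)])
    show "(\<Inter>n. {0..<y n}) \<subseteq> {0..a}"
    proof
      fix x assume x: "x \<in> (\<Inter>n. {0..<y n})"
      have "y \<longlonglongrightarrow> a" using ylim by (simp add: filterlim_at)
      then have "x \<le> a" by (rule LIMSEQ_le_const) (use x in \<open>auto intro: less_imp_le\<close>)
      then show "x \<in> {0..a}" using x by auto
    qed
  qed
  finally have "(\<lambda>n. emeasure (dR b R) {0..<y n}) \<longlonglongrightarrow> emeasure (dR b R) {0..a}" .
  moreover have "emeasure (dR b R) {0..<y n} = ennreal (R (y n))" for n
    using emeasure_Ico[OF yI[of n], of 0] yI[of n] by (simp add: zero Ico0_nonneg)
  moreover have "(\<lambda>n. ennreal (R (y n))) \<longlonglongrightarrow> ennreal (R_plus R a)"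
    by (intro tendsto_ennrealI filterlim_compose[OF right_limit(1)[OF a] ylim])
  ultimately show ?thesis by (simp add: LIMSEQ_unique)
qed

lemma R_end_SUP:
  shows "R_end b R = (SUP x\<in>Ico0 b. ereal (R x))"
proof -
  have "((\<lambda>x. ereal (R x)) \<longlongrightarrow> (SUP x\<in>Ico0 b. ereal (R x))) (at_end b)"
  proof (rule increasing_tendsto)
    show "\<forall>\<^sub>F n in at_end b. ereal (R n) \<le> (SUP x\<in>Ico0 b. ereal (R x))"
      using eventually_at_end_Ico0[OF b_pos] by eventually_elim (auto intro: SUP_upper)
    fix e assume "e < (SUP x\<in>Ico0 b. ereal (R x))"
    then obtain y where y: "y \<in> Ico0 b" "e < ereal (R y)" by (auto simp: less_SUP_iff)
    show "\<forall>\<^sub>F n in at_end b. e < ereal (R n)"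
      using eventually_at_end_ge[OF b_pos y(1)] eventually_at_end_Ico0[OF b_pos]
      by eventually_elim (use y mono in \<open>auto intro: less_le_trans\<close>)
  qed
  then show ?thesis unfolding R_end_def by (rule tendsto_Lim[OF at_end_neq_bot[OF b_pos]])
qed

lemma R_end_finite:
  assumes "finite_measure (dR b R)"
  shows "R_end b R = ereal (measure (dR b R) (Ico0 b))" and "(R \<longlongrightarrow> measure (dR b R) (Ico0 b)) (at_end b)"
proof -
  interpret finite_measure "dR b R" by fact
  have "(cum (dR b R) (\<lambda>t. 1) \<longlongrightarrow> (\<integral>t. 1 \<partial>dR b R)) (at_end b)"
    by (rule cum_tendsto) simp
  moreover have "eventually (\<lambda>x. cum (dR b R) (\<lambda>t. 1) x = complex_of_real (R x)) (at_end b)"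
    using eventually_at_end_Ico0[OF b_pos] by eventually_elim (simp add: cum_const)
  ultimately have "((\<lambda>x. complex_of_real (R x)) \<longlongrightarrow> (\<integral>t. 1 \<partial>dR b R)) (at_end b)"
    by (simp add: tendsto_cong)
  then have "((\<lambda>x. complex_of_real (R x)) \<longlongrightarrow> complex_of_real (measure (dR b R) (Ico0 b))) (at_end b)"
    by (simp add: scaleR_conv_of_real)
  then show lim: "(R \<longlongrightarrow> measure (dR b R) (Ico0 b)) (at_end b)" by (simp only: tendsto_of_real_iff)
  show "R_end b R = ereal (measure (dR b R) (Ico0 b))"
    unfolding R_end_def by (intro tendsto_Lim[OF at_end_neq_bot[OF b_pos]] tendsto_intros lim)
qed

lemma R_end_infinite:
  assumes "R_end b R = \<infinity>"
  shows "filterlim R at_top (at_end b)"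
  unfolding filterlim_at_top
proof
  fix Z :: real
  have "ereal Z < (SUP x\<in>Ico0 b. ereal (R x))" using assms R_end_SUP by simp
  then obtain y where y: "y \<in> Ico0 b" "ereal Z < ereal (R y)" by (auto simp: less_SUP_iff)
  show "\<forall>\<^sub>F x in at_end b. Z \<le> R x"
    using eventually_at_end_ge[OF b_pos y(1)] eventually_at_end_Ico0[OF b_pos]
    by eventually_elim (rule order_trans[OF less_imp_le mono[OF y(1)]], use y in simp_all)
qed

end

text \<open>
  The measures of \<open>R\<close> on \<open>[0,b)\<close> and on a shorter interval agree on the half-open intervals,
  which generate.
\<close>

lemma dR_shorten:
  assumes b0: "0 < b0" "b0 \<le> b" and R: "stieltjes_integrator b R"
  shows "dR b0 R = restrict_space (dR b R) (Ico0 b0)"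
proof -
  have I: "Ico0 b0 \<subseteq> Ico0 b" using b0(2) by (auto simp: Ico0_def)
  have R0: "stieltjes_integrator b0 R"
    using R I by (auto simp: stieltjes_integrator_def intro: mono_on_subset)
  interpret A: stieltjes b R using b0 R by unfold_locales auto
  interpret B: stieltjes b0 R using b0 R0 by unfold_locales auto
  let ?J = "{(x, y). 0 \<le> x \<and> x \<le> y \<and> ereal y < b0}"
  let ?E = "(\<lambda>(x, y). {x..<y}) ` ?J"
  have E: "?E \<subseteq> Pow (Ico0 b0)"
    by (auto simp: Ico0_def) (metis ereal_less_eq(3) le_less_trans less_imp_le)
  have sets_B: "sets (dR b0 R) = sigma_sets (Ico0 b0) ?E"
    unfolding dR_def by (rule sets_extend_measure[OF E])
  have I_sets: "Ico0 b0 \<inter> space (dR b R) \<in> sets (dR b R)"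
    using A.borel_Int_sets[OF B.sets_dR_le[OF sets.top]] by simp
  have sets_eq: "sets (restrict_space (dR b R) (Ico0 b0)) = sets (dR b0 R)"
  proof (intro equalityI subsetI)
    fix X assume "X \<in> sets (restrict_space (dR b R) (Ico0 b0))"
    then obtain Y where "X = Ico0 b0 \<inter> Y" "Y \<in> sets (dR b R)" by (auto simp: sets_restrict_space)
    then show "X \<in> sets (dR b0 R)" using B.borel_Int_sets[OF A.sets_dR_le, of Y] by (simp add: Int_commute)
  next
    fix X assume X: "X \<in> sets (dR b0 R)"
    then have sub: "X \<subseteq> Ico0 b0" using sets.sets_into_space by force
    then have "X \<in> sets (dR b R)" using A.borel_sets[OF B.sets_dR_le[OF X]] I by blast
    then show "X \<in> sets (restrict_space (dR b R) (Ico0 b0))"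
      unfolding sets_restrict_space using sub by (intro image_eqI[of _ _ X]) auto
  qed
  obtain y where y: "\<And>n. y n \<in> Ico0 b0" "\<And>x. x \<in> Ico0 b0 \<Longrightarrow> eventually (\<lambda>n. x < y n) sequentially"
    using Ico0_exhaustion[OF b0(1)] by blast
  show ?thesis
  proof (rule measure_eqI_generator_eq[OF _ E, where A = "\<lambda>n. {0..<y n}"])
    show "Int_stable ?E"
    proof (rule Int_stableI)
      fix P Q assume "P \<in> ?E" "Q \<in> ?E"
      then obtain p q p' q' where PQ: "P = {p..<q}" "Q = {p'..<q'}" "0 \<le> p" "p \<le> q" "ereal q < b0" "0 \<le> p'" "p' \<le> q'" "ereal q' < b0"
        by auto
      have Int_eq: "{p..<q} \<inter> {p'..<q'} = {max p p'..<max (max p p') (min q q')}" by auto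
      have "(max p p', max (max p p') (min q q')) \<in> ?J"
      proof -
        have "ereal p < b0" by (rule le_less_trans[OF _ PQ(5)]) (simp add: PQ(4))
        moreover have "ereal p' < b0" by (rule le_less_trans[OF _ PQ(8)]) (simp add: PQ(7))
        ultimately show ?thesis using PQ(3,5,6,8) by (simp add: max_def min_def)
      qed
      then show "P \<inter> Q \<in> ?E" unfolding PQ(1,2) Int_eq by (rule rev_image_eqI) simp
    qed
    show "sets (dR b0 R) = sigma_sets (Ico0 b0) ?E"
      "sets (restrict_space (dR b R) (Ico0 b0)) = sigma_sets (Ico0 b0) ?E"
      by (simp_all only: sets_eq sets_B)
    show "emeasure (dR b0 R) X = emeasure (restrict_space (dR b R) (Ico0 b0)) X" if X: "X \<in> ?E" for X
    proof -
      obtain p q where pq: "X = {p..<q}" "0 \<le> p" "p \<le> q" "ereal q < b0" using X by auto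
      then have "q \<in> Ico0 b0" by (simp add: Ico0_def)
      then have q: "q \<in> Ico0 b0" "q \<in> Ico0 b" using I by auto
      have "X \<subseteq> Ico0 b0" using E X by blast
      then show ?thesis unfolding pq(1)
        by (simp add: emeasure_restrict_space[OF I_sets] A.emeasure_Ico[OF q(2) pq(2,3)] B.emeasure_Ico[OF q(1) pq(2,3)])
    qed
    show "range (\<lambda>n. {0..<y n}) \<subseteq> ?E"
    proof
      fix X assume "X \<in> range (\<lambda>n. {0..<y n})"
      then obtain n where X: "X = {0..<y n}" by blast
      have "(0, y n) \<in> ?J" using y(1)[of n] by (simp add: Ico0_def)
      then show "X \<in> ?E" unfolding X by (rule rev_image_eqI) simp
    qed
    show "(\<Union>n. {0..<y n}) = Ico0 b0"
    proof
      show "(\<Union>n. {0..<y n}) \<subseteq> Ico0 b0" using Ico0_subset[OF y(1)] by blast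
      show "Ico0 b0 \<subseteq> (\<Union>n. {0..<y n})"
      proof
        fix x assume x: "x \<in> Ico0 b0"
        then obtain n where "x < y n" using y(2)[OF x] by (auto simp: eventually_sequentially)
        then show "x \<in> (\<Union>n. {0..<y n})" using Ico0_nonneg[OF x] by auto
      qed
    qed
    show "emeasure (dR b0 R) {0..<y n} \<noteq> \<infinity>" for n using B.fin[OF y(1)] by (simp add: less_top)
  qed
qed

section \<open>Iterated integrals\<close>

text \<open>
  The terms of the Volterra series are dominated by these integrals over simplices
  \<open>t\<^sub>1 < \<dots> < t\<^sub>n < x\<close>.
\<close>

primrec simplex_integral :: "real measure \<Rightarrow> (real \<Rightarrow> ennreal) \<Rightarrow> nat \<Rightarrow> real \<Rightarrow> ennreal" where
  "simplex_integral M w 0 x = 1"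
| "simplex_integral M w (Suc n) x = (\<integral>\<^sup>+t. (if t < x then w t * simplex_integral M w n t else 0) \<partial>M)"

context ico_measure
begin

lemma simplex_integral_measurable [measurable]:
  assumes [measurable]: "w \<in> borel_measurable M"
  shows "simplex_integral M w n \<in> borel_measurable M"
proof (induction n)
  case (Suc n)
  note Suc.IH [measurable]
  have "simplex_integral M w (Suc n) = (\<lambda>x. \<integral>\<^sup>+t. (if t < x then w t * simplex_integral M w n t else 0) \<partial>M)"
    by (rule ext) simp
  also have "\<dots> \<in> borel_measurable M" by measurable
  finally show ?case .
qed simp

lemma simplex_integral_mono: "x \<le> y \<Longrightarrow> simplex_integral M w n x \<le> simplex_integral M w n y"
  by (cases n) (auto intro!: nn_integral_mono)

text \<open>
  The product on the right is an integral over all positions of one additional variable. The part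
  where it is the largest of all variables gives one copy of the larger simplex; where it precedes the
  largest one, the induction hypothesis applies inside the outermost integral.
\<close>

lemma simplex_integral_Suc_le:
  assumes [measurable]: "w \<in> borel_measurable M"
  shows "of_nat (Suc n) * simplex_integral M w (Suc n) x \<le> simplex_integral M w 1 x * simplex_integral M w n x"
proof (induction n arbitrary: x)
  case (Suc n)
  let ?I = "simplex_integral M w"
  define L where "L = of_nat (Suc (Suc n)) * ?I (Suc (Suc n)) x"
  have "L = (\<integral>\<^sup>+t. (if t < x then w t * (of_nat (Suc n) * ?I (Suc n) t) else 0) \<partial>M) + ?I (Suc (Suc n)) x"
  proof -
    have "(\<integral>\<^sup>+t. (if t < x then w t * (of_nat (Suc n) * ?I (Suc n) t) else 0) \<partial>M)
       = (\<integral>\<^sup>+t. of_nat (Suc n) * (if t < x then w t * ?I (Suc n) t else 0) \<partial>M)"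
      by (intro nn_integral_cong) (auto simp: mult_ac simp del: simplex_integral.simps of_nat_Suc)
    also have "\<dots> = of_nat (Suc n) * ?I (Suc (Suc n)) x"
      by (subst nn_integral_cmult) (simp_all del: of_nat_Suc)
    finally show ?thesis by (simp add: L_def algebra_simps del: simplex_integral.simps)
  qed
  also have "\<dots> \<le> (\<integral>\<^sup>+t. (if t < x then w t * (?I 1 t * ?I n t) else 0) \<partial>M) + ?I (Suc (Suc n)) x"
    by (intro add_right_mono nn_integral_mono) 
      (use Suc.IH in \<open>auto intro!: mult_left_mono simp del: simplex_integral.simps of_nat_Suc\<close>)
  also have "(\<integral>\<^sup>+t. (if t < x then w t * (?I 1 t * ?I n t) else 0) \<partial>M)
    = (\<integral>\<^sup>+t. (\<integral>\<^sup>+s. (if s < t \<and> t < x then w s * (w t * ?I n t) else 0) \<partial>M) \<partial>M)"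
  proof (intro nn_integral_cong)
    fix t
    have "(\<integral>\<^sup>+s. (if s < t \<and> t < x then w s * (w t * ?I n t) else 0) \<partial>M)
      = (\<integral>\<^sup>+s. (if s < t then w s else 0) * (if t < x then w t * ?I n t else 0) \<partial>M)"
      by (intro nn_integral_cong) auto
    also have "\<dots> = (\<integral>\<^sup>+s. (if s < t then w s else 0) \<partial>M) * (if t < x then w t * ?I n t else 0)"
      by (rule nn_integral_multc) measurable
    finally show "(if t < x then w t * (?I 1 t * ?I n t) else 0) = (\<integral>\<^sup>+s. (if s < t \<and> t < x then w s * (w t * ?I n t) else 0) \<partial>M)"
      by (auto simp: mult_ac cong: if_cong)
  qed
  also have "?I (Suc (Suc n)) x = (\<integral>\<^sup>+s. (\<integral>\<^sup>+t. (if t < s \<and> s < x then w s * (w t * ?I n t) else 0) \<partial>M) \<partial>M)"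
    unfolding simplex_integral.simps(2)[of M w "Suc n" x]
  proof (intro nn_integral_cong)
    fix s
    have "(\<integral>\<^sup>+t. (if t < s \<and> s < x then w s * (w t * ?I n t) else 0) \<partial>M)
      = (\<integral>\<^sup>+t. (if s < x then w s else 0) * (if t < s then w t * ?I n t else 0) \<partial>M)"
      by (intro nn_integral_cong) auto
    also have "\<dots> = (if s < x then w s else 0) * (\<integral>\<^sup>+t. (if t < s then w t * ?I n t else 0) \<partial>M)"
      by (rule nn_integral_cmult) measurable
    finally show "(if s < x then w s * ?I (Suc n) s else 0) = (\<integral>\<^sup>+t. (if t < s \<and> s < x then w s * (w t * ?I n t) else 0) \<partial>M)"
      by auto
  qed
  also have "\<dots> = (\<integral>\<^sup>+t. (\<integral>\<^sup>+s. (if t < s \<and> s < x then w s * (w t * ?I n t) else 0) \<partial>M) \<partial>M)"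
  proof -
    interpret pair_sigma_finite M M ..
    show ?thesis by (rule Fubini') measurable
  qed
  also have "(\<integral>\<^sup>+t. (\<integral>\<^sup>+s. (if s < t \<and> t < x then w s * (w t * ?I n t) else 0) \<partial>M) \<partial>M) + \<dots>
    = (\<integral>\<^sup>+t. (\<integral>\<^sup>+s. (if s < t \<and> t < x then w s * (w t * ?I n t) else 0)
        + (if t < s \<and> s < x then w s * (w t * ?I n t) else 0) \<partial>M) \<partial>M)"
  proof -
    let ?p = "\<lambda>t s. if s < t \<and> t < x then w s * (w t * ?I n t) else 0"
    let ?q = "\<lambda>t s. if t < s \<and> s < x then w s * (w t * ?I n t) else 0"
    have "(\<integral>\<^sup>+t. (\<integral>\<^sup>+s. ?p t s + ?q t s \<partial>M) \<partial>M) = (\<integral>\<^sup>+t. (\<integral>\<^sup>+s. ?p t s \<partial>M) + (\<integral>\<^sup>+s. ?q t s \<partial>M) \<partial>M)"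
      by (intro nn_integral_cong nn_integral_add) measurable
    also have "\<dots> = (\<integral>\<^sup>+t. (\<integral>\<^sup>+s. ?p t s \<partial>M) \<partial>M) + (\<integral>\<^sup>+t. (\<integral>\<^sup>+s. ?q t s \<partial>M) \<partial>M)"
      by (rule nn_integral_add) measurable
    finally show ?thesis ..
  qed
  also have "\<dots> \<le> (\<integral>\<^sup>+t. (\<integral>\<^sup>+s. (if s < x then w s else 0) * (if t < x then w t * ?I n t else 0) \<partial>M) \<partial>M)"
    by (intro nn_integral_mono) auto
  also have "\<dots> = ?I 1 x * ?I (Suc n) x"
    by (subst nn_integral_multc, measurable)+ (simp add: nn_integral_cmult cong: if_cong)
  finally show ?case unfolding L_def .
qed simp

lemma simplex_integral_le:
  assumes "w \<in> borel_measurable M"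
  shows "fact n * simplex_integral M w n x \<le> simplex_integral M w 1 x ^ n"
proof (induction n)
  case (Suc n)
  have "fact (Suc n) * simplex_integral M w (Suc n) x = fact n * (of_nat (Suc n) * simplex_integral M w (Suc n) x)"
    by (simp add: mult_ac del: simplex_integral.simps)
  also have "\<dots> \<le> fact n * (simplex_integral M w 1 x * simplex_integral M w n x)"
    by (intro mult_left_mono simplex_integral_Suc_le assms) auto
  also have "\<dots> = simplex_integral M w 1 x * (fact n * simplex_integral M w n x)" by (simp only: mult_ac)
  also have "\<dots> \<le> simplex_integral M w 1 x * simplex_integral M w 1 x ^ n"
    by (intro mult_left_mono Suc.IH) auto
  finally show ?case by (simp only: power_Suc)
qed simp

lemma simplex_integral_le_real:
  assumes "w \<in> borel_measurable M" "simplex_integral M w 1 x \<le> ennreal a" "0 \<le> a"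
  shows "simplex_integral M w n x \<le> ennreal (a ^ n / fact n)"
proof -
  have "fact n * simplex_integral M w n x \<le> ennreal a ^ n"
    by (rule order_trans[OF simplex_integral_le[OF assms(1)] power_mono[OF assms(2)]]) simp
  also have "\<dots> = ennreal (a ^ n)" using assms by (simp add: ennreal_power)
  finally have le: "fact n * simplex_integral M w n x \<le> ennreal (a ^ n)" .
  have f: "(fact n :: ennreal) = ennreal (fact n)"
    by (metis ennreal_of_nat_eq_real_of_nat of_nat_fact)
  have "simplex_integral M w n x = ennreal (1 / fact n) * (fact n * simplex_integral M w n x)"
    unfolding f mult.assoc[symmetric] by (simp add: ennreal_mult[symmetric])
  also have "\<dots> \<le> ennreal (1 / fact n) * ennreal (a ^ n)"
    by (intro mult_left_mono le) auto
  also have "\<dots> = ennreal (a ^ n / fact n)" using assms by (simp add: ennreal_mult[symmetric])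
  finally show ?thesis .
qed

lemma cum_norm_nn:
  assumes [measurable]: "f \<in> borel_measurable M" and x: "x \<in> Ico0 b"
  shows "ennreal (cmod (cum M f x)) \<le> (\<integral>\<^sup>+t. (if t < x then ennreal (cmod (f t)) else 0) \<partial>M)"
proof -
  have [measurable]: "{0..<x} \<in> sets M" using x by simp
  have "ennreal (cmod (cum M f x)) \<le> (\<integral>\<^sup>+t. norm (indicator {0..<x} t *\<^sub>R f t) \<partial>M)"
    unfolding cum_def set_lebesgue_integral_def
  proof (cases "integrable M (\<lambda>t. indicat_real {0..<x} t *\<^sub>R f t)")
    case True
    then show "ennreal (cmod (CLINT t|M. indicat_real {0..<x} t *\<^sub>R f t)) \<le> (\<integral>\<^sup>+t. norm (indicator {0..<x} t *\<^sub>R f t) \<partial>M)"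
      by (rule integral_norm_bound_ennreal)
  qed (simp add: not_integrable_integral_eq)
  also have "\<dots> = (\<integral>\<^sup>+t. (if t < x then ennreal (cmod (f t)) else 0) \<partial>M)"
    by (intro nn_integral_cong) (auto simp: indicator_def space_M Ico0_def)
  finally show ?thesis .
qed

end

section \<open>The integral system\<close>

locale integral_system =
  fixes b :: ereal and R1 R2 :: "real \<Rightarrow> real"
  assumes b_pos: "0 < b" and R1: "stieltjes_integrator b R1" and R2: "stieltjes_integrator b R2"
    and no_common_jumps: "\<And>x. x \<in> Ico0 b \<Longrightarrow>
      continuous (at x within Ico0 b) R1 \<or> continuous (at x within Ico0 b) R2"
begin

sublocale S1: stieltjes b R1 by unfold_locales (fact b_pos R1)+
sublocale S2: stieltjes b R2 by unfold_locales (fact b_pos R2)+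
sublocale ico_pair b "dR b R1" "dR b R2" ..

abbreviation "\<mu>1 \<equiv> dR b R1"
abbreviation "\<mu>2 \<equiv> dR b R2"

lemma R1_measurable [measurable]: "R1 \<in> borel_measurable \<mu>2"
proof -
  have [measurable]: "cum \<mu>1 (\<lambda>t. 1) \<in> borel_measurable \<mu>2"
    by (intro S1.cum_measurable S2.ico_measure_axioms) auto
  have "(\<lambda>x. Re (cum \<mu>1 (\<lambda>t. 1) x)) \<in> borel_measurable \<mu>2"
    by measurable
  then show ?thesis by (rule subst[OF measurable_cong, rotated]) (simp add: S1.cum_const)
qed

lemma integral_pair_iff:
  "integral_pair b R1 R2 u1 u2 f \<longleftrightarrow> locally_integrable b \<mu>1 u2 \<and> locally_integrable b \<mu>2 f \<and>
    (\<forall>x\<in>Ico0 b. u1 x = u1 0 + cum \<mu>1 u2 x \<and> u2 x = u2 0 - cum \<mu>2 f x)"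
  unfolding integral_pair_def locally_integrable_def cum_def by auto

lemma integral_pairD:
  assumes "integral_pair b R1 R2 u1 u2 f"
  shows "locally_integrable b \<mu>1 u2" "locally_integrable b \<mu>2 f"
    "x \<in> Ico0 b \<Longrightarrow> u1 x = u1 0 + cum \<mu>1 u2 x" "x \<in> Ico0 b \<Longrightarrow> u2 x = u2 0 - cum \<mu>2 f x"
  using assms by (simp_all add: integral_pair_iff)

lemma integral_pair_locally_bounded:
  assumes "integral_pair b R1 R2 u1 u2 f" "x \<in> Ico0 b"
  shows "\<exists>B. \<forall>t. 0 \<le> t \<longrightarrow> t < x \<longrightarrow> cmod (u1 t) \<le> B" "\<exists>B. \<forall>t. 0 \<le> t \<longrightarrow> t < x \<longrightarrow> cmod (u2 t) \<le> B"
proof -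
  note u = integral_pairD[OF assms(1)]
  have in_I: "t \<in> Ico0 b" if "0 \<le> t" "t < x" for t using that assms(2) by (auto intro: Ico0_down)
  obtain B where B: "\<And>t. 0 \<le> t \<Longrightarrow> t < x \<Longrightarrow> cmod (u1 0 + cum \<mu>1 u2 t) \<le> B"
    using S1.cum_locally_bounded[OF u(1) assms(2)] by blast
  have "cmod (u1 t) \<le> B" if "0 \<le> t" "t < x" for t
    using B[OF that] u(3)[OF in_I[OF that]] by simp
  then show "\<exists>B. \<forall>t. 0 \<le> t \<longrightarrow> t < x \<longrightarrow> cmod (u1 t) \<le> B" by blast
  obtain B where B: "\<And>t. 0 \<le> t \<Longrightarrow> t < x \<Longrightarrow> cmod (- u2 0 + cum \<mu>2 f t) \<le> B"
    using S2.cum_locally_bounded[OF u(2) assms(2)] by blast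
  have "cmod (u2 t) \<le> B" if "0 \<le> t" "t < x" for t
    using B[OF that] u(4)[OF in_I[OF that]] by (simp add: norm_minus_commute)
  then show "\<exists>B. \<forall>t. 0 \<le> t \<longrightarrow> t < x \<longrightarrow> cmod (u2 t) \<le> B" by blast
qed

lemma integral_pair_measurable:
  assumes "integral_pair b R1 R2 u1 u2 f"
  shows "u1 \<in> borel_measurable \<mu>1" "u1 \<in> borel_measurable \<mu>2"
    "u2 \<in> borel_measurable \<mu>1" "u2 \<in> borel_measurable \<mu>2" "f \<in> borel_measurable \<mu>2"
proof -
  note u = integral_pairD[OF assms]
  have m: "u2 \<in> borel_measurable \<mu>1" "f \<in> borel_measurable \<mu>2"
    using S1.locally_integrable_measurable[OF u(1)] S2.locally_integrable_measurable[OF u(2)] by auto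
  have c: "cum \<mu>1 u2 \<in> borel_measurable \<mu>1" "cum \<mu>1 u2 \<in> borel_measurable \<mu>2" "cum \<mu>2 f \<in> borel_measurable \<mu>2"
    by (intro S1.cum_measurable S2.cum_measurable m S1.ico_measure_axioms S2.ico_measure_axioms)+
  have "u1 \<in> borel_measurable \<mu>1 \<longleftrightarrow> (\<lambda>x. u1 0 + cum \<mu>1 u2 x) \<in> borel_measurable \<mu>1"
    "u1 \<in> borel_measurable \<mu>2 \<longleftrightarrow> (\<lambda>x. u1 0 + cum \<mu>1 u2 x) \<in> borel_measurable \<mu>2"
    "u2 \<in> borel_measurable \<mu>2 \<longleftrightarrow> (\<lambda>x. u2 0 - cum \<mu>2 f x) \<in> borel_measurable \<mu>2"
    by (intro measurable_cong; use u in simp)+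
  then show "u1 \<in> borel_measurable \<mu>1" "u1 \<in> borel_measurable \<mu>2" "u2 \<in> borel_measurable \<mu>2"
    using c by auto
qed (use assms in \<open>auto simp: integral_pair_iff intro: S1.locally_integrable_measurable S2.locally_integrable_measurable\<close>)

lemma integral_pair_locally_integrable:
  assumes "integral_pair b R1 R2 u1 u2 f"
  shows "locally_integrable b \<mu>2 u1"
  using integral_pair_measurable[OF assms] integral_pair_locally_bounded[OF assms]
  by (intro S2.locally_integrable_bounded) auto

lemma solves_system_iff:
  "solves_system b R1 R2 z u1 u2 \<longleftrightarrow> integral_pair b R1 R2 u1 u2 (\<lambda>t. z * u1 t)"
proof
  assume "solves_system b R1 R2 z u1 u2"
  then show "integral_pair b R1 R2 u1 u2 (\<lambda>t. z * u1 t)"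
    unfolding solves_system_def integral_pair_def by auto
next
  assume u: "integral_pair b R1 R2 u1 u2 (\<lambda>t. z * u1 t)"
  from integral_pair_locally_integrable[OF u] u show "solves_system b R1 R2 z u1 u2"
    unfolding solves_system_def integral_pair_def locally_integrable_def by auto
qed

lemma integral_pair_combine:
  assumes u: "integral_pair b R1 R2 u1 u2 f" and v: "integral_pair b R1 R2 v1 v2 g"
  shows "integral_pair b R1 R2 (\<lambda>x. c * u1 x + d * v1 x) (\<lambda>x. c * u2 x + d * v2 x) (\<lambda>x. c * f x + d * g x)"
  unfolding integral_pair_iff
proof (intro conjI ballI)
  note u' = integral_pairD[OF u] and v' = integral_pairD[OF v]

  have l1: "locally_integrable b \<mu>1 (\<lambda>x. c * u2 x)" "locally_integrable b \<mu>1 (\<lambda>x. d * v2 x)"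
    and l2: "locally_integrable b \<mu>2 (\<lambda>x. c * f x)" "locally_integrable b \<mu>2 (\<lambda>x. d * g x)"
    by (intro S1.locally_integrable_scale S2.locally_integrable_scale u' v')+
  show "locally_integrable b \<mu>1 (\<lambda>x. c * u2 x + d * v2 x)" by (rule S1.locally_integrable_add[OF l1])
  show "locally_integrable b \<mu>2 (\<lambda>x. c * f x + d * g x)" by (rule S2.locally_integrable_add[OF l2])
  fix x assume x: "x \<in> Ico0 b"
  show "c * u1 x + d * v1 x = c * u1 0 + d * v1 0 + cum \<mu>1 (\<lambda>x. c * u2 x + d * v2 x) x"
    using u'(3)[OF x] v'(3)[OF x] by (simp add: S1.cum_add[OF l1 x] S1.cum_scale algebra_simps)
  show "c * u2 x + d * v2 x = c * u2 0 + d * v2 0 - cum \<mu>2 (\<lambda>x. c * f x + d * g x) x"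
    unfolding u'(4)[OF x] v'(4)[OF x] S2.cum_add[OF l2 x] S2.cum_scale by (simp add: algebra_simps)
qed

lemma integral_pair_cnj:
  assumes u: "integral_pair b R1 R2 u1 u2 f"
  shows "integral_pair b R1 R2 (\<lambda>x. cnj (u1 x)) (\<lambda>x. cnj (u2 x)) (\<lambda>x. cnj (f x))"
  unfolding integral_pair_iff
proof (intro conjI ballI)
  note u' = integral_pairD[OF u]
  show "locally_integrable b \<mu>1 (\<lambda>x. cnj (u2 x))" "locally_integrable b \<mu>2 (\<lambda>x. cnj (f x))"
    by (intro S1.locally_integrable_cnj S2.locally_integrable_cnj u')+
  fix x assume x: "x \<in> Ico0 b"
  show "cnj (u1 x) = cnj (u1 0) + cum \<mu>1 (\<lambda>x. cnj (u2 x)) x"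
    unfolding u'(3)[OF x] S1.cum_cnj by simp
  show "cnj (u2 x) = cnj (u2 0) - cum \<mu>2 (\<lambda>x. cnj (f x)) x"
    unfolding u'(4)[OF x] S2.cum_cnj by simp
qed

lemma no_common_atoms: "s \<in> Ico0 b \<Longrightarrow> measure \<mu>1 {s} = 0 \<or> measure \<mu>2 {s} = 0"
  using no_common_jumps[of s] S1.no_atom[of s] S2.no_atom[of s] by blast

text \<open>
  Lagrange's identity: a first component is integrated against \<open>dR\<^sub>1\<close> and a second one against
  \<open>dR\<^sub>2\<close>, so their product has no contribution of common atoms.
\<close>

lemma integral_pair_product:
  assumes u: "integral_pair b R1 R2 u1 u2 f" and v: "integral_pair b R1 R2 v1 v2 g" and x: "x \<in> Ico0 b"
  shows "u1 x * v2 x = u1 0 * v2 0 + cum \<mu>1 (\<lambda>t. u2 t * v2 t) x - cum \<mu>2 (\<lambda>t. u1 t * g t) x"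
proof -
  note u' = integral_pairD[OF u] and v' = integral_pairD[OF v]
  have g': "locally_integrable b \<mu>2 (\<lambda>t. - 1 * g t)"
    by (rule S2.locally_integrable_scale[OF v'(2)])
  have "u1 x * v2 x = u1 0 * v2 0 + cum \<mu>1 (\<lambda>t. u2 t * v2 t) x + cum \<mu>2 (\<lambda>t. u1 t * (- 1 * g t)) x"
  proof (rule integration_by_parts[OF u'(1) g' x u'(3) _ no_common_atoms])
    show "v2 x = v2 0 + cum \<mu>2 (\<lambda>t. - 1 * g t) x" if "x \<in> Ico0 b" for x
      using v'(4)[OF that] unfolding S2.cum_scale by simp
  qed
  also have "cum \<mu>2 (\<lambda>t. u1 t * (- 1 * g t)) x = - cum \<mu>2 (\<lambda>t. u1 t * g t) x"
    using S2.cum_scale[of "- 1" "\<lambda>t. u1 t * g t" x] by simp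
  finally show ?thesis by simp
qed

lemma wronskian:
  assumes u: "integral_pair b R1 R2 u1 u2 (\<lambda>t. z * u1 t)" and v: "integral_pair b R1 R2 v1 v2 (\<lambda>t. z * v1 t)"
    and x: "x \<in> Ico0 b"
  shows "u1 x * v2 x - v1 x * u2 x = u1 0 * v2 0 - v1 0 * u2 0"
  using integral_pair_product[OF u v x] integral_pair_product[OF v u x]
  by (simp add: mult_ac)

subsection \<open>The Volterra operator\<close>

text \<open>
  The class of functions bounded by a multiple of \<open>1 + R\<^sub>1\<close> contains the solutions \<open>1\<close> and \<open>R\<^sub>1\<close>
  for the spectral parameter \<open>0\<close>, and on every \<open>[0,x)\<close> the Volterra operator preserves it.
\<close>

definition "weight t = ennreal (1 + R1 t)"

lemma weight_measurable [measurable]: "weight \<in> borel_measurable \<mu>2"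
  unfolding weight_def by measurable

abbreviation "weighted_simplex \<equiv> simplex_integral \<mu>2 weight"

definition volterra :: "(real \<Rightarrow> complex) \<Rightarrow> real \<Rightarrow> complex" where
  "volterra h x = cum \<mu>1 (cum \<mu>2 h) x"

lemma volterra_measurable: "h \<in> borel_measurable \<mu>2 \<Longrightarrow> volterra h \<in> borel_measurable \<mu>2"
  unfolding volterra_def[abs_def]
  by (intro S1.cum_measurable S2.cum_measurable S1.ico_measure_axioms S2.ico_measure_axioms)

lemma cum_bound:
  assumes h: "h \<in> borel_measurable \<mu>2" and x: "x \<in> Ico0 b"
    and le: "\<And>t. t \<in> Ico0 b \<Longrightarrow> t < x \<Longrightarrow> ennreal (cmod (h t)) \<le> c * (weight t * weighted_simplex n t)"
  shows "ennreal (cmod (cum \<mu>2 h x)) \<le> c * weighted_simplex (Suc n) x"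
proof -
  have "ennreal (cmod (cum \<mu>2 h x)) \<le> (\<integral>\<^sup>+s. (if s < x then ennreal (cmod (h s)) else 0) \<partial>\<mu>2)"
    by (rule S2.cum_norm_nn[OF h x])
  also have "\<dots> \<le> (\<integral>\<^sup>+s. c * (if s < x then weight s * weighted_simplex n s else 0) \<partial>\<mu>2)"
    by (intro nn_integral_mono) (auto intro: le)
  also have "\<dots> = c * weighted_simplex (Suc n) x"
    by (simp add: nn_integral_cmult S2.simplex_integral_measurable)
  finally show ?thesis .
qed

text \<open>
  The inner integration passes to the next simplex integral, which is nondecreasing; the outer one
  then contributes only the factor \<open>R\<^sub>1(x)\<close>.
\<close>

lemma volterra_bound:
  assumes h: "h \<in> borel_measurable \<mu>2" and x: "x \<in> Ico0 b"
    and le: "\<And>t. t \<in> Ico0 b \<Longrightarrow> t < x \<Longrightarrow> ennreal (cmod (h t)) \<le> c * (weight t * weighted_simplex n t)"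
  shows "ennreal (cmod (volterra h x)) \<le> c * (weight x * weighted_simplex (Suc n) x)"
proof -
  have "ennreal (cmod (volterra h x)) \<le> (\<integral>\<^sup>+t. (if t < x then ennreal (cmod (cum \<mu>2 h t)) else 0) \<partial>\<mu>1)"
    unfolding volterra_def
    by (intro S1.cum_norm_nn x S2.cum_measurable h S1.ico_measure_axioms)
  also have "\<dots> \<le> (\<integral>\<^sup>+t. c * weighted_simplex (Suc n) x * indicator {0..<x} t \<partial>\<mu>1)"
  proof (intro nn_integral_mono)
    fix t assume t: "t \<in> space \<mu>1"
    have "ennreal (cmod (cum \<mu>2 h t)) \<le> c * weighted_simplex (Suc n) x" if "t < x"
    proof -
      have "ennreal (cmod (cum \<mu>2 h t)) \<le> c * weighted_simplex (Suc n) t"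
        by (rule cum_bound[OF h]) (use t that le in auto)
      also have "\<dots> \<le> c * weighted_simplex (Suc n) x" using that 
        by (intro mult_left_mono S2.simplex_integral_mono) auto
      finally show ?thesis .
    qed
    then show "(if t < x then ennreal (cmod (cum \<mu>2 h t)) else 0) \<le> c * weighted_simplex (Suc n) x * indicator {0..<x} t"
      using t by (auto simp: indicator_def Ico0_def simp del: simplex_integral.simps)
  qed
  also have "\<dots> = c * weighted_simplex (Suc n) x * ennreal (R1 x)"
    using S1.emeasure_Ico[of x 0] x by (simp add: nn_integral_cmult_indicator Ico0_nonneg S1.zero del: simplex_integral.simps)
  also have "\<dots> \<le> c * weighted_simplex (Suc n) x * weight x"
    unfolding weight_def by (intro mult_left_mono ennreal_leI) auto
  finally show ?thesis by (simp only: mult_ac)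
qed

lemma simplex_finite:
  assumes x: "x \<in> Ico0 b"
  shows "weighted_simplex 1 x \<le> ennreal ((1 + R1 x) * R2 x)"
proof -
  have "weighted_simplex 1 x \<le> (\<integral>\<^sup>+t. ennreal (1 + R1 x) * indicator {0..<x} t \<partial>\<mu>2)"
    using S1.mono[OF _ x] x
    by (auto intro!: nn_integral_mono ennreal_leI simp: weight_def indicator_def Ico0_def)
  also have "\<dots> = ennreal ((1 + R1 x) * R2 x)"
    using S2.emeasure_Ico[of x 0] x S1.nonneg[OF x]
    by (simp add: nn_integral_cmult_indicator Ico0_nonneg S2.zero ennreal_mult')
  finally show ?thesis .
qed

text \<open>
  Two solutions of an initial value problem differ by a locally bounded fixed point of a multiple of
  the Volterra operator, and the powers of that operator decay factorially.
\<close>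

lemma homogeneous_unique:
  assumes u: "integral_pair b R1 R2 u1 u2 (\<lambda>t. z * u1 t)" and 0: "u1 0 = 0" "u2 0 = 0" and x: "x \<in> Ico0 b"
  shows "u1 x = 0"
proof -
  note u' = integral_pairD[OF u]
  have [measurable]: "u1 \<in> borel_measurable \<mu>2" by (rule integral_pair_measurable[OF u])
  have fixed_point: "u1 y = - z * volterra u1 y" if y: "y \<in> Ico0 b" for y
  proof -
    have "u1 y = cum \<mu>1 (\<lambda>t. - z * cum \<mu>2 u1 t) y"
      unfolding u'(3)[OF y] 0 by (simp, intro S1.cum_cong y) (simp add: u'(4) 0 S2.cum_scale)
    then show ?thesis by (simp only: S1.cum_scale volterra_def)
  qed
  obtain X where X: "X \<in> Ico0 b" "x < X" by (rule Ico0_next[OF x])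
  obtain B where B: "\<And>t. 0 \<le> t \<Longrightarrow> t < X \<Longrightarrow> cmod (u1 t) \<le> B"
    using integral_pair_locally_bounded(1)[OF u X(1)] by blast
  have B0: "0 \<le> B" using order_trans[OF norm_ge_zero B[OF Ico0_nonneg[OF x] X(2)]] .
  have it: "ennreal (cmod (u1 y)) \<le> ennreal (B * cmod z ^ n) * (weight y * weighted_simplex n y)"
    if "y \<in> Ico0 b" "y < X" for y n
    using that
  proof (induction n arbitrary: y)
    case 0
    have "cmod (u1 y) \<le> B * (1 + R1 y)"
    proof -
      have "B * 1 \<le> B * (1 + R1 y)" using B0 S1.nonneg[OF 0(1)] by (intro mult_left_mono) auto
      then show ?thesis using B[of y] 0 by (simp add: Ico0_nonneg)
    qed
    then show ?case using B0 by (simp add: weight_def ennreal_mult'[symmetric] ennreal_leI)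
  next
    case (Suc n)
    have "ennreal (cmod (volterra u1 y)) \<le> ennreal (B * cmod z ^ n) * (weight y * weighted_simplex (Suc n) y)"
      by (rule volterra_bound) (use Suc in auto)
    then have "ennreal (cmod z) * ennreal (cmod (volterra u1 y)) \<le> ennreal (cmod z) * (ennreal (B * cmod z ^ n) * (weight y * weighted_simplex (Suc n) y))"
      by (intro mult_left_mono) auto
    also have "ennreal (cmod z) * ennreal (cmod (volterra u1 y)) = ennreal (cmod (u1 y))"
      by (subst fixed_point[OF Suc.prems(1)]) (simp add: norm_mult ennreal_mult)
    also have "ennreal (cmod z) * (ennreal (B * cmod z ^ n) * (weight y * weighted_simplex (Suc n) y)) = ennreal (B * cmod z ^ Suc n) * (weight y * weighted_simplex (Suc n) y)"
    proof -
      have "ennreal (B * cmod z ^ Suc n) = ennreal (cmod z * (B * cmod z ^ n))" by (simp add: mult_ac)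
      also have "\<dots> = ennreal (cmod z) * ennreal (B * cmod z ^ n)" by (rule ennreal_mult') simp
      finally show ?thesis by (simp only: mult.assoc)
    qed
    finally show ?case .
  qed
  define a where "a = (1 + R1 x) * R2 x"
  have a0: "0 \<le> a" unfolding a_def using S1.nonneg[OF x] S2.nonneg[OF x] by simp
  have "cmod (u1 x) \<le> B * (1 + R1 x) * ((cmod z * a) ^ n / fact n)" for n
  proof -
    have "ennreal (cmod (u1 x)) \<le> ennreal (B * cmod z ^ n) * (weight x * weighted_simplex n x)" using it X x by blast
    also have "\<dots> \<le> ennreal (B * cmod z ^ n) * (weight x * ennreal (a ^ n / fact n))"
      using simplex_finite[OF x] a0 unfolding a_def[symmetric]
      by (intro mult_left_mono S2.simplex_integral_le_real) auto
    also have "\<dots> = ennreal (B * (1 + R1 x) * ((cmod z * a) ^ n / fact n))"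
    proof -
      have "ennreal (B * cmod z ^ n) * (ennreal (1 + R1 x) * ennreal (a ^ n / fact n))
        = ennreal ((B * cmod z ^ n) * ((1 + R1 x) * (a ^ n / fact n)))"
        using B0 a0 S1.nonneg[OF x] by (simp only: ennreal_mult' mult_nonneg_nonneg zero_le_power norm_ge_zero add_nonneg_nonneg zero_le_one)
      then show ?thesis unfolding weight_def by (simp add: power_mult_distrib mult_ac)
    qed
    finally show ?thesis
      using B0 a0 S1.nonneg[OF x] by (subst (asm) ennreal_le_iff) auto
  qed
  moreover have "(\<lambda>n. B * (1 + R1 x) * ((cmod z * a) ^ n / fact n)) \<longlonglongrightarrow> B * (1 + R1 x) * 0"
    using summable_LIMSEQ_zero[OF summable_exp[of "cmod z * a"]]
    by (intro tendsto_intros) (simp add: field_simps)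
  ultimately have "cmod (u1 x) \<le> B * (1 + R1 x) * 0"
    by (intro LIMSEQ_le_const) auto
  then show ?thesis by simp
qed

lemma solution_unique:
  assumes u: "integral_pair b R1 R2 u1 u2 (\<lambda>t. z * u1 t + g t)" and v: "integral_pair b R1 R2 v1 v2 (\<lambda>t. z * v1 t + g t)"
    and 0: "u1 0 = v1 0" "u2 0 = v2 0" and x: "x \<in> Ico0 b"
  shows "u1 x = v1 x" "u2 x = v2 x"
proof -
  have "integral_pair b R1 R2 (\<lambda>x. 1 * u1 x + - 1 * v1 x) (\<lambda>x. 1 * u2 x + - 1 * v2 x) 
     (\<lambda>x. z * (1 * u1 x + - 1 * v1 x))"
    using integral_pair_combine[OF u v, of 1 "- 1"] by (simp add: algebra_simps)
  from homogeneous_unique[OF this] have eq: "u1 x = v1 x" if "x \<in> Ico0 b" for x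
    using 0 that by simp
  show "u1 x = v1 x" by (rule eq[OF x])
  have "cum \<mu>2 (\<lambda>t. z * u1 t + g t) x = cum \<mu>2 (\<lambda>t. z * v1 t + g t) x"
    by (rule S2.cum_cong[OF x]) (simp add: eq)
  then show "u2 x = v2 x" using integral_pairD(4)[OF u x] integral_pairD(4)[OF v x] 0 by simp
qed

end

section \<open>Finite \<open>dR\<^sub>2\<close> and square-integrable \<open>R\<^sub>1\<close>\<close>

lemma (in ico_measure) cum_sums:
  assumes x: "x \<in> Ico0 b" and m [measurable]: "\<And>n. f n \<in> borel_measurable M"
    and B: "\<And>n t. t \<in> Ico0 b \<Longrightarrow> t < x \<Longrightarrow> cmod (f n t) \<le> B n" and s: "summable B"
  shows "(\<lambda>n. cum M (f n) x) sums cum M (\<lambda>t. \<Sum>n. f n t) x"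
proof -
  let ?f = "\<lambda>n t. indicator {0..<x} t *\<^sub>R f n t"
  have [measurable]: "{0..<x} \<in> sets M" using x by simp
  have I: "t \<in> Ico0 b" if "0 \<le> t" "t < x" for t using that x by (auto intro: Ico0_down)
  have B0: "0 \<le> B n" if "0 < x" for n
    using B[of 0 n] that b_pos order_trans[OF norm_ge_zero] by (auto intro: Ico0_zero)
  have bd: "norm (?f n t) \<le> indicator {0..<x} t * B n" for n t
    using B[OF I] by (auto simp: indicator_def)
  have ind: "integrable M (\<lambda>t. indicator {0..<x} t * B n)" for n
    using fin[OF x] by (intro integrable_mult_left integrable_real_indicator) auto
  have int: "integrable M (?f n)" for n
    by (rule Bochner_Integration.integrable_bound[OF ind[of n]]) 
      (measurable, intro AE_I2, simp only: real_norm_def, rule order_trans[OF bd abs_ge_self])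
  have "(\<lambda>n. \<integral>t. ?f n t \<partial>M) sums (\<integral>t. (\<Sum>n. ?f n t) \<partial>M)"
  proof (rule sums_integral[OF int])
    show "AE t in M. summable (\<lambda>n. norm (?f n t))"
    proof (intro AE_I2)
      fix t
      have "summable (\<lambda>n. indicator {0..<x} t * B n)" using s by (rule summable_mult)
      then show "summable (\<lambda>n. norm (?f n t))"
        by (rule summable_comparison_test'[where N = 0]) (use bd in auto)
    qed
    have "summable (\<lambda>n. measure M {0..<x} * B n)" using s by (rule summable_mult)
    then show "summable (\<lambda>n. \<integral>t. norm (?f n t) \<partial>M)"
    proof (rule summable_comparison_test'[where N = 0])
      fix n
      have "(\<integral>t. norm (?f n t) \<partial>M) \<le> (\<integral>t. indicator {0..<x} t * B n \<partial>M)"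
        by (intro integral_mono integrable_norm int ind bd)
      also have "\<dots> = measure M {0..<x} * B n"
        using Ico0_subset[OF x] by (simp add: space_M Int_absorb2)
      finally show "norm (\<integral>t. norm (?f n t) \<partial>M) \<le> measure M {0..<x} * B n" by simp
    qed
  qed
  moreover have "(\<Sum>n. ?f n t) = indicator {0..<x} t *\<^sub>R (\<Sum>n. f n t)" for t
    by (simp add: indicator_def)
  ultimately show ?thesis unfolding cum_def set_lebesgue_integral_def by simp
qed

lemma (in stieltjes) cum_bounded:
  assumes x: "x \<in> Ico0 b" and m [measurable]: "f \<in> borel_measurable (dR b R)"
    and B: "\<And>t. t \<in> Ico0 b \<Longrightarrow> t < x \<Longrightarrow> cmod (f t) \<le> B" and B0: "0 \<le> B"
  shows "cmod (cum (dR b R) f x) \<le> B * R x"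
proof -
  have [measurable]: "{0..<x} \<in> sets (dR b R)" using x by simp
  have I: "t \<in> Ico0 b" if "0 \<le> t" "t < x" for t using that x by (auto intro: Ico0_down)
  have "ennreal (cmod (cum (dR b R) f x)) \<le> (\<integral>\<^sup>+t. (if t < x then ennreal (cmod (f t)) else 0) \<partial>dR b R)"
    by (rule cum_norm_nn[OF m x])
  also have "\<dots> \<le> (\<integral>\<^sup>+t. ennreal B * indicator {0..<x} t \<partial>dR b R)"
    by (intro nn_integral_mono) (auto simp: indicator_def Ico0_nonneg intro!: ennreal_leI B)
  also have "\<dots> = ennreal (B * R x)"
    using emeasure_Ico[of x 0] x B0 by (simp add: nn_integral_cmult_indicator Ico0_nonneg zero ennreal_mult')
  finally show ?thesis using B0 nonneg[OF x] by (subst (asm) ennreal_le_iff) auto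
qed

lemma norm_mult_le_squares: "norm (x :: complex) * norm (y :: complex) \<le> (norm x)\<^sup>2 + (norm y)\<^sup>2"
proof -
  have "0 \<le> norm x * norm y" "2 * norm x * norm y \<le> (norm x)\<^sup>2 + (norm y)\<^sup>2"
    by (auto intro: sum_squares_bound)
  then show ?thesis by linarith
qed

lemma zero_L2_fun: "(\<lambda>x. 0) \<in> L2_fun M"
  by (simp add: L2_fun_def)

lemma L2_fun_bound:
  assumes g: "g \<in> L2_fun M" and f [measurable]: "f \<in> borel_measurable M"
    and le: "\<And>x. x \<in> space M \<Longrightarrow> cmod (f x) \<le> cmod (g x)"
  shows "f \<in> L2_fun M"
proof -
  have "integrable M (\<lambda>x. (cmod (g x))\<^sup>2)" using g by (simp add: L2_fun_def)
  then have "integrable M (\<lambda>x. (cmod (f x))\<^sup>2)"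
    by (rule Bochner_Integration.integrable_bound) (auto intro!: AE_I2 power_mono le)
  then show ?thesis by (simp add: L2_fun_def)
qed

lemma L2_fun_measurable: "f \<in> L2_fun M \<Longrightarrow> f \<in> borel_measurable M"
  by (simp add: L2_fun_def)

lemma cnj_borel_measurable [measurable]: "cnj \<in> borel_measurable borel"
  by (intro borel_measurable_continuous_onI continuous_intros)

lemma L2_fun_mult_integrable:
  assumes f: "f \<in> L2_fun M" and g: "g \<in> L2_fun M"
  shows "integrable M (\<lambda>x. f x * g x)"
proof -
  have [measurable]: "f \<in> borel_measurable M" "g \<in> borel_measurable M"
    using f g by (auto intro: L2_fun_measurable)
  have "integrable M (\<lambda>x. (cmod (f x))\<^sup>2 + (cmod (g x))\<^sup>2)"
    using f g by (auto simp: L2_fun_def)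
  then show ?thesis
    by (rule Bochner_Integration.integrable_bound) (auto simp: norm_mult norm_mult_le_squares)
qed

lemma L2_fun_cnj: "f \<in> L2_fun M \<Longrightarrow> (\<lambda>x. cnj (f x)) \<in> L2_fun M"
  by (auto simp: L2_fun_def)

text \<open>
  The limit circle case in terms of the spectral parameter \<open>0\<close>: the two assumptions concern the
  first components of the fundamental solutions \<open>(1, 0)\<close> and \<open>(R\<^sub>1, 1)\<close>.
\<close>

locale limit_circle_system = integral_system +
  assumes one_L2: "(\<lambda>x. 1) \<in> L2_fun (dR b R2)"
    and R1_L2: "(\<lambda>x. complex_of_real (R1 x)) \<in> L2_fun (dR b R2)"
begin

lemma finite_mu2: "emeasure \<mu>2 (space \<mu>2) \<noteq> \<infinity>"
  using one_L2 by (simp add: L2_fun_def integrable_iff_bounded)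

sublocale F2: finite_measure \<mu>2
  by (rule finite_measureI) (rule finite_mu2)

lemma L2_integrable: "f \<in> L2_fun \<mu>2 \<Longrightarrow> integrable \<mu>2 f"
  using L2_fun_mult_integrable[OF _ one_L2, of f] by simp

lemma R1_integrable: "integrable \<mu>2 R1"
  using integrable_Re[OF L2_integrable[OF R1_L2]] by simp

lemma dominated_L2:
  assumes [measurable]: "u \<in> borel_measurable \<mu>2" and le: "\<And>x. x \<in> Ico0 b \<Longrightarrow> cmod (u x) \<le> C * (1 + R1 x)"
  shows "u \<in> L2_fun \<mu>2"
proof (rule L2_fun_bound)
  show "(\<lambda>x. complex_of_real C * (1 + complex_of_real (R1 x))) \<in> L2_fun \<mu>2"
    by (intro L2_fun_scale L2_fun_add one_L2 R1_L2)
  fix x assume "x \<in> space \<mu>2"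
  then have "cmod (u x) \<le> Re (complex_of_real C * (1 + complex_of_real (R1 x)))" using le by simp
  then show "cmod (u x) \<le> cmod (complex_of_real C * (1 + complex_of_real (R1 x)))"
    using complex_Re_le_cmod by (rule order_trans)
qed measurable

lemma cum2_le:
  assumes f: "integrable \<mu>2 f" and x: "x \<in> Ico0 b"
  shows "cmod (cum \<mu>2 f x) \<le> (\<integral>t. cmod (f t) \<partial>\<mu>2)"
proof -
  have "cmod (cum \<mu>2 f x) \<le> (LINT t:{0..<x}|\<mu>2. cmod (f t))"
    by (rule S2.norm_cum_le_cum[OF S2.integrable_locally[OF f] x])
  also have "\<dots> \<le> (\<integral>t. cmod (f t) \<partial>\<mu>2)" unfolding set_lebesgue_integral_def
    by (intro integral_mono integrable_mult_indicator integrable_norm f) (use x in \<open>auto simp: indicator_def intro!: S2.Ico_sets\<close>)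
  finally show ?thesis .
qed

lemma growth:
  assumes u: "integral_pair b R1 R2 u1 u2 f" and f: "integrable \<mu>2 f"
  shows "\<exists>C\<ge>0. \<forall>x\<in>Ico0 b. cmod (u2 x) \<le> C \<and> cmod (u1 x) \<le> C * (1 + R1 x)"
proof -
  note u' = integral_pairD[OF u]
  define B where "B = cmod (u2 0) + (\<integral>t. cmod (f t) \<partial>\<mu>2)"
  have B0: "0 \<le> B" by (simp add: B_def)
  have B: "cmod (u2 x) \<le> B" if "x \<in> Ico0 b" for x
    using cum2_le[OF f that] norm_triangle_ineq4[of "u2 0" "cum \<mu>2 f x"] unfolding u'(4)[OF that] B_def by linarith
  define C where "C = max B (cmod (u1 0))"
  have C: "B \<le> C" "cmod (u1 0) \<le> C" by (auto simp: C_def)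
  have "cmod (u1 x) \<le> C * (1 + R1 x)" if x: "x \<in> Ico0 b" for x
  proof -
    have "cmod (cum \<mu>1 u2 x) \<le> B * R1 x"
      by (rule S1.cum_bounded[OF x]) (use B B0 integral_pair_measurable[OF u] in auto)
    also have "\<dots> \<le> C * R1 x" using C S1.nonneg[OF x] by (intro mult_right_mono)
    finally show ?thesis using norm_triangle_ineq[of "u1 0" "cum \<mu>1 u2 x"] C(2)
      unfolding u'(3)[OF x] by (simp add: algebra_simps)
  qed
  moreover have "cmod (u2 x) \<le> C" if "x \<in> Ico0 b" for x using B[OF that] C(1) by (rule order_trans)
  moreover have "0 \<le> C" using B0 C(1) by (rule order_trans)
  ultimately show ?thesis by blast
qed

lemma integral_pair_L2:
  assumes u: "integral_pair b R1 R2 u1 u2 f" and f: "integrable \<mu>2 f"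
  shows "u1 \<in> L2_fun \<mu>2"
proof -
  obtain C where "\<forall>x\<in>Ico0 b. cmod (u2 x) \<le> C \<and> cmod (u1 x) \<le> C * (1 + R1 x)"
    using growth[OF u f] by blast
  then have "\<And>x. x \<in> Ico0 b \<Longrightarrow> cmod (u1 x) \<le> C * (1 + R1 x)" by simp
  then show ?thesis using integral_pair_measurable[OF u] by (intro dominated_L2)
qed

lemma triples_iff:
  "(u1, u2, f) \<in> triples b R1 R2 \<longleftrightarrow> f \<in> L2_fun \<mu>2 \<and> integral_pair b R1 R2 u1 u2 f"
  unfolding triples_def using integral_pair_L2 L2_integrable by auto

text \<open>
  The first component is automatically square-integrable, so \<open>f\<close> and both initial values can be
  prescribed freely.
\<close>

lemma triple_exists:
  assumes f: "f \<in> L2_fun \<mu>2"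
  obtains u1 u2 where "(u1, u2, f) \<in> triples b R1 R2" "u1 0 = p1" "u2 0 = p2"
proof -
  note fi = S2.integrable_locally[OF L2_integrable[OF f]]
  define u2 where "u2 x = p2 - cum \<mu>2 f x" for x
  define u1 where "u1 x = p1 + cum \<mu>1 u2 x" for x
  have "locally_integrable b \<mu>1 u2"
  proof (rule S1.locally_integrable_bounded)
    show "u2 \<in> borel_measurable \<mu>1" unfolding u2_def[abs_def]
      using S2.cum_measurable[OF L2_fun_measurable[OF f] S1.ico_measure_axioms] by auto
    fix x assume "x \<in> Ico0 b"
    from S2.cum_locally_bounded[OF fi this, of "- p2"]
    show "\<exists>B. \<forall>t\<ge>0. t < x \<longrightarrow> cmod (u2 t) \<le> B"
      by (simp add: u2_def norm_minus_commute)
  qed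
  then have "integral_pair b R1 R2 u1 u2 f" using fi
    unfolding integral_pair_iff by (simp add: u1_def u2_def)
  then show ?thesis by (intro that[of u1 u2]) (use f in \<open>auto simp: triples_iff u1_def u2_def\<close>)
qed

subsection \<open>Solutions by the Volterra series\<close>

definition "total_weight = (\<integral>t. 1 + R1 t \<partial>\<mu>2)"

lemma total_weight_nonneg: "0 \<le> total_weight"
  unfolding total_weight_def using S1.nonneg by (intro integral_nonneg_AE AE_I2) (auto intro: add_nonneg_nonneg)

lemma weighted_simplex_le:
  "weighted_simplex n x \<le> ennreal (total_weight ^ n / fact n)"
proof (rule S2.simplex_integral_le_real[OF weight_measurable _ total_weight_nonneg])
  have "weighted_simplex 1 x \<le> (\<integral>\<^sup>+t. ennreal (1 + R1 t) \<partial>\<mu>2)"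
    by (auto intro!: nn_integral_mono simp: weight_def)
  also have "\<dots> = ennreal total_weight"
    unfolding total_weight_def using S1.nonneg R1_integrable
    by (intro nn_integral_eq_integral AE_I2) (auto intro: add_nonneg_nonneg)
  finally show "weighted_simplex 1 x \<le> ennreal total_weight" .
qed

end

text \<open>
  The equation \<open>u = h - z K u\<close>, where \<open>K\<close> is the Volterra operator, is solved by the Neumann series.
  It covers the homogeneous and the inhomogeneous system, by the choice of \<open>h\<close>.
\<close>

locale volterra_series = limit_circle_system +
  fixes h :: "real \<Rightarrow> complex" and C :: real
  assumes h_measurable: "h \<in> borel_measurable (dR b R2)"
    and h_le: "\<And>x. x \<in> Ico0 b \<Longrightarrow> cmod (h x) \<le> C * (1 + R1 x)" and C_nonneg: "0 \<le> C"
begin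

definition "iter n = (volterra ^^ n) h"

definition "solution z x = (\<Sum>n. (- z) ^ n * iter n x)"

lemma iter_measurable [measurable]: "iter n \<in> borel_measurable \<mu>2"
  unfolding iter_def by (induction n) (auto intro: h_measurable volterra_measurable)

lemma iter_0: "iter 0 = h" and iter_Suc: "iter (Suc n) = volterra (iter n)"
  by (simp_all add: iter_def)

lemma iter_le:
  assumes x: "x \<in> Ico0 b"
  shows "cmod (iter n x) \<le> C * (1 + R1 x) * (total_weight ^ n / fact n)"
proof -
  have "ennreal (cmod (iter n x)) \<le> ennreal C * (weight x * weighted_simplex n x)"
    using x
  proof (induction n arbitrary: x)
    case 0
    then show ?case using h_le[OF 0] C_nonneg by (simp add: iter_0 weight_def ennreal_mult'[symmetric] ennreal_leI)
  next
    case (Suc n)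
    then show ?case unfolding iter_Suc by (intro volterra_bound iter_measurable)
  qed
  also have "\<dots> \<le> ennreal C * (weight x * ennreal (total_weight ^ n / fact n))"
    by (intro mult_left_mono weighted_simplex_le) auto
  also have "\<dots> = ennreal (C * (1 + R1 x) * (total_weight ^ n / fact n))"
    unfolding weight_def using C_nonneg S1.nonneg[OF x] total_weight_nonneg
    by (simp only: ennreal_mult' mult_nonneg_nonneg zero_le_power add_nonneg_nonneg zero_le_one mult.assoc)
  finally show ?thesis
    using C_nonneg S1.nonneg[OF x] total_weight_nonneg by (subst (asm) ennreal_le_iff) auto
qed

lemma term_le:
  assumes x: "x \<in> Ico0 b"
  shows "cmod ((- z) ^ n * iter n x) \<le> C * (1 + R1 x) * ((cmod z * total_weight) ^ n / fact n)"
proof -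
  have "cmod ((- z) ^ n * iter n x) = cmod z ^ n * cmod (iter n x)" by (simp add: norm_mult norm_power)
  also have "\<dots> \<le> cmod z ^ n * (C * (1 + R1 x) * (total_weight ^ n / fact n))"
    by (intro mult_left_mono iter_le x) auto
  finally show ?thesis by (simp add: power_mult_distrib mult_ac)
qed

lemma exp_terms_summable: "summable (\<lambda>n. K * ((cmod z * total_weight) ^ n / fact n))"
  using summable_mult[OF summable_exp[of "cmod z * total_weight"], of K] by (simp add: field_simps)

lemma term_summable: "x \<in> Ico0 b \<Longrightarrow> summable (\<lambda>n. cmod ((- z) ^ n * iter n x))"
  by (rule summable_comparison_test'[OF exp_terms_summable, where N = 0]) (use term_le in auto)

lemma solution_measurable [measurable]: "solution z \<in> borel_measurable \<mu>2"
  unfolding solution_def[abs_def] by measurable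

lemma solution_le:
  assumes x: "x \<in> Ico0 b"
  shows "cmod (solution z x) \<le> (C * (\<Sum>n. (cmod z * total_weight) ^ n / fact n)) * (1 + R1 x)"
proof -
  have "cmod (solution z x) \<le> (\<Sum>n. cmod ((- z) ^ n * iter n x))"
    unfolding solution_def by (rule summable_norm[OF term_summable[OF x]])
  also have "\<dots> \<le> (\<Sum>n. (C * (1 + R1 x)) * ((cmod z * total_weight) ^ n / fact n))"
    by (intro suminf_le term_le x term_summable exp_terms_summable)
  also have "\<dots> = C * (1 + R1 x) * (\<Sum>n. (cmod z * total_weight) ^ n / fact n)"
    using exp_terms_summable[of 1 z] by (intro suminf_mult) simp
  finally show ?thesis by (simp add: mult_ac)
qed

lemma solution_L2: "solution z \<in> L2_fun \<mu>2"
  by (rule dominated_L2[OF solution_measurable solution_le])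

lemma cum_solution:
  assumes x: "x \<in> Ico0 b"
  shows "(\<lambda>n. (- z) ^ n * cum \<mu>2 (iter n) x) sums cum \<mu>2 (solution z) x"
proof -
  have "(\<lambda>n. cum \<mu>2 (\<lambda>t. (- z) ^ n * iter n t) x) sums cum \<mu>2 (\<lambda>t. \<Sum>n. (- z) ^ n * iter n t) x"
  proof (rule S2.cum_sums[OF x])
    show "summable (\<lambda>n. C * (1 + R1 x) * ((cmod z * total_weight) ^ n / fact n))" by (rule exp_terms_summable)
    fix n t assume t: "t \<in> Ico0 b" "t < x"
    have "cmod ((- z) ^ n * iter n t) \<le> C * (1 + R1 t) * ((cmod z * total_weight) ^ n / fact n)"
      by (rule term_le[OF t(1)])
    also have "\<dots> \<le> C * (1 + R1 x) * ((cmod z * total_weight) ^ n / fact n)"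
      using S1.mono[OF t(1) x] t(2) C_nonneg total_weight_nonneg by (intro mult_right_mono mult_left_mono) auto
    finally show "cmod ((- z) ^ n * iter n t) \<le> C * (1 + R1 x) * ((cmod z * total_weight) ^ n / fact n)" .
  qed measurable
  then show ?thesis unfolding S2.cum_scale solution_def[abs_def] .
qed

lemma cum_iter_le:
  assumes t: "t \<in> Ico0 b"
  shows "cmod (cum \<mu>2 (iter n) t) \<le> C * (1 + R1 t) * (total_weight ^ n / fact n) * R2 t"
proof (rule S2.cum_bounded[OF t iter_measurable])
  show "0 \<le> C * (1 + R1 t) * (total_weight ^ n / fact n)"
    using C_nonneg S1.nonneg[OF t] total_weight_nonneg by simp
  fix s assume s: "s \<in> Ico0 b" "s < t"
  have "cmod (iter n s) \<le> C * (1 + R1 s) * (total_weight ^ n / fact n)" by (rule iter_le[OF s(1)])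
  also have "\<dots> \<le> C * (1 + R1 t) * (total_weight ^ n / fact n)"
    using S1.mono[OF s(1) t] s(2) C_nonneg total_weight_nonneg by (intro mult_right_mono mult_left_mono) auto
  finally show "cmod (iter n s) \<le> C * (1 + R1 t) * (total_weight ^ n / fact n)" .
qed

lemma solution_fixed_point:
  assumes x: "x \<in> Ico0 b"
  shows "solution z x = h x - z * volterra (solution z) x"
proof -
  let ?B = "\<lambda>n. (C * (1 + R1 x) * R2 x) * ((cmod z * total_weight) ^ n / fact n)"
  have "(\<lambda>n. cum \<mu>1 (\<lambda>t. (- z) ^ n * cum \<mu>2 (iter n) t) x) sums cum \<mu>1 (\<lambda>t. \<Sum>n. (- z) ^ n * cum \<mu>2 (iter n) t) x"
  proof (rule S1.cum_sums[OF x])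
    show "summable ?B" by (rule exp_terms_summable)
    have [measurable]: "cum \<mu>2 (iter n) \<in> borel_measurable \<mu>1" for n
      by (intro S2.cum_measurable iter_measurable S1.ico_measure_axioms)
    show "(\<lambda>t. (- z) ^ n * cum \<mu>2 (iter n) t) \<in> borel_measurable \<mu>1" for n by measurable
    fix n t assume t: "t \<in> Ico0 b" "t < x"
    have "cmod ((- z) ^ n * cum \<mu>2 (iter n) t) \<le> cmod z ^ n * (C * (1 + R1 t) * (total_weight ^ n / fact n) * R2 t)"
      unfolding norm_mult norm_power norm_minus_cancel by (intro mult_left_mono cum_iter_le t) auto
    also have "\<dots> \<le> cmod z ^ n * (C * (1 + R1 x) * (total_weight ^ n / fact n) * R2 x)"
      using S1.mono[OF t(1) x] S2.mono[OF t(1) x] t(2) C_nonneg total_weight_nonneg S1.nonneg[OF t(1)] S2.nonneg[OF t(1)] S1.nonneg[OF x]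
      by (intro mult_left_mono mult_mono mult_nonneg_nonneg) auto
    also have "\<dots> = ?B n" by (simp add: power_mult_distrib mult_ac)
    finally show "cmod ((- z) ^ n * cum \<mu>2 (iter n) t) \<le> ?B n" .
  qed
  also have "cum \<mu>1 (\<lambda>t. \<Sum>n. (- z) ^ n * cum \<mu>2 (iter n) t) x = volterra (solution z) x"
    unfolding volterra_def by (intro S1.cum_cong[OF x]) (rule sums_unique[OF cum_solution, symmetric])
  finally have "(\<lambda>n. (- z) ^ n * iter (Suc n) x) sums volterra (solution z) x"
    unfolding S1.cum_scale iter_Suc volterra_def .
  then have "(\<lambda>n. (- z) * ((- z) ^ n * iter (Suc n) x)) sums ((- z) * volterra (solution z) x)"
    by (rule sums_mult)
  then have "(\<lambda>n. (- z) ^ Suc n * iter (Suc n) x) sums (- z * volterra (solution z) x)"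
    by (simp add: mult.assoc)
  then have "(\<lambda>n. (- z) ^ n * iter n x) sums (- z * volterra (solution z) x + (- z) ^ 0 * iter 0 x)"
    by (subst (asm) sums_Suc_iff[where f = "\<lambda>n. (- z) ^ n * iter n x"]) (simp add: algebra_simps)
  then show ?thesis unfolding solution_def[of z x] by (simp add: sums_iff iter_0)
qed

text \<open>
  The integral of a solution over \<open>[0,b)\<close>, and with it the boundary value of its second component, is
  given by a power series in \<open>z\<close> that converges everywhere.
\<close>

lemma integral_solution: "(\<lambda>n. (\<integral>t. iter n t \<partial>\<mu>2) * (- z) ^ n) sums (\<integral>t. solution z t \<partial>\<mu>2)"
proof -
  have w: "integrable \<mu>2 (\<lambda>t. K * (1 + R1 t))" for K using R1_integrable by auto
  have bd: "norm ((- z) ^ n * iter n t) \<le> (C * ((cmod z * total_weight) ^ n / fact n)) * (1 + R1 t)" if "t \<in> space \<mu>2" for n t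
    using term_le[of t z n] that by (simp add: mult_ac)
  have int: "integrable \<mu>2 (\<lambda>t. (- z) ^ n * iter n t)" for n
    by (rule Bochner_Integration.integrable_bound[OF w[of "C * ((cmod z * total_weight) ^ n / fact n)"]])
      (measurable, intro AE_I2, simp only: real_norm_def, rule order_trans[OF bd abs_ge_self])
  have "(\<lambda>n. \<integral>t. (- z) ^ n * iter n t \<partial>\<mu>2) sums (\<integral>t. (\<Sum>n. (- z) ^ n * iter n t) \<partial>\<mu>2)"
  proof (rule sums_integral[OF int])
    show "AE t in \<mu>2. summable (\<lambda>n. norm ((- z) ^ n * iter n t))"
      by (intro AE_I2) (use term_summable in auto)
    show "summable (\<lambda>n. \<integral>t. norm ((- z) ^ n * iter n t) \<partial>\<mu>2)"
    proof (rule summable_comparison_test'[OF exp_terms_summable[of "C * total_weight" z], where N = 0])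
      fix n
      have "(\<integral>t. norm ((- z) ^ n * iter n t) \<partial>\<mu>2) \<le> (\<integral>t. (C * ((cmod z * total_weight) ^ n / fact n)) * (1 + R1 t) \<partial>\<mu>2)"
        by (intro integral_mono integrable_norm int w bd)
      also have "\<dots> = (C * ((cmod z * total_weight) ^ n / fact n)) * total_weight"
        unfolding total_weight_def by (rule integral_mult_right_zero)
      finally show "norm (\<integral>t. norm ((- z) ^ n * iter n t) \<partial>\<mu>2) \<le> C * total_weight * ((cmod z * total_weight) ^ n / fact n)"
        by (simp add: mult_ac)
    qed
  qed
  then show ?thesis by (simp add: solution_def[abs_def] mult.commute)
qed

end

section \<open>Consequences of the limit circle case\<close>

context integral_system
begin

lemma integral_pair_AE:
  assumes u: "integral_pair b R1 R2 u1 u2 f" and g: "g \<in> borel_measurable \<mu>2" and ae: "AE t in \<mu>2. f t = g t"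
  shows "integral_pair b R1 R2 u1 u2 g"
proof -
  note u' = integral_pairD[OF u]
  have m: "f \<in> borel_measurable \<mu>2" by (rule integral_pair_measurable[OF u])
  have "locally_integrable b \<mu>2 g" unfolding locally_integrable_def
  proof
    fix x assume x: "x \<in> Ico0 b"
    have [measurable]: "{0..<x} \<in> sets \<mu>2" using x by simp
    note [measurable] = m g
    have "integrable \<mu>2 (\<lambda>t. indicator {0..<x} t *\<^sub>R f t) \<longleftrightarrow> integrable \<mu>2 (\<lambda>t. indicator {0..<x} t *\<^sub>R g t)"
      by (rule integrable_cong_AE; (measurable)?) (use ae in \<open>auto elim!: AE_mp\<close>)
    then show "set_integrable \<mu>2 {0..<x} g"
      using S2.locally_integrableD[OF u'(2) x] by (simp add: set_integrable_def)
  qed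
  moreover have "cum \<mu>2 f x = cum \<mu>2 g x" if "x \<in> Ico0 b" for x
    by (rule S2.cum_AE_cong[OF ae m g that])
  ultimately show ?thesis using u' unfolding integral_pair_iff by metis
qed

text \<open>
  Where \<open>u\<^sub>2\<close> is close to \<open>L\<close>, the increments of \<open>u\<^sub>1\<close> are close to those of \<open>L R\<^sub>1\<close>.
\<close>

lemma asymptotics:
  assumes u: "integral_pair b R1 R2 u1 u2 f" and x: "x0 \<in> Ico0 b" "x \<in> Ico0 b" "x0 \<le> x"
    and e: "\<And>t. t \<in> Ico0 b \<Longrightarrow> x0 \<le> t \<Longrightarrow> cmod (u2 t - L) \<le> e" and e0: "0 \<le> e"
  shows "cmod (u1 x - u1 x0 - L * (R1 x - R1 x0)) \<le> e * R1 x"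
proof -
  note u' = integral_pairD[OF u]
  have [measurable]: "u2 \<in> borel_measurable \<mu>1" by (rule integral_pair_measurable[OF u])
  let ?g = "\<lambda>t. u2 t - L"
  let ?h = "\<lambda>t. if x0 \<le> t then ?g t else 0"
  have g: "locally_integrable b \<mu>1 ?g"
    by (rule S1.locally_integrable_diff[OF u'(1) S1.locally_integrable_const])
  have ind: "integrable \<mu>1 (\<lambda>t. indicator {0..<y} t *\<^sub>R ?g t)" if "y \<in> Ico0 b" for y
    using S1.locally_integrableD[OF g that] by (simp add: set_integrable_def)
  have cum_g: "cum \<mu>1 ?g y = cum \<mu>1 u2 y - L * R1 y" if "y \<in> Ico0 b" for y
    by (simp add: S1.cum_diff[OF u'(1) S1.locally_integrable_const that] S1.cum_const that)
  have "cum \<mu>1 ?g x - cum \<mu>1 ?g x0 = (\<integral>t. indicator {0..<x} t *\<^sub>R ?g t - indicator {0..<x0} t *\<^sub>R ?g t \<partial>\<mu>1)"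
    unfolding cum_def set_lebesgue_integral_def
    by (rule Bochner_Integration.integral_diff[symmetric]; rule ind; rule x)
  also have "\<dots> = cum \<mu>1 ?h x"
    unfolding cum_def set_lebesgue_integral_def
    using x by (intro Bochner_Integration.integral_cong refl) (auto simp: indicator_def)
  finally have "u1 x - u1 x0 - L * (R1 x - R1 x0) = cum \<mu>1 ?h x"
    unfolding cum_g[OF x(1)] cum_g[OF x(2)] u'(3)[OF x(1)] u'(3)[OF x(2)] by (simp add: algebra_simps)
  moreover have "cmod (cum \<mu>1 ?h x) \<le> e * R1 x"
  proof (rule S1.cum_bounded[OF x(2) _ _ e0])
    note [measurable] = S1.id_meas
    show "?h \<in> borel_measurable \<mu>1" by measurable
  qed (use e e0 in auto)
  ultimately show ?thesis by simp
qed

lemma ratio_tendsto: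
  assumes u: "integral_pair b R1 R2 u1 u2 f" and lim: "(u2 \<longlongrightarrow> L) (at_end b)"
    and R1: "filterlim R1 at_top (at_end b)"
  shows "((\<lambda>x. u1 x / R1 x) \<longlongrightarrow> L) (at_end b)"
proof (rule tendstoI)
  fix e :: real assume e: "0 < e"
  then have "eventually (\<lambda>x. dist (u2 x) L < e / 2) (at_end b)"
    using lim by (intro tendstoD) auto
  then obtain x0 where x0: "x0 \<in> Ico0 b" "\<And>t. t \<in> Ico0 b \<Longrightarrow> x0 \<le> t \<Longrightarrow> dist (u2 t) L < e / 2"
    unfolding eventually_at_end[OF b_pos] by blast
  define K where "K = cmod (u1 x0) + cmod L * R1 x0"
  have "eventually (\<lambda>x. 2 * K / e + 1 \<le> R1 x) (at_end b)" "eventually (\<lambda>x. 1 \<le> R1 x) (at_end b)"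
    using R1 by (auto simp: filterlim_at_top)
  with eventually_at_end_Ico0[OF b_pos] eventually_at_end_ge[OF b_pos x0(1)]
  show "eventually (\<lambda>x. dist (u1 x / R1 x) L < e) (at_end b)"
  proof eventually_elim
    case (elim x)
    have "cmod (u1 x - u1 x0 - L * (R1 x - R1 x0)) \<le> e / 2 * R1 x"
      by (rule asymptotics[OF u x0(1)]) (use elim x0(2) e in \<open>auto simp: dist_norm less_imp_le\<close>)
    moreover have "u1 x - L * R1 x = (u1 x - u1 x0 - L * (R1 x - R1 x0)) + (u1 x0 - L * R1 x0)"
      by (simp add: algebra_simps)
    then have "cmod (u1 x - L * R1 x) \<le> cmod (u1 x - u1 x0 - L * (R1 x - R1 x0)) + cmod (u1 x0 - L * R1 x0)"
      by (simp only: norm_triangle_ineq)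
    ultimately have "cmod (u1 x - L * R1 x) \<le> e / 2 * R1 x + cmod (u1 x0 - L * R1 x0)"
      by linarith
    also have "cmod (u1 x0 - L * R1 x0) \<le> K"
      using norm_triangle_ineq4[of "u1 x0" "L * R1 x0"] S1.nonneg[OF x0(1)] by (simp add: K_def norm_mult)
    also have "K < e / 2 * R1 x" using elim e by (simp add: field_simps)
    finally have le: "cmod (u1 x - L * R1 x) < e * R1 x" by simp
    have "u1 x / R1 x - L = (u1 x - L * R1 x) / R1 x" using elim by (simp add: field_simps)
    then have "cmod (u1 x / R1 x - L) = cmod (u1 x - L * R1 x) / R1 x"
      using elim by (simp add: norm_divide)
    also have "\<dots> < e" using le elim by (simp add: field_simps)
    finally show ?case by (simp add: dist_norm)
  qed
qed

text \<open>
  The real part of \<open>u\<^sub>1 \<cdot> cnj u\<^sub>2\<close> grows when the spectral parameter is imaginary, and therefore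
  so does \<open>\<bar>u\<^sub>1\<bar>\<close>.
\<close>

lemma norm_nondecreasing_imaginary:
  assumes u: "integral_pair b R1 R2 u1 u2 (\<lambda>t. \<i> * u1 t)" and 0: "u1 0 * cnj (u2 0) = 0"
    and x: "x \<in> Ico0 b" and y: "y \<in> Ico0 b" "x \<le> y"
  shows "cmod (u1 x) \<le> cmod (u1 y)"
proof (rule S1.norm_nondecreasing[OF integral_pairD(1)[OF u] integral_pairD(3)[OF u] _ x y])
  fix t assume t: "t \<in> Ico0 b"
  have sq: "z * cnj z = complex_of_real ((cmod z)\<^sup>2)" for z by (rule complex_norm_square[symmetric])
  have "u1 t * cnj (u2 t) = cum \<mu>1 (\<lambda>t. u2 t * cnj (u2 t)) t - cum \<mu>2 (\<lambda>t. u1 t * cnj (\<i> * u1 t)) t"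
    using integral_pair_product[OF u integral_pair_cnj[OF u] t] 0 by simp
  also have "(\<lambda>t. u1 t * cnj (\<i> * u1 t)) = (\<lambda>t. - \<i> * complex_of_real ((cmod (u1 t))\<^sup>2))"
    unfolding sq[symmetric] by (simp add: mult_ac)
  also have "cum \<mu>2 \<dots> t = - \<i> * cum \<mu>2 (\<lambda>t. complex_of_real ((cmod (u1 t))\<^sup>2)) t"
    by (rule S2.cum_scale)
  also have "cum \<mu>2 (\<lambda>t. complex_of_real ((cmod (u1 t))\<^sup>2)) t = complex_of_real (LINT s:{0..<t}|\<mu>2. (cmod (u1 s))\<^sup>2)"
    unfolding cum_def by (rule set_integral_complex_of_real)
  also have "cum \<mu>1 (\<lambda>t. u2 t * cnj (u2 t)) t = complex_of_real (LINT s:{0..<t}|\<mu>1. (cmod (u2 s))\<^sup>2)"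
    unfolding cum_def sq by (rule set_integral_complex_of_real)
  finally have "Re (u1 t * cnj (u2 t)) = (LINT s:{0..<t}|\<mu>1. (cmod (u2 s))\<^sup>2)" by simp
  moreover have "0 \<le> (LINT s:{0..<t}|\<mu>1. (cmod (u2 s))\<^sup>2)"
    unfolding set_lebesgue_integral_def by (intro integral_nonneg_AE AE_I2) auto
  moreover have "Re (cnj (u1 t) * u2 t) = Re (u1 t * cnj (u2 t))" by simp
  ultimately show "0 \<le> Re (cnj (u1 t) * u2 t)" by simp
qed

text \<open>
  If \<open>w\<^sub>2(b) = 0\<close> then \<open>w\<^sub>2(x)\<close> is \<open>\<i>\<close> times the integral of \<open>w\<^sub>1\<close> over \<open>[x,b)\<close>, where \<open>\<bar>v\<^sub>1\<bar>\<close>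
  is at least its value at \<open>x\<close>.
\<close>

lemma boundary_product_le:
  assumes vm: "\<And>x y. x \<in> Ico0 b \<Longrightarrow> y \<in> Ico0 b \<Longrightarrow> x \<le> y \<Longrightarrow> cmod (v1 x) \<le> cmod (v1 y)"
    and w: "integral_pair b R1 R2 w1 w2 (\<lambda>t. \<i> * w1 t)" "integrable \<mu>2 w1"
    and w0: "w2 0 - \<i> * (\<integral>t. w1 t \<partial>\<mu>2) = 0"
    and vw: "integrable \<mu>2 (\<lambda>t. cmod (v1 t) * cmod (w1 t))" and x: "x \<in> Ico0 b"
  shows "cmod (v1 x * w2 x) \<le> (\<integral>t. indicator {x..} t * (cmod (v1 t) * cmod (w1 t)) \<partial>\<mu>2)"
proof -
  have "w2 x = \<i> * ((\<integral>t. w1 t \<partial>\<mu>2) - cum \<mu>2 w1 x)"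
    using integral_pairD(4)[OF w(1) x] w0 by (simp add: S2.cum_scale algebra_simps)
  then have "cmod (v1 x * w2 x) \<le> cmod (v1 x) * (\<integral>t. indicator {x..} t * cmod (w1 t) \<partial>\<mu>2)"
    using S2.tail_norm_le[OF w(2) x] by (simp add: norm_mult mult_left_mono)
  also have "\<dots> = (\<integral>t. cmod (v1 x) * (indicator {x..} t * cmod (w1 t)) \<partial>\<mu>2)" by simp
  also have "\<dots> \<le> (\<integral>t. indicator {x..} t * (cmod (v1 t) * cmod (w1 t)) \<partial>\<mu>2)"
  proof (rule integral_mono)
    have [measurable]: "indicat_real {x..} \<in> borel_measurable \<mu>2"
      by (rule S2.borel_measurable_M) simp
    have [measurable]: "(\<lambda>t. cmod (v1 t) * cmod (w1 t)) \<in> borel_measurable \<mu>2" "w1 \<in> borel_measurable \<mu>2"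
      using vw w(2) by auto
    show "integrable \<mu>2 (\<lambda>t. indicat_real {x..} t * (cmod (v1 t) * cmod (w1 t)))"
      by (rule Bochner_Integration.integrable_bound[OF vw]) (auto simp: indicator_def)
    show "integrable \<mu>2 (\<lambda>t. cmod (v1 x) * (indicat_real {x..} t * cmod (w1 t)))"
      by (intro integrable_mult_right Bochner_Integration.integrable_bound[OF integrable_norm[OF w(2)]])
        (auto simp: indicator_def)
  qed (use vm x in \<open>auto simp: indicator_def intro!: mult_right_mono\<close>)
  finally show ?thesis .
qed

lemma R1_L2_if_limit_nonzero:
  assumes u: "integral_pair b R1 R2 u1 u2 f" "u1 \<in> L2_fun \<mu>2" "(u2 \<longlongrightarrow> L) (at_end b)" "L \<noteq> 0"
    and one: "(\<lambda>x. 1) \<in> L2_fun \<mu>2"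
  shows "(\<lambda>x. complex_of_real (R1 x)) \<in> L2_fun \<mu>2"
proof -
  have "eventually (\<lambda>x. dist (u2 x) L < cmod L / 2) (at_end b)"
    using u(3,4) by (intro tendstoD) auto
  then obtain x0 where x0: "x0 \<in> Ico0 b" "\<And>t. t \<in> Ico0 b \<Longrightarrow> x0 \<le> t \<Longrightarrow> dist (u2 t) L < cmod L / 2"
    unfolding eventually_at_end[OF b_pos] by blast
  define K where "K = cmod (u1 x0) + cmod L * R1 x0"
  \<comment> \<open>beyond \<open>x0\<close> the increment of \<open>u\<^sub>1\<close> differs from that of \<open>L R\<^sub>1\<close> by at most half of \<open>\<bar>L\<bar> R\<^sub>1(x)\<close>\<close>
  have bd: "cmod L / 2 * R1 x \<le> cmod (u1 x) + K" if x: "x \<in> Ico0 b" for x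
  proof (cases "x0 \<le> x")
    case True
    have "cmod (u1 x - u1 x0 - L * (R1 x - R1 x0)) \<le> cmod L / 2 * R1 x"
      by (rule asymptotics[OF u(1) x0(1) x True]) (use x0(2) in \<open>auto simp: dist_norm less_imp_le\<close>)
    moreover have "L * R1 x = u1 x - ((u1 x - u1 x0 - L * (R1 x - R1 x0)) + (u1 x0 - L * R1 x0))"
      by (simp add: algebra_simps)
    then have "cmod (L * R1 x) \<le> cmod (u1 x) + cmod ((u1 x - u1 x0 - L * (R1 x - R1 x0)) + (u1 x0 - L * R1 x0))"
      by (simp only: norm_triangle_ineq4)
    moreover have "cmod ((u1 x - u1 x0 - L * (R1 x - R1 x0)) + (u1 x0 - L * R1 x0))
      \<le> cmod (u1 x - u1 x0 - L * (R1 x - R1 x0)) + cmod (u1 x0 - L * R1 x0)"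
      by (rule norm_triangle_ineq)
    moreover have "cmod (u1 x0 - L * R1 x0) \<le> cmod (u1 x0) + cmod (L * R1 x0)"
      by (rule norm_triangle_ineq4)
    ultimately show ?thesis using S1.nonneg[OF x] S1.nonneg[OF x0(1)] by (simp add: K_def norm_mult)
  next
    case False
    then have "R1 x \<le> R1 x0" using S1.mono[OF x x0(1)] by simp
    then have "cmod L / 2 * R1 x \<le> cmod L / 2 * R1 x0" by (intro mult_left_mono) auto
    also have "\<dots> \<le> K" unfolding K_def using S1.nonneg[OF x0(1)] by (simp add: field_simps)
    finally show ?thesis by (simp add: add_increasing)
  qed
  have "(\<lambda>x. complex_of_real (cmod L / 2) * complex_of_real (R1 x)) \<in> L2_fun \<mu>2"
  proof (rule L2_fun_bound)
    show "(\<lambda>x. complex_of_real (cmod (u1 x)) + complex_of_real K * 1) \<in> L2_fun \<mu>2"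
      using u(2) by (intro L2_fun_add L2_fun_scale one) (auto simp: L2_fun_def)
    fix x assume "x \<in> space \<mu>2"
    then have x: "x \<in> Ico0 b" by simp
    have "cmod (complex_of_real (cmod L / 2) * complex_of_real (R1 x)) = cmod L / 2 * R1 x"
      using S1.nonneg[OF x] by (simp add: norm_mult)
    also have "\<dots> \<le> Re (complex_of_real (cmod (u1 x)) + complex_of_real K * 1)" using bd[OF x] by simp
    also have "\<dots> \<le> cmod (complex_of_real (cmod (u1 x)) + complex_of_real K * 1)" by (rule complex_Re_le_cmod)
    finally show "cmod (complex_of_real (cmod L / 2) * complex_of_real (R1 x))
      \<le> cmod (complex_of_real (cmod (u1 x)) + complex_of_real K * 1)" .
  qed measurable
  from L2_fun_scale[OF this, of "complex_of_real (2 / cmod L)"] u(4)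
  show ?thesis by (simp add: mult.assoc[symmetric])
qed

text \<open>
  If both fundamental solutions for \<open>\<i>\<close> are square-integrable, then so are both for \<open>0\<close>. First
  \<open>\<bar>c\<^sub>1\<bar> \<ge> 1\<close>, so \<open>dR\<^sub>2\<close> is finite and the second components have limits. The limits cannot both
  vanish, because the Wronskian \<open>c\<^sub>1 s\<^sub>2 - s\<^sub>1 c\<^sub>2\<close> would then be at most twice the tail of the integral
  of \<open>\<bar>c\<^sub>1 s\<^sub>1\<bar>\<close>. A first component whose second component has a nonzero limit grows like \<open>R\<^sub>1\<close>.
\<close>

lemma limit_circle_imp:
  assumes c: "integral_pair b R1 R2 c1 c2 (\<lambda>t. \<i> * c1 t)" "c1 0 = 1" "c2 0 = 0" "c1 \<in> L2_fun \<mu>2"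
    and s: "integral_pair b R1 R2 s1 s2 (\<lambda>t. \<i> * s1 t)" "s1 0 = 0" "s2 0 = 1" "s1 \<in> L2_fun \<mu>2"
  shows "limit_circle_system b R1 R2"
proof -
  have cm: "x \<in> Ico0 b \<Longrightarrow> y \<in> Ico0 b \<Longrightarrow> x \<le> y \<Longrightarrow> cmod (c1 x) \<le> cmod (c1 y)" for x y
    by (rule norm_nondecreasing_imaginary[OF c(1)]) (simp_all add: c)
  have sm: "x \<in> Ico0 b \<Longrightarrow> y \<in> Ico0 b \<Longrightarrow> x \<le> y \<Longrightarrow> cmod (s1 x) \<le> cmod (s1 y)" for x y
    by (rule norm_nondecreasing_imaginary[OF s(1)]) (simp_all add: s)
  have one: "(\<lambda>x. 1) \<in> L2_fun \<mu>2"
  proof (rule L2_fun_bound[OF c(4)])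
    show "cmod 1 \<le> cmod (c1 x)" if "x \<in> space \<mu>2" for x
      using cm[OF Ico0_zero[OF b_pos], of x] c(2) that by (simp add: Ico0_nonneg)
  qed simp
  have int: "integrable \<mu>2 u" if "u \<in> L2_fun \<mu>2" for u
    using L2_fun_mult_integrable[OF that one] by simp
  have lim: "(u2 \<longlongrightarrow> u2 0 - \<i> * (\<integral>t. u1 t \<partial>\<mu>2)) (at_end b)"
    if u: "integral_pair b R1 R2 u1 u2 (\<lambda>t. \<i> * u1 t)" "u1 \<in> L2_fun \<mu>2" for u1 u2
  proof -
    have "((\<lambda>x. u2 0 - \<i> * cum \<mu>2 u1 x) \<longlongrightarrow> u2 0 - \<i> * (\<integral>t. u1 t \<partial>\<mu>2)) (at_end b)"
      by (intro tendsto_intros S2.cum_tendsto int u)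
    moreover have "eventually (\<lambda>x. u2 x = u2 0 - \<i> * cum \<mu>2 u1 x) (at_end b)"
      using eventually_at_end_Ico0[OF b_pos]
      by eventually_elim (use integral_pairD(4)[OF u(1)] in \<open>simp add: S2.cum_scale\<close>)
    ultimately show ?thesis by (simp add: tendsto_cong)
  qed
  obtain u1 u2 L where u: "integral_pair b R1 R2 u1 u2 (\<lambda>t. \<i> * u1 t)" "u1 \<in> L2_fun \<mu>2"
      "(u2 \<longlongrightarrow> L) (at_end b)" "L \<noteq> 0"
  proof (cases "s2 0 - \<i> * (\<integral>t. s1 t \<partial>\<mu>2) = 0 \<and> c2 0 - \<i> * (\<integral>t. c1 t \<partial>\<mu>2) = 0")
    case False
    then show ?thesis using that lim[OF c(1,4)] lim[OF s(1,4)] c s by blast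
  next
    case True
    let ?T = "\<lambda>x. \<integral>t. indicator {x..} t * (cmod (c1 t) * cmod (s1 t)) \<partial>\<mu>2"
    have cs: "integrable \<mu>2 (\<lambda>t. cmod (c1 t) * cmod (s1 t))"
      using integrable_norm[OF L2_fun_mult_integrable[OF c(4) s(4)]] by (simp add: norm_mult)
    have sc: "integrable \<mu>2 (\<lambda>t. cmod (s1 t) * cmod (c1 t))" using cs by (simp add: mult.commute)
    have "1 \<le> ?T x + ?T x" if x: "x \<in> Ico0 b" for x
    proof -
      have "c1 x * s2 x - s1 x * c2 x = 1"
        using wronskian[OF c(1) s(1) x] by (simp add: c s)
      then have "1 = cmod (c1 x * s2 x - s1 x * c2 x)" by simp
      also have "\<dots> \<le> cmod (c1 x * s2 x) + cmod (s1 x * c2 x)" by (rule norm_triangle_ineq4)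
      also have "cmod (c1 x * s2 x) \<le> ?T x" 
        by (rule boundary_product_le[OF cm s(1) int[OF s(4)] _ cs x]) (use True in auto)
      also have "cmod (s1 x * c2 x) \<le> ?T x"
        using boundary_product_le[OF sm c(1) int[OF c(4)] _ sc x] True by (simp add: mult.commute)
      finally show ?thesis by simp
    qed
    then have "eventually (\<lambda>x. 1 \<le> ?T x + ?T x) (at_end b)"
      using eventually_at_end_Ico0[OF b_pos] by (auto elim: eventually_mono)
    moreover have "((\<lambda>x. ?T x + ?T x) \<longlongrightarrow> 0 + 0) (at_end b)"
      by (intro tendsto_add S2.tail_tendsto cs) auto
    ultimately have "1 \<le> (0 + 0 :: real)"
      by (intro tendsto_lowerbound[OF _ _ at_end_neq_bot[OF b_pos]])
    then show ?thesis by simp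
  qed
  have "(\<lambda>x. complex_of_real (R1 x)) \<in> L2_fun \<mu>2" by (rule R1_L2_if_limit_nonzero[OF u one])
  with one show ?thesis by unfold_locales
qed

end

section \<open>Solutions and their behaviour at the right end\<close>

lemma entire_of_sums:
  fixes a :: "nat \<Rightarrow> complex"
  assumes "\<And>z. (\<lambda>n. a n * (- z) ^ n) sums F z"
  shows "F holomorphic_on A"
proof -
  have s: "(\<lambda>n. a n * z ^ n) sums F (- z)" for z using assms[of "- z"] by simp
  then have "summable (\<lambda>n. a n * z ^ n)" for z by (rule sums_summable)
  then have "((\<lambda>z. \<Sum>n. a n * z ^ n) has_field_derivative (\<Sum>n. diffs a n * z ^ n)) (at z)" for z
    by (rule termdiffs_strong_converges_everywhere)
  then have "(\<lambda>z. \<Sum>n. a n * z ^ n) holomorphic_on UNIV"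
    by (auto simp: holomorphic_on_open)
  moreover have "(\<lambda>z. \<Sum>n. a n * z ^ n) = (\<lambda>z. F (- z))"
    using s by (auto simp: sums_iff)
  ultimately have "(\<lambda>z. F (- z)) holomorphic_on UNIV" by simp
  then have "(\<lambda>z. F (- z)) \<circ> uminus holomorphic_on A"
    by (intro holomorphic_on_compose) (auto intro!: holomorphic_intros intro: holomorphic_on_subset)
  then show ?thesis by (simp add: o_def)
qed

context volterra_series
begin

lemma solution_integral_pair:
  fixes p1 p2 :: complex
  assumes g: "g \<in> L2_fun \<mu>2" and h: "\<And>x. x \<in> Ico0 b \<Longrightarrow> h x = p1 + p2 * R1 x - volterra g x"
  shows "integral_pair b R1 R2 (solution z) (\<lambda>x. p2 - cum \<mu>2 (\<lambda>t. z * solution z t + g t) x)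
    (\<lambda>t. z * solution z t + g t)" and "solution z 0 = p1"
proof -
  let ?U = "solution z" and ?f = "\<lambda>t. z * solution z t + g t"
  have 0: "0 \<in> Ico0 b" by (rule Ico0_zero[OF b_pos])
  show U0: "?U 0 = p1"
    using solution_fixed_point[OF 0, of z] h[OF 0] by (simp add: volterra_def S1.zero)
  have fL: "?f \<in> L2_fun \<mu>2" by (intro L2_fun_add L2_fun_scale solution_L2 g)
  note loc = S2.integrable_locally[OF L2_integrable]
  note fl = loc[OF fL] and gl = loc[OF g] and Ul = loc[OF L2_fun_scale[OF solution_L2, of z]]
  have cumb: "locally_integrable b \<mu>1 (cum \<mu>2 k)" if k: "k \<in> L2_fun \<mu>2" for k
    using S2.cum_locally_bounded[OF loc[OF k], of _ 0]
    by (intro S1.locally_integrable_bounded S2.cum_measurable L2_fun_measurable k S1.ico_measure_axioms) simp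
  have cf: "cum \<mu>2 ?f t = z * cum \<mu>2 ?U t + cum \<mu>2 g t" if "t \<in> Ico0 b" for t
    by (simp add: S2.cum_add[OF Ul gl that] S2.cum_scale)
  show "integral_pair b R1 R2 ?U (\<lambda>x. p2 - cum \<mu>2 ?f x) ?f"
    unfolding integral_pair_iff
  proof (intro conjI ballI fl)
    show "locally_integrable b \<mu>1 (\<lambda>x. p2 - cum \<mu>2 ?f x)"
      by (intro S1.locally_integrable_diff S1.locally_integrable_const cumb fL)
    fix x assume x: "x \<in> Ico0 b"
    have "cum \<mu>1 (\<lambda>x. p2 - cum \<mu>2 ?f x) x = p2 * R1 x - cum \<mu>1 (cum \<mu>2 ?f) x"
      by (simp add: S1.cum_diff[OF S1.locally_integrable_const cumb[OF fL] x] S1.cum_const x)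
    also have "cum \<mu>1 (cum \<mu>2 ?f) x = cum \<mu>1 (\<lambda>t. z * cum \<mu>2 ?U t + cum \<mu>2 g t) x"
      by (rule S1.cum_cong[OF x cf])
    also have "\<dots> = z * volterra ?U x + volterra g x"
      unfolding volterra_def
      by (simp only: S1.cum_add[OF S1.locally_integrable_scale[OF cumb[OF solution_L2]] cumb[OF g] x] S1.cum_scale)
    finally show "?U x = ?U 0 + cum \<mu>1 (\<lambda>x. p2 - cum \<mu>2 ?f x) x"
      unfolding U0 solution_fixed_point[OF x, of z] h[OF x] by simp
  qed simp
qed

end

context limit_circle_system
begin

lemma volterra_le:
  assumes g: "g \<in> L2_fun \<mu>2" and x: "x \<in> Ico0 b"
  shows "cmod (volterra g x) \<le> (\<integral>t. cmod (g t) \<partial>\<mu>2) * R1 x"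
  unfolding volterra_def
  by (rule S1.cum_bounded[OF x S2.cum_measurable])
    (auto intro!: cum2_le L2_integrable L2_fun_measurable g S1.ico_measure_axioms)

lemma solution_exists:
  assumes g: "g \<in> L2_fun \<mu>2"
  shows "\<exists>u1 u2. integral_pair b R1 R2 u1 u2 (\<lambda>t. z * u1 t + g t) \<and> u1 \<in> L2_fun \<mu>2 \<and> u1 0 = p1 \<and> u2 0 = p2"
proof -
  let ?h = "\<lambda>x. p1 + p2 * R1 x - volterra g x"
  let ?C = "cmod p1 + cmod p2 + (\<integral>t. cmod (g t) \<partial>\<mu>2)"
  interpret V: volterra_series b R1 R2 ?h ?C
  proof
    have [measurable]: "volterra g \<in> borel_measurable \<mu>2" by (intro volterra_measurable L2_fun_measurable g)
    show "?h \<in> borel_measurable \<mu>2" by measurable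
    show "0 \<le> ?C" by (intro add_nonneg_nonneg) auto
    fix x assume x: "x \<in> Ico0 b"
    have "cmod (?h x) \<le> cmod p1 + cmod (p2 * R1 x) + cmod (volterra g x)"
      using norm_triangle_ineq4[of "p1 + p2 * R1 x" "volterra g x"] norm_triangle_ineq[of p1 "p2 * R1 x"] by linarith
    also have "\<dots> \<le> cmod p1 + cmod p2 * R1 x + (\<integral>t. cmod (g t) \<partial>\<mu>2) * R1 x"
      using volterra_le[OF g x] S1.nonneg[OF x] by (simp add: norm_mult)
    also have "\<dots> \<le> ?C * (1 + R1 x)"
      using S1.nonneg[OF x] by (simp add: algebra_simps add_increasing)
    finally show "cmod (?h x) \<le> ?C * (1 + R1 x)" .
  qed
  show ?thesis
    using V.solution_integral_pair[OF g, of p1 p2 z] V.solution_L2[of z] by (intro exI[of _ "V.solution z"] exI conjI) (assumption | simp)+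
qed

lemma homogeneous_exists:
  "\<exists>u1 u2. integral_pair b R1 R2 u1 u2 (\<lambda>t. z * u1 t) \<and> u1 0 = p1 \<and> u2 0 = p2"
  using solution_exists[OF zero_L2_fun, of z p1 p2] by auto

lemma system_solution:
  "integral_pair b R1 R2 (fst (system_solution b R1 R2 p1 p2 z)) (snd (system_solution b R1 R2 p1 p2 z))
     (\<lambda>t. z * fst (system_solution b R1 R2 p1 p2 z) t)"
  "fst (system_solution b R1 R2 p1 p2 z) 0 = p1" "snd (system_solution b R1 R2 p1 p2 z) 0 = p2"
proof -
  let ?P = "\<lambda>u. solves_system b R1 R2 z (fst u) (snd u) \<and> fst u 0 = p1 \<and> snd u 0 = p2"
  obtain u1 u2 where "integral_pair b R1 R2 u1 u2 (\<lambda>t. z * u1 t)" "u1 0 = p1" "u2 0 = p2"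
    using homogeneous_exists by blast
  then have P: "?P (u1, u2)" by (simp add: solves_system_iff)
  have eq: "system_solution b R1 R2 p1 p2 z = (SOME u. ?P u)"
    unfolding system_solution_def by (simp add: case_prod_unfold)
  have "?P (system_solution b R1 R2 p1 p2 z)" unfolding eq using P by (rule someI[where P = ?P])
  then show "integral_pair b R1 R2 (fst (system_solution b R1 R2 p1 p2 z)) (snd (system_solution b R1 R2 p1 p2 z))
     (\<lambda>t. z * fst (system_solution b R1 R2 p1 p2 z) t)"
    "fst (system_solution b R1 R2 p1 p2 z) 0 = p1" "snd (system_solution b R1 R2 p1 p2 z) 0 = p2"
    by (simp_all add: solves_system_iff)
qed

lemma volterra_series_affine:
  fixes p1 p2 :: complex
  shows "volterra_series b R1 R2 (\<lambda>x. p1 + p2 * R1 x) (cmod p1 + cmod p2)"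
proof
  fix x assume x: "x \<in> Ico0 b"
  have "cmod (p1 + p2 * R1 x) \<le> cmod p1 + cmod p2 * R1 x"
    using norm_triangle_ineq[of p1 "p2 * R1 x"] S1.nonneg[OF x] by (simp add: norm_mult)
  also have "\<dots> \<le> (cmod p1 + cmod p2) * (1 + R1 x)" using S1.nonneg[OF x] by (simp add: algebra_simps)
  finally show "cmod (p1 + p2 * R1 x) \<le> (cmod p1 + cmod p2) * (1 + R1 x)" .
qed auto

lemma homogeneous_eq_series:
  assumes u: "integral_pair b R1 R2 u1 u2 (\<lambda>t. z * u1 t)" and x: "x \<in> Ico0 b"
  shows "u1 x = volterra_series.solution b R1 R2 (\<lambda>x. u1 0 + u2 0 * R1 x) z x"
proof -
  interpret V: volterra_series b R1 R2 "\<lambda>x. u1 0 + u2 0 * R1 x" "cmod (u1 0) + cmod (u2 0)"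
    by (rule volterra_series_affine)
  have "volterra (\<lambda>t. 0) x = 0" for x by (simp add: volterra_def cum_def)
  then have h: "u1 0 + u2 0 * R1 x = u1 0 + u2 0 * R1 x - volterra (\<lambda>t. 0) x" for x by simp
  have u': "integral_pair b R1 R2 u1 u2 (\<lambda>t. z * u1 t + 0)" using u by simp
  note s = V.solution_integral_pair[OF zero_L2_fun h, of z]
  show ?thesis
    by (rule solution_unique(1)[OF u' s(1) _ _ x]) (simp_all add: s(2))
qed

lemma homogeneous_L2:
  assumes u: "integral_pair b R1 R2 u1 u2 (\<lambda>t. z * u1 t)"
  shows "u1 \<in> L2_fun \<mu>2"
proof -
  interpret V: volterra_series b R1 R2 "\<lambda>x. u1 0 + u2 0 * R1 x" "cmod (u1 0) + cmod (u2 0)"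
    by (rule volterra_series_affine)
  show ?thesis
    by (rule dominated_L2[OF integral_pair_measurable(2)[OF u]])
      (simp only: homogeneous_eq_series[OF u], rule V.solution_le)
qed

lemma integral_homogeneous_holomorphic:
  assumes u: "\<And>z. integral_pair b R1 R2 (u1 z) (u2 z) (\<lambda>t. z * u1 z t)"
    and 0: "\<And>z. u1 z 0 = p1" "\<And>z. u2 z 0 = p2"
  shows "(\<lambda>z. \<integral>t. u1 z t \<partial>\<mu>2) holomorphic_on A"
proof -
  interpret V: volterra_series b R1 R2 "\<lambda>x. p1 + p2 * R1 x" "cmod p1 + cmod p2"
    by (rule volterra_series_affine)
  have "(\<integral>t. u1 z t \<partial>\<mu>2) = (\<integral>t. V.solution z t \<partial>\<mu>2)" for z
    using homogeneous_eq_series[OF u[of z]] unfolding 0 by (intro Bochner_Integration.integral_cong) auto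
  then show ?thesis using V.integral_solution by (intro entire_of_sums) simp
qed

subsection \<open>Limits at the right end and Green's formula\<close>

lemma u2_tendsto:
  assumes u: "integral_pair b R1 R2 u1 u2 f" and f: "f \<in> L2_fun \<mu>2"
  shows "(u2 \<longlongrightarrow> u2 0 - (\<integral>t. f t \<partial>\<mu>2)) (at_end b)"
proof -
  have "((\<lambda>x. u2 0 - cum \<mu>2 f x) \<longlongrightarrow> u2 0 - (\<integral>t. f t \<partial>\<mu>2)) (at_end b)"
    by (intro tendsto_intros S2.cum_tendsto L2_integrable f)
  moreover have "eventually (\<lambda>x. u2 x = u2 0 - cum \<mu>2 f x) (at_end b)"
    using eventually_at_end_Ico0[OF b_pos] by eventually_elim (rule integral_pairD(4)[OF u])
  ultimately show ?thesis by (simp add: tendsto_cong)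
qed

lemma u2_tendsto_0_iff:
  assumes u: "integral_pair b R1 R2 u1 u2 f" and f: "f \<in> L2_fun \<mu>2"
  shows "(u2 \<longlongrightarrow> 0) (at_end b) \<longleftrightarrow> u2 0 = (\<integral>t. f t \<partial>\<mu>2)"
  using u2_tendsto[OF assms] tendsto_unique[OF at_end_neq_bot[OF b_pos] u2_tendsto[OF assms], of 0] by auto

text \<open>
  If \<open>v\<^sub>2(b) = 0\<close> then \<open>v\<^sub>2(x)\<close> is an integral over \<open>[x,b)\<close>, and there \<open>1 + R\<^sub>1\<close> is at least its
  value at \<open>x\<close>, which bounds the growth of \<open>u\<^sub>1\<close>.
\<close>

lemma boundary_term:
  assumes u: "integral_pair b R1 R2 u1 u2 f" and f: "f \<in> L2_fun \<mu>2"
    and v: "integral_pair b R1 R2 v1 v2 g" and g: "g \<in> L2_fun \<mu>2" and lim: "(v2 \<longlongrightarrow> 0) (at_end b)"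
  shows "((\<lambda>x. u1 x * v2 x) \<longlongrightarrow> 0) (at_end b)"
proof -
  obtain C where C: "0 \<le> C" "\<And>x. x \<in> Ico0 b \<Longrightarrow> cmod (u1 x) \<le> C * (1 + R1 x)"
    using growth[OF u L2_integrable[OF f]] by blast
  have w: "integrable \<mu>2 (\<lambda>x. (1 + complex_of_real (R1 x)) * g x)"
    by (intro L2_fun_mult_integrable L2_fun_add one_L2 R1_L2 g)
  define k where "k t = \<bar>1 + R1 t\<bar> * cmod (g t)" for t
  have k: "integrable \<mu>2 k"
  proof -
    have "cmod (1 + complex_of_real (R1 t)) = \<bar>1 + R1 t\<bar>" for t
      by (metis norm_of_real of_real_1 of_real_add)
    then show ?thesis using integrable_norm[OF w] by (simp add: norm_mult k_def[abs_def])
  qed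
  have "((\<lambda>x. C * (\<integral>t. indicator {x..} t * k t \<partial>\<mu>2)) \<longlongrightarrow> C * 0) (at_end b)"
    by (intro tendsto_intros S2.tail_tendsto k) (simp add: k_def)
  then have lim0: "((\<lambda>x. C * (\<integral>t. indicator {x..} t * k t \<partial>\<mu>2)) \<longlongrightarrow> 0) (at_end b)" by simp
  show ?thesis
  proof (rule Lim_null_comparison[OF _ lim0])
    show "eventually (\<lambda>x. norm (u1 x * v2 x) \<le> C * (\<integral>t. indicator {x..} t * k t \<partial>\<mu>2)) (at_end b)"
      using eventually_at_end_Ico0[OF b_pos]
    proof eventually_elim
      case (elim x)
      have [measurable]: "indicat_real {x..} \<in> borel_measurable \<mu>2"
        by (rule S2.borel_measurable_M) simp
      have [measurable]: "k \<in> borel_measurable \<mu>2" "g \<in> borel_measurable \<mu>2"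
        using k L2_fun_measurable[OF g] by auto
      have "v2 x = (\<integral>t. g t \<partial>\<mu>2) - cum \<mu>2 g x"
        using integral_pairD(4)[OF v elim] u2_tendsto_0_iff[OF v g] lim by simp
      then have "cmod (v2 x) \<le> (\<integral>t. indicator {x..} t * cmod (g t) \<partial>\<mu>2)"
        using S2.tail_norm_le[OF L2_integrable[OF g] elim] by simp
      then have "cmod (u1 x * v2 x) \<le> (C * (1 + R1 x)) * (\<integral>t. indicator {x..} t * cmod (g t) \<partial>\<mu>2)"
        unfolding norm_mult using C S1.nonneg[OF elim] elim by (intro mult_mono) auto
      also have "\<dots> = C * (\<integral>t. (1 + R1 x) * (indicator {x..} t * cmod (g t)) \<partial>\<mu>2)" by simp
      also have "\<dots> \<le> C * (\<integral>t. indicator {x..} t * k t \<partial>\<mu>2)"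
      proof (intro mult_left_mono integral_mono C)
        show "integrable \<mu>2 (\<lambda>t. indicat_real {x..} t * k t)"
          by (rule Bochner_Integration.integrable_bound[OF k]) (auto simp: indicator_def)
        show "integrable \<mu>2 (\<lambda>t. (1 + R1 x) * (indicat_real {x..} t * cmod (g t)))"
          by (intro integrable_mult_right Bochner_Integration.integrable_bound[OF integrable_norm[OF L2_integrable[OF g]]])
            (auto simp: indicator_def)
        fix t assume "t \<in> space \<mu>2"
        then show "(1 + R1 x) * (indicat_real {x..} t * cmod (g t)) \<le> indicat_real {x..} t * k t"
          using S1.mono[OF elim, of t] by (auto simp: indicator_def k_def intro!: mult_right_mono)
      qed
      finally show ?case by simp
    qed
  qed
qed

text \<open>
  If \<open>v\<^sub>2(b) = 0\<close>, integration by parts gives the limit of the mixed energy \<open>\<integral>u\<^sub>2 v\<^sub>2 dR\<^sub>1\<close> at \<open>b\<close>.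
  If \<open>u\<^sub>2(b) = 0\<close> as well, this works in two ways, and their comparison is Green's formula.
\<close>

lemma energy_tendsto:
  assumes u: "integral_pair b R1 R2 u1 u2 f" and f: "f \<in> L2_fun \<mu>2"
    and v: "integral_pair b R1 R2 v1 v2 g" and g: "g \<in> L2_fun \<mu>2" and lim: "(v2 \<longlongrightarrow> 0) (at_end b)"
  shows "(cum \<mu>1 (\<lambda>t. u2 t * v2 t) \<longlongrightarrow> (\<integral>t. u1 t * g t \<partial>\<mu>2) - u1 0 * v2 0) (at_end b)"
proof -
  have "((\<lambda>x. u1 x * v2 x - u1 0 * v2 0 + cum \<mu>2 (\<lambda>t. u1 t * g t) x) \<longlongrightarrow> 0 - u1 0 * v2 0 + (\<integral>t. u1 t * g t \<partial>\<mu>2)) (at_end b)"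
    by (intro tendsto_intros boundary_term[OF assms] S2.cum_tendsto L2_fun_mult_integrable g integral_pair_L2[OF u] L2_integrable f)
  moreover have "eventually (\<lambda>x. u1 x * v2 x - u1 0 * v2 0 + cum \<mu>2 (\<lambda>t. u1 t * g t) x = cum \<mu>1 (\<lambda>t. u2 t * v2 t) x) (at_end b)"
    using eventually_at_end_Ico0[OF b_pos] by eventually_elim (simp add: integral_pair_product[OF u v])
  ultimately show ?thesis by (simp add: tendsto_cong)
qed

lemma green:
  assumes u: "integral_pair b R1 R2 u1 u2 f" and f: "f \<in> L2_fun \<mu>2" and u2: "(u2 \<longlongrightarrow> 0) (at_end b)"
    and v: "integral_pair b R1 R2 v1 v2 g" and g: "g \<in> L2_fun \<mu>2" and v2: "(v2 \<longlongrightarrow> 0) (at_end b)"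
  shows "(\<integral>t. f t * v1 t \<partial>\<mu>2) - (\<integral>t. u1 t * g t \<partial>\<mu>2) = v1 0 * u2 0 - u1 0 * v2 0"
proof -
  have "(cum \<mu>1 (\<lambda>t. u2 t * v2 t) \<longlongrightarrow> (\<integral>t. v1 t * f t \<partial>\<mu>2) - v1 0 * u2 0) (at_end b)"
    using energy_tendsto[OF v g u f u2] by (simp add: mult.commute)
  with energy_tendsto[OF u f v g v2] have "(\<integral>t. u1 t * g t \<partial>\<mu>2) - u1 0 * v2 0 = (\<integral>t. v1 t * f t \<partial>\<mu>2) - v1 0 * u2 0"
    by (rule tendsto_unique[OF at_end_neq_bot[OF b_pos]])
  then show ?thesis by (simp add: mult.commute algebra_simps)
qed

text \<open>
  The integral of \<open>\<bar>w\<bar>\<^sup>2\<close> over all of \<open>[0,b)\<close>, taken as a limit at \<open>b\<close>, where its existence follows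
  from the convergence of the mixed energy.
\<close>

definition dirichlet :: "(real \<Rightarrow> complex) \<Rightarrow> real" where
  "dirichlet w = Lim (at_end b) (\<lambda>x. LINT t:{0..<x}|\<mu>1. (cmod (w t))\<^sup>2)"

lemma dirichlet_integrable:
  assumes u: "integral_pair b R1 R2 u1 u2 f" and x: "x \<in> Ico0 b"
  shows "integrable \<mu>1 (\<lambda>t. indicator {0..<x} t *\<^sub>R (cmod (u2 t))\<^sup>2)"
proof -
  have "locally_integrable b \<mu>1 (\<lambda>t. u2 t * cnj (u2 t))"
    by (rule S1.locally_integrable_mult_bounded[OF integral_pairD(1)[OF u]])
      (use integral_pair_locally_bounded(2)[OF u] integral_pair_measurable(3)[OF integral_pair_cnj[OF u]] in auto)
  then have "integrable \<mu>1 (\<lambda>t. Re (indicator {0..<x} t *\<^sub>R (u2 t * cnj (u2 t))))"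
    using x unfolding locally_integrable_def set_integrable_def by (intro integrable_Re) auto
  moreover have "Re (w * cnj w) = (cmod w)\<^sup>2" for w
    unfolding complex_norm_square[symmetric] by simp
  ultimately show ?thesis by simp
qed

lemma dirichlet:
  assumes u: "integral_pair b R1 R2 u1 u2 f" and f: "f \<in> L2_fun \<mu>2" and lim: "(u2 \<longlongrightarrow> 0) (at_end b)"
  shows "complex_of_real (dirichlet u2) = (\<integral>t. u1 t * cnj (f t) \<partial>\<mu>2) - u1 0 * cnj (u2 0)"
    and "x \<in> Ico0 b \<Longrightarrow> (LINT t:{0..<x}|\<mu>1. (cmod (u2 t))\<^sup>2) \<le> dirichlet u2"
    and "0 \<le> dirichlet u2"
    and "((\<lambda>x. LINT t:{0..<x}|\<mu>1. (cmod (u2 t))\<^sup>2) \<longlongrightarrow> dirichlet u2) (at_end b)"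
proof -
  let ?D = "\<lambda>x. LINT t:{0..<x}|\<mu>1. (cmod (u2 t))\<^sup>2"
  let ?L = "(\<integral>t. u1 t * cnj (f t) \<partial>\<mu>2) - u1 0 * cnj (u2 0)"
  have "((\<lambda>x. cnj (u2 x)) \<longlongrightarrow> 0) (at_end b)" using tendsto_cnj[OF lim] by simp
  then have "(cum \<mu>1 (\<lambda>t. u2 t * cnj (u2 t)) \<longlongrightarrow> ?L) (at_end b)"
    by (rule energy_tendsto[OF u f integral_pair_cnj[OF u] L2_fun_cnj[OF f]])
  moreover have "cum \<mu>1 (\<lambda>t. u2 t * cnj (u2 t)) = (\<lambda>x. complex_of_real (?D x))"
    unfolding cum_def[abs_def] complex_norm_square[symmetric] by (intro ext set_integral_complex_of_real)
  ultimately have L: "((\<lambda>x. complex_of_real (?D x)) \<longlongrightarrow> ?L) (at_end b)"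
    by simp
  have nt: "at_end b \<noteq> bot" by (rule at_end_neq_bot[OF b_pos])
  have R: "(?D \<longlongrightarrow> Re ?L) (at_end b)" using tendsto_Re[OF L] by simp
  have "dirichlet u2 = Re ?L" unfolding dirichlet_def by (rule tendsto_Lim[OF nt R])
  moreover have "?L = complex_of_real (Re ?L)"
    using tendsto_unique[OF nt L tendsto_of_real[OF R]] .
  ultimately show "complex_of_real (dirichlet u2) = ?L" by simp
  show lim': "(?D \<longlongrightarrow> dirichlet u2) (at_end b)" using R \<open>dirichlet u2 = Re ?L\<close> by simp

  have mono: "?D x \<le> ?D y" if "x \<in> Ico0 b" "y \<in> Ico0 b" "x \<le> y" for x y
    unfolding set_lebesgue_integral_def
    using that by (intro integral_mono dirichlet_integrable[OF u]) (auto simp: indicator_def)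
  show le: "?D x \<le> dirichlet u2" if x: "x \<in> Ico0 b" for x
  proof (rule tendsto_lowerbound[OF lim' _ nt])
    show "eventually (\<lambda>y. ?D x \<le> ?D y) (at_end b)"
      using eventually_at_end_ge[OF b_pos x] eventually_at_end_Ico0[OF b_pos]
      by eventually_elim (rule mono[OF x])
  qed
  show "0 \<le> dirichlet u2"
    using le[OF Ico0_zero[OF b_pos]] by (simp add: set_lebesgue_integral_def)
qed

lemma Re_energy_le:
  assumes u: "integral_pair b R1 R2 u1 u2 f" "f \<in> L2_fun \<mu>2" "(u2 \<longlongrightarrow> 0) (at_end b)"
    and v: "integral_pair b R1 R2 v1 v2 g" "g \<in> L2_fun \<mu>2" "(v2 \<longlongrightarrow> 0) (at_end b)"
    and L: "(cum \<mu>1 (\<lambda>s. u2 s * v2 s) \<longlongrightarrow> L) (at_end b)"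
  shows "2 * Re L \<le> dirichlet u2 + dirichlet v2"
proof (rule tendsto_le[OF at_end_neq_bot[OF b_pos]])
  show "((\<lambda>x. 2 * Re (cum \<mu>1 (\<lambda>s. u2 s * v2 s) x)) \<longlongrightarrow> 2 * Re L) (at_end b)"
    by (intro tendsto_intros L)
  show "((\<lambda>x. (LINT t:{0..<x}|\<mu>1. (cmod (u2 t))\<^sup>2) + (LINT t:{0..<x}|\<mu>1. (cmod (v2 t))\<^sup>2))
     \<longlongrightarrow> dirichlet u2 + dirichlet v2) (at_end b)"
    by (intro tendsto_add dirichlet(4)[OF u] dirichlet(4)[OF v])
  show "eventually (\<lambda>x. 2 * Re (cum \<mu>1 (\<lambda>s. u2 s * v2 s) x) \<le>
     (LINT t:{0..<x}|\<mu>1. (cmod (u2 t))\<^sup>2) + (LINT t:{0..<x}|\<mu>1. (cmod (v2 t))\<^sup>2)) (at_end b)"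
    using eventually_at_end_Ico0[OF b_pos]
  proof eventually_elim
    case (elim x)
    note i1 = dirichlet_integrable[OF u(1) elim] and i2 = dirichlet_integrable[OF v(1) elim]
    have "locally_integrable b \<mu>1 (\<lambda>s. u2 s * v2 s)"
      by (rule S1.locally_integrable_mult_bounded[OF integral_pairD(1)[OF u(1)]])
        (use integral_pair_locally_bounded(2)[OF v(1)] integral_pair_measurable(3)[OF v(1)] in auto)
    then have "integrable \<mu>1 (\<lambda>s. indicator {0..<x} s *\<^sub>R (u2 s * v2 s))"
      using elim by (simp add: locally_integrable_def set_integrable_def)
    note i0 = this
    have i3: "integrable \<mu>1 (\<lambda>s. Re (indicator {0..<x} s *\<^sub>R (u2 s * v2 s)))"
      using i0 by (rule integrable_Re)
    have "Re (cum \<mu>1 (\<lambda>s. u2 s * v2 s) x) = (\<integral>s. Re (indicator {0..<x} s *\<^sub>R (u2 s * v2 s)) \<partial>\<mu>1)"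
      unfolding cum_def set_lebesgue_integral_def using i0 by (rule integral_Re[symmetric])
    then have "2 * Re (cum \<mu>1 (\<lambda>s. u2 s * v2 s) x) = (\<integral>s. 2 * Re (indicator {0..<x} s *\<^sub>R (u2 s * v2 s)) \<partial>\<mu>1)"
      by (simp only: integral_mult_right_zero)
    also have "\<dots> \<le> (\<integral>s. indicator {0..<x} s *\<^sub>R (cmod (u2 s))\<^sup>2 + indicator {0..<x} s *\<^sub>R (cmod (v2 s))\<^sup>2 \<partial>\<mu>1)"
    proof (rule integral_mono)
      fix s
      have "Re (u2 s * v2 s) \<le> cmod (u2 s) * cmod (v2 s)"
        by (metis complex_Re_le_cmod norm_mult)
      moreover have "2 * (cmod (u2 s) * cmod (v2 s)) \<le> (cmod (u2 s))\<^sup>2 + (cmod (v2 s))\<^sup>2"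
        using sum_squares_bound[of "cmod (u2 s)" "cmod (v2 s)"] by (simp add: mult.assoc)
      ultimately have "2 * Re (u2 s * v2 s) \<le> (cmod (u2 s))\<^sup>2 + (cmod (v2 s))\<^sup>2" by linarith
      then show "2 * Re (indicator {0..<x} s *\<^sub>R (u2 s * v2 s)) \<le> indicator {0..<x} s *\<^sub>R (cmod (u2 s))\<^sup>2 + indicator {0..<x} s *\<^sub>R (cmod (v2 s))\<^sup>2"
        by (cases "s \<in> {0..<x}") auto
    next
      show "integrable \<mu>1 (\<lambda>s. 2 * Re (indicator {0..<x} s *\<^sub>R (u2 s * v2 s)))"
        using i3 by (rule integrable_mult_right)
      show "integrable \<mu>1 (\<lambda>s. indicator {0..<x} s *\<^sub>R (cmod (u2 s))\<^sup>2 + indicator {0..<x} s *\<^sub>R (cmod (v2 s))\<^sup>2)"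
        by (rule Bochner_Integration.integrable_add[OF i1 i2])
    qed
    also have "\<dots> = (LINT t:{0..<x}|\<mu>1. (cmod (u2 t))\<^sup>2) + (LINT t:{0..<x}|\<mu>1. (cmod (v2 t))\<^sup>2)"
      unfolding set_lebesgue_integral_def by (rule Bochner_Integration.integral_add[OF i1 i2])
    finally show ?case .
  qed
qed

end

section \<open>The Neumann relation\<close>

lemma Carrier_L2: "X \<in> Carrier (L2 M) \<longleftrightarrow> (\<exists>f\<in>L2_fun M. X = L2_class M f)"
  by (auto simp: L2_def quotient_def L2_class_def)

lemma Zero_L2: "Zero (L2 M) = L2_class M (\<lambda>x. 0)"
  by (simp add: L2_def)

lemma L2_class_cong: "f \<in> L2_fun M \<Longrightarrow> g \<in> L2_fun M \<Longrightarrow> (\<And>x. x \<in> space M \<Longrightarrow> f x = g x) \<Longrightarrow> L2_class M f = L2_class M g"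
  by (subst L2_class_eq_iff) auto

lemma lincomb_single:
  assumes "f \<in> L2_fun M"
  shows "lincomb (L2 M) [a] [L2_class M f] = L2_class M (\<lambda>x. a * f x)"
  using L2_ops_class(1)[OF L2_fun_scale[OF assms] zero_L2_fun, of a]
  by (simp add: lincomb_def L2_ops_class(2)[OF assms assms] Zero_L2)

lemma lincomb_pair:
  assumes "f \<in> L2_fun M" "g \<in> L2_fun M"
  shows "lincomb (L2 M) [a, d] [L2_class M f, L2_class M g] = L2_class M (\<lambda>x. a * f x + d * g x)"
  using L2_ops_class(1)[OF L2_fun_scale[OF assms(1), of a] L2_fun_scale[OF assms(2), of d]]
    L2_ops_class(1)[OF L2_fun_scale[OF assms(2)] zero_L2_fun, of d]
  by (simp add: lincomb_def L2_ops_class(2)[OF assms] L2_ops_class(2)[OF assms(2) assms(2)] Zero_L2)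

context integral_system
begin

abbreviation "cls \<equiv> L2_class \<mu>2"
abbreviation "H \<equiv> L2 \<mu>2"

text \<open>
  The relations of the problem differ in a condition on the functions \<open>u\<^sub>1\<close>, \<open>u\<^sub>2\<close>, which survives
  a change of \<open>f\<close> on a null set.
\<close>

definition "relation Q = {(cls u1, cls f) | u1 u2 f. (u1, u2, f) \<in> triples b R1 R2 \<and> Q u1 u2}"

lemma relationE:
  assumes "(X, Y) \<in> relation Q"
  obtains u1 u2 f where "X = cls u1" "Y = cls f" "f \<in> L2_fun \<mu>2" "u1 \<in> L2_fun \<mu>2" "integral_pair b R1 R2 u1 u2 f" "Q u1 u2"
  using assms unfolding relation_def triples_def by blast

lemma relationI:
  "f \<in> L2_fun \<mu>2 \<Longrightarrow> u1 \<in> L2_fun \<mu>2 \<Longrightarrow> integral_pair b R1 R2 u1 u2 f \<Longrightarrow> Q u1 u2 \<Longrightarrow> (cls u1, cls f) \<in> relation Q"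
  unfolding relation_def triples_def by blast

lemma shift_relationE:
  assumes "(X, cls g) \<in> shift_rel H (relation Q) z" and g: "g \<in> L2_fun \<mu>2"
  obtains u1 u2 where "X = cls u1" "u1 \<in> L2_fun \<mu>2" "integral_pair b R1 R2 u1 u2 (\<lambda>t. z * u1 t + g t)" "Q u1 u2"
proof -
  obtain F where XF: "(X, F) \<in> relation Q" "cls g = Add H F (Scale H (- z) X)"
    using assms(1) by (auto simp: shift_rel_def)
  from XF(1) obtain u1 u2 f where u: "X = cls u1" "F = cls f" "f \<in> L2_fun \<mu>2" "u1 \<in> L2_fun \<mu>2"
    "integral_pair b R1 R2 u1 u2 f" "Q u1 u2" by (rule relationE)
  note zu = L2_fun_scale[OF u(4), of "- z"]
  have "cls g = cls (\<lambda>x. f x + - z * u1 x)"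
    using XF(2) u by (simp only: L2_ops_class(2)[OF u(4) u(4)] L2_ops_class(1)[OF u(3) zu])
  then have "AE x in \<mu>2. g x = f x + - z * u1 x"
    by (subst (asm) L2_class_eq_iff) (intro g L2_fun_add u zu)+
  then have "AE x in \<mu>2. f x = z * u1 x + g x" by (rule AE_mp) (auto intro!: AE_I2)
  then have "integral_pair b R1 R2 u1 u2 (\<lambda>t. z * u1 t + g t)"
    by (intro integral_pair_AE[OF u(5)] L2_fun_measurable L2_fun_add L2_fun_scale u g)
  with u that show ?thesis by blast
qed

lemma shift_relationI:
  assumes u: "integral_pair b R1 R2 u1 u2 (\<lambda>t. z * u1 t + g t)" "u1 \<in> L2_fun \<mu>2" "Q u1 u2" and g: "g \<in> L2_fun \<mu>2"
  shows "(cls u1, cls g) \<in> shift_rel H (relation Q) z"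
proof -
  note f = L2_fun_add[OF L2_fun_scale[OF u(2), of z] g]
  have "(cls u1, cls (\<lambda>t. z * u1 t + g t)) \<in> relation Q" by (rule relationI[where Q = Q, OF f u(2,1,3)])
  moreover have "cls g = Add H (cls (\<lambda>t. z * u1 t + g t)) (Scale H (- z) (cls u1))"
    unfolding L2_ops_class(2)[OF u(2) u(2)] L2_ops_class(1)[OF f L2_fun_scale[OF u(2)]]
    by (simp add: algebra_simps)
  ultimately show ?thesis unfolding shift_rel_def by blast
qed

lemma ker_relation:
  "ker_rel H (shift_rel H (relation Q) z) =
    {cls u1 | u1 u2. u1 \<in> L2_fun \<mu>2 \<and> integral_pair b R1 R2 u1 u2 (\<lambda>t. z * u1 t) \<and> Q u1 u2}"
proof (intro equalityI subsetI)
  fix X assume "X \<in> ker_rel H (shift_rel H (relation Q) z)"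
  then have "(X, cls (\<lambda>x. 0)) \<in> shift_rel H (relation Q) z" by (simp add: ker_rel_def Zero_L2)
  then obtain u1 u2 where "X = cls u1" "u1 \<in> L2_fun \<mu>2" "integral_pair b R1 R2 u1 u2 (\<lambda>t. z * u1 t + 0)" "Q u1 u2"
    by (rule shift_relationE[OF _ zero_L2_fun])
  then show "X \<in> {cls u1 | u1 u2. u1 \<in> L2_fun \<mu>2 \<and> integral_pair b R1 R2 u1 u2 (\<lambda>t. z * u1 t) \<and> Q u1 u2}"
    by auto
next
  fix X assume "X \<in> {cls u1 | u1 u2. u1 \<in> L2_fun \<mu>2 \<and> integral_pair b R1 R2 u1 u2 (\<lambda>t. z * u1 t) \<and> Q u1 u2}"
  then obtain u1 u2 where u: "X = cls u1" "u1 \<in> L2_fun \<mu>2" "integral_pair b R1 R2 u1 u2 (\<lambda>t. z * u1 t)" "Q u1 u2"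
    by blast
  have "(cls u1, cls (\<lambda>x. 0)) \<in> shift_rel H (relation Q) z"
    by (rule shift_relationI[where Q = Q and ?u2.0 = u2]) (use u in \<open>simp_all add: zero_L2_fun\<close>)
  then show "X \<in> ker_rel H (shift_rel H (relation Q) z)" by (simp add: ker_rel_def Zero_L2 u)
qed

lemma T_max_eq: "T_max b R1 R2 = relation (\<lambda>_ _. True)"
  by (simp add: T_max_def relation_def)

lemma T_N_eq: "T_N b R1 R2 = relation (\<lambda>u1 u2. u1 0 = 0 \<and> u2 0 = 0 \<and> (u2 \<longlongrightarrow> 0) (at_end b))"
  by (simp add: T_N_def relation_def)

lemma T_NE:
  assumes "(U, F) \<in> T_N b R1 R2"
  obtains u1 u2 f where "U = cls u1" "F = cls f" "f \<in> L2_fun \<mu>2" "u1 \<in> L2_fun \<mu>2"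
    "integral_pair b R1 R2 u1 u2 f" "u1 0 = 0" "u2 0 = 0" "(u2 \<longlongrightarrow> 0) (at_end b)"
proof -
  obtain u1 u2 f where u: "U = cls u1" "F = cls f" "f \<in> L2_fun \<mu>2" "u1 \<in> L2_fun \<mu>2"
    "integral_pair b R1 R2 u1 u2 f" "u1 0 = 0 \<and> u2 0 = 0 \<and> (u2 \<longlongrightarrow> 0) (at_end b)"
    using assms unfolding T_N_eq by (rule relationE)
  show thesis by (rule that[OF u(1-5)]) (use u(6) in auto)
qed

text \<open>
  The initial values of two square-integrable solutions with independent classes are independent, by
  uniqueness, so a two-dimensional eigenspace contains both fundamental solutions.
\<close>

lemma limit_circle_imp_system:
  assumes "limit_circle b R1 R2"
  shows "limit_circle_system b R1 R2"
proof -
  let ?E = "\<lambda>u1 u2. integral_pair b R1 R2 u1 u2 (\<lambda>t. \<i> * u1 t)"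
  have "has_dim H (ker_rel H (shift_rel H (T_max b R1 R2) \<i>)) 2"
    using assms unfolding limit_circle_def by (simp add: complex_is_Real_iff)
  then obtain vs where vs: "length vs = 2" "set vs \<subseteq> ker_rel H (shift_rel H (relation (\<lambda>_ _. True)) \<i>)"
    "lin_indep H vs" unfolding has_dim_def T_max_eq by blast
  then obtain X Y where XY: "vs = [X, Y]"
    by (metis (no_types, lifting) One_nat_def Suc_1 length_0_conv length_Suc_conv)
  obtain u1 u2 where u: "X = cls u1" "u1 \<in> L2_fun \<mu>2" "?E u1 u2"
    using vs(2) unfolding XY ker_relation by auto
  obtain v1 v2 where v: "Y = cls v1" "v1 \<in> L2_fun \<mu>2" "?E v1 v2"
    using vs(2) unfolding XY ker_relation by auto
  define D where "D = u1 0 * v2 0 - v1 0 * u2 0"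
  have comb: "?E (\<lambda>x. a * u1 x + d * v1 x) (\<lambda>x. a * u2 x + d * v2 x)" for a d
    using integral_pair_combine[OF u(3) v(3), of a d] by (simp add: algebra_simps)
  have L: "(\<lambda>x. a * u1 x + d * v1 x) \<in> L2_fun \<mu>2" for a d
    by (intro L2_fun_add L2_fun_scale u v)
  have indep: "a = 0 \<and> d = 0" if "a * u1 0 + d * v1 0 = 0" "a * u2 0 + d * v2 0 = 0" for a d
  proof -
    have "a * u1 x + d * v1 x = 0" if "x \<in> Ico0 b" for x
      by (rule homogeneous_unique[OF comb _ _ that]) fact+
    then have "cls (\<lambda>x. a * u1 x + d * v1 x) = cls (\<lambda>x. 0)"
      by (intro L2_class_cong L zero_L2_fun) auto
    then have "lincomb H [a, d] [X, Y] = Zero H"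
      by (simp add: u v lincomb_pair Zero_L2)
    then have "\<forall>c\<in>set [a, d]. c = 0"
      using vs(3)[unfolded lin_indep_def XY, THEN spec, of "[a, d]"] by simp
    then show ?thesis by simp
  qed
  have D: "D \<noteq> 0"
  proof
    assume D0: "D = 0"
    have "v2 0 * u1 0 + - u2 0 * v1 0 = 0" "v2 0 * u2 0 + - u2 0 * v2 0 = 0"
      "v1 0 * u1 0 + - u1 0 * v1 0 = 0" "v1 0 * u2 0 + - u1 0 * v2 0 = 0"
      using D0 unfolding D_def by algebra+
    then have "v2 0 = 0 \<and> - u2 0 = 0" and "v1 0 = 0 \<and> - u1 0 = 0" by (metis indep)+
    then show False using indep[of 1 0] by simp
  qed
  show ?thesis
  proof (rule limit_circle_imp)
    show "?E (\<lambda>x. v2 0 / D * u1 x + - u2 0 / D * v1 x) (\<lambda>x. v2 0 / D * u2 x + - u2 0 / D * v2 x)" by (rule comb)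
    show "?E (\<lambda>x. - v1 0 / D * u1 x + u1 0 / D * v1 x) (\<lambda>x. - v1 0 / D * u2 x + u1 0 / D * v2 x)" by (rule comb)
    show "v2 0 / D * u1 0 + - u2 0 / D * v1 0 = 1" "v2 0 / D * u2 0 + - u2 0 / D * v2 0 = 0"
      "- v1 0 / D * u1 0 + u1 0 / D * v1 0 = 0" "- v1 0 / D * u2 0 + u1 0 / D * v2 0 = 1"
    proof -
      have "v2 0 / D * u1 0 + - u2 0 / D * v1 0 = D / D" "- v1 0 / D * u2 0 + u1 0 / D * v2 0 = D / D"
        unfolding add_divide_distrib diff_divide_distrib D_def[THEN arg_cong[where f = "\<lambda>y. y / D"]] by (simp_all add: mult.commute)
      then show "v2 0 / D * u1 0 + - u2 0 / D * v1 0 = 1" "- v1 0 / D * u2 0 + u1 0 / D * v2 0 = 1"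
        using D by simp_all
    qed (simp_all add: mult.commute)
  qed (rule L)+
qed

end

text \<open>
  The first assumption makes the initial values functions of the classes in \<open>T\<^sub>m\<^sub>a\<^sub>x\<close>. The second one
  is what singularity means once \<open>dR\<^sub>2\<close> is finite.
\<close>

locale singular_limit_circle = limit_circle_system +
  assumes separation: "(AE x in dR b R2. p + q * complex_of_real (R1 x) = 0) \<Longrightarrow> p = 0 \<and> q = 0"
    and R1_unbounded: "filterlim R1 at_top (at_end b)"
begin

abbreviation "mass \<equiv> measure \<mu>2 (Ico0 b)"

lemma mass_pos: "0 < mass"
proof -
  have "mass \<noteq> 0"
  proof
    assume "mass = 0"
    then have "emeasure \<mu>2 (space \<mu>2) = 0"
      using F2.emeasure_eq_measure by simp
    then have "AE x in \<mu>2. (1 :: complex) + 0 * complex_of_real (R1 x) = 0"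
      by (intro AE_I[OF _ _ sets.top]) auto
    from separation[OF this] show False by simp
  qed
  then show ?thesis by (simp add: zero_less_measure_iff)
qed

text \<open>
  The difference of two triples with the same classes has a density that vanishes almost everywhere.
  Its second component is constant, and its first component is a combination of \<open>1\<close> and \<open>R\<^sub>1\<close>.
\<close>

lemma determined:
  assumes u: "integral_pair b R1 R2 u1 u2 f" "f \<in> L2_fun \<mu>2" and v: "integral_pair b R1 R2 v1 v2 g" "g \<in> L2_fun \<mu>2"
    and eq: "cls u1 = cls v1" "cls f = cls g"
  shows "u1 0 = v1 0" "u2 0 = v2 0"
proof -
  have uL: "u1 \<in> L2_fun \<mu>2" and vL: "v1 \<in> L2_fun \<mu>2"
    using u v by (auto intro: integral_pair_L2 L2_integrable)
  have ae: "AE x in \<mu>2. u1 x = v1 x" "AE x in \<mu>2. f x = g x"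
    using eq by (simp_all add: L2_class_eq_iff uL vL u v)
  let ?p = "u1 0 - v1 0" and ?q = "u2 0 - v2 0"
  have "u1 x = v1 x + (?p + ?q * R1 x)" if x: "x \<in> Ico0 b" for x
  proof -
    have 2: "u2 t = v2 t + ?q" if "t \<in> Ico0 b" for t
      using integral_pairD(4)[OF u(1) that] integral_pairD(4)[OF v(1) that]
        S2.cum_AE_cong[OF ae(2) L2_fun_measurable[OF u(2)] L2_fun_measurable[OF v(2)] that] by simp
    have "cum \<mu>1 u2 x = cum \<mu>1 (\<lambda>t. v2 t + ?q) x" by (rule S1.cum_cong[OF x 2])
    also have "\<dots> = cum \<mu>1 v2 x + ?q * R1 x"
      by (simp only: S1.cum_add[OF integral_pairD(1)[OF v(1)] S1.locally_integrable_const x] S1.cum_const[OF x])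
    finally show ?thesis using integral_pairD(3)[OF u(1) x] integral_pairD(3)[OF v(1) x] by simp
  qed
  note eq' = this
  have "AE x in \<mu>2. ?p + ?q * complex_of_real (R1 x) = 0"
  proof (rule AE_mp[OF ae(1)], intro AE_I2 impI)
    fix x assume "x \<in> space \<mu>2" "u1 x = v1 x"
    then have "v1 x + (?p + ?q * complex_of_real (R1 x)) = v1 x" using eq'[of x] by simp
    then show "?p + ?q * complex_of_real (R1 x) = 0" by (simp only: add_cancel_left_right)
  qed
  from separation[OF this] show "u1 0 = v1 0" "u2 0 = v2 0" by auto
qed

lemma Gamma_N:
  assumes u: "integral_pair b R1 R2 u1 u2 f" "f \<in> L2_fun \<mu>2"
  shows "Gamma0_N b R1 R2 (cls u1, cls f) = u2 0" "Gamma1_N b R1 R2 (cls u1, cls f) = - u1 0"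
proof -
  have t: "(u1, u2, f) \<in> triples b R1 R2" using u by (simp add: triples_iff)
  have d: "v1 0 = u1 0 \<and> v2 0 = u2 0" if "(v1, v2, g) \<in> triples b R1 R2" "(cls u1, cls f) = (cls v1, cls g)" for v1 v2 g
    using that determined[OF _ _ u, of v1 v2 g] by (auto simp: triples_iff)
  show "Gamma0_N b R1 R2 (cls u1, cls f) = u2 0" unfolding Gamma0_N_def
    by (rule the_equality) (use t d in \<open>blast | metis\<close>)+
  show "Gamma1_N b R1 R2 (cls u1, cls f) = - u1 0" unfolding Gamma1_N_def
    by (rule the_equality) (use t d in \<open>blast | metis\<close>)+
qed

definition "T_star = relation (\<lambda>u1 u2. (u2 \<longlongrightarrow> 0) (at_end b))"

lemma Inner_cls: "f \<in> L2_fun \<mu>2 \<Longrightarrow> g \<in> L2_fun \<mu>2 \<Longrightarrow> Inner H (cls f) (cls g) = (\<integral>t. f t * cnj (g t) \<partial>\<mu>2)"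
  by (rule L2_ops_class)

lemma green_cnj:
  assumes u: "integral_pair b R1 R2 u1 u2 f" "f \<in> L2_fun \<mu>2" "(u2 \<longlongrightarrow> 0) (at_end b)"
    and v: "integral_pair b R1 R2 v1 v2 g" "g \<in> L2_fun \<mu>2" "(v2 \<longlongrightarrow> 0) (at_end b)"
  shows "(\<integral>t. f t * cnj (v1 t) \<partial>\<mu>2) - (\<integral>t. u1 t * cnj (g t) \<partial>\<mu>2) = cnj (v1 0) * u2 0 - u1 0 * cnj (v2 0)"
proof -
  have "((\<lambda>x. cnj (v2 x)) \<longlongrightarrow> 0) (at_end b)" using tendsto_cnj[OF v(3)] by simp
  from green[OF u integral_pair_cnj[OF v(1)] L2_fun_cnj[OF v(2)] this] show ?thesis .
qed

lemma L2_norm_zero: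
  assumes f: "f \<in> L2_fun M" and 0: "(\<integral>t. f t * cnj (f t) \<partial>M) = 0"
  shows "AE t in M. f t = 0"
proof -
  have "complex_of_real (\<integral>t. (cmod (f t))\<^sup>2 \<partial>M) = 0"
    using 0 unfolding complex_norm_square[symmetric] by (simp only: integral_complex_of_real)
  then have "AE t in M. (cmod (f t))\<^sup>2 = 0"
    using f by (subst (asm) of_real_eq_0_iff, subst (asm) integral_nonneg_eq_0_iff_AE) (auto simp: L2_fun_def)
  then show ?thesis by (rule AE_mp) (auto intro!: AE_I2)
qed

text \<open>
  Every \<open>f\<close> of mean zero belongs to the range of \<open>T\<^sub>N\<close>. An element \<open>[v g]\<close> of the adjoint therefore
  differs from the solution with density \<open>g\<close>, zero value at \<open>0\<close> and Neumann condition at \<open>b\<close> by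
  a constant.
\<close>

lemma adjoint_T_N: "adjoint_rel H (T_N b R1 R2) = T_star"
proof (intro equalityI subsetI)
  fix VG assume "VG \<in> T_star"
  then obtain V G where VG: "VG = (V, G)" "(V, G) \<in> T_star" by (cases VG) auto
  then obtain v1 v2 g where v: "V = cls v1" "G = cls g" "g \<in> L2_fun \<mu>2" "v1 \<in> L2_fun \<mu>2"
    "integral_pair b R1 R2 v1 v2 g" "(v2 \<longlongrightarrow> 0) (at_end b)"
    unfolding T_star_def by (elim relationE)
  have "Inner H F V = Inner H U G" if UF: "(U, F) \<in> T_N b R1 R2" for U F
  proof -
    obtain u1 u2 f where u: "U = cls u1" "F = cls f" "f \<in> L2_fun \<mu>2" "u1 \<in> L2_fun \<mu>2"
      "integral_pair b R1 R2 u1 u2 f" "u1 0 = 0" "u2 0 = 0" "(u2 \<longlongrightarrow> 0) (at_end b)"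
      using UF by (rule T_NE)
    show ?thesis using green_cnj[OF u(5,3,8) v(5,3,6)] u v by (simp add: Inner_cls)
  qed
  then show "VG \<in> adjoint_rel H (T_N b R1 R2)"
    unfolding VG(1) adjoint_rel_def using v by (auto simp: Carrier_L2)
next
  fix VG assume "VG \<in> adjoint_rel H (T_N b R1 R2)"
  then obtain v g where v: "VG = (cls v, cls g)" "v \<in> L2_fun \<mu>2" "g \<in> L2_fun \<mu>2"
    and orth: "\<And>U F. (U, F) \<in> T_N b R1 R2 \<Longrightarrow> Inner H F (cls v) = Inner H U (cls g)"
    unfolding adjoint_rel_def Carrier_L2 by blast
  obtain w1 w2 where w: "(w1, w2, g) \<in> triples b R1 R2" "w1 0 = 0" "w2 0 = (\<integral>t. g t \<partial>\<mu>2)"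
    by (rule triple_exists[OF v(3)])
  then have wp: "integral_pair b R1 R2 w1 w2 g" by (simp add: triples_iff)
  have wlim: "(w2 \<longlongrightarrow> 0) (at_end b)" using u2_tendsto_0_iff[OF wp v(3)] w by simp
  have wL: "w1 \<in> L2_fun \<mu>2" by (rule integral_pair_L2[OF wp L2_integrable[OF v(3)]])
  define h where "h t = v t + - 1 * w1 t" for t
  have hL: "h \<in> L2_fun \<mu>2" unfolding h_def[abs_def] by (intro L2_fun_add L2_fun_scale v wL)
  define k where "k = (\<integral>t. h t \<partial>\<mu>2) / complex_of_real mass"
  define f where "f t = h t + - k * 1" for t
  have fL: "f \<in> L2_fun \<mu>2" unfolding f_def[abs_def] by (intro L2_fun_add L2_fun_scale hL one_L2)
  have f0: "(\<integral>t. f t \<partial>\<mu>2) = 0"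
    using mass_pos L2_integrable[OF hL] by (simp add: f_def k_def scaleR_conv_of_real)
  obtain u1 u2 where u: "(u1, u2, f) \<in> triples b R1 R2" "u1 0 = 0" "u2 0 = 0"
    by (rule triple_exists[OF fL])
  then have up: "integral_pair b R1 R2 u1 u2 f" by (simp add: triples_iff)
  have ulim: "(u2 \<longlongrightarrow> 0) (at_end b)" using u2_tendsto_0_iff[OF up fL] u f0 by simp
  have uL: "u1 \<in> L2_fun \<mu>2" by (rule integral_pair_L2[OF up L2_integrable[OF fL]])
  have "(cls u1, cls f) \<in> T_N b R1 R2"
    unfolding T_N_eq by (intro relationI[where ?u2.0 = u2] fL uL up conjI u ulim)
  from orth[OF this] have "(\<integral>t. f t * cnj (v t) \<partial>\<mu>2) = (\<integral>t. u1 t * cnj (g t) \<partial>\<mu>2)"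
    by (simp add: Inner_cls fL uL v)
  moreover have "(\<integral>t. f t * cnj (w1 t) \<partial>\<mu>2) = (\<integral>t. u1 t * cnj (g t) \<partial>\<mu>2)"
    using green_cnj[OF up fL ulim wp v(3) wlim] u by simp
  moreover have "(\<integral>t. f t * cnj (f t) \<partial>\<mu>2) = (\<integral>t. f t * cnj (v t) - f t * cnj (w1 t) - cnj k * f t \<partial>\<mu>2)"
    by (intro Bochner_Integration.integral_cong refl) (simp add: f_def h_def algebra_simps)
  moreover have "\<dots> = (\<integral>t. f t * cnj (v t) \<partial>\<mu>2) - (\<integral>t. f t * cnj (w1 t) \<partial>\<mu>2) - cnj k * (\<integral>t. f t \<partial>\<mu>2)"
    using L2_fun_mult_integrable[OF fL L2_fun_cnj[OF v(2)]] L2_fun_mult_integrable[OF fL L2_fun_cnj[OF wL]]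
      L2_integrable[OF fL] by simp
  ultimately have "(\<integral>t. f t * cnj (f t) \<partial>\<mu>2) = 0" using f0 by simp
  then have "AE t in \<mu>2. f t = 0" by (rule L2_norm_zero[OF fL])
  then have ae: "AE t in \<mu>2. v t = w1 t + k"
    by (rule AE_mp) (auto intro!: AE_I2 simp: f_def h_def algebra_simps)
  have wkL: "(\<lambda>t. w1 t + k) \<in> L2_fun \<mu>2"
    using L2_fun_add[OF wL L2_fun_scale[OF one_L2, of k]] by simp
  have "integral_pair b R1 R2 (\<lambda>t. w1 t + k) w2 g"
    using wp unfolding integral_pair_iff by auto
  then have "(cls (\<lambda>t. w1 t + k), cls g) \<in> T_star"
    unfolding T_star_def by (intro relationI[where ?u2.0 = w2] v wkL wlim)
  moreover have "cls v = cls (\<lambda>t. w1 t + k)" using ae by (simp add: L2_class_eq_iff v wkL)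
  ultimately show "VG \<in> T_star" by (simp add: v)
qed

lemma T_starE:
  assumes "(X, Y) \<in> adjoint_rel H (T_N b R1 R2)"
  obtains u1 u2 f where "X = cls u1" "Y = cls f" "f \<in> L2_fun \<mu>2" "u1 \<in> L2_fun \<mu>2" "integral_pair b R1 R2 u1 u2 f"
    "(u2 \<longlongrightarrow> 0) (at_end b)"
  using assms unfolding adjoint_T_N T_star_def by (elim relationE)

lemma T_N_linear: "linear_relation H (T_N b R1 R2)"
  unfolding linear_relation_def
proof (intro conjI allI impI)
  let ?Q = "\<lambda>u1 u2 :: real \<Rightarrow> complex. u1 0 = 0 \<and> u2 0 = 0 \<and> (u2 \<longlongrightarrow> 0) (at_end b)"
  show "T_N b R1 R2 \<subseteq> Carrier H \<times> Carrier H"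
    unfolding T_N_eq by (auto elim!: relationE simp: Carrier_L2)
  have "integral_pair b R1 R2 (\<lambda>x. 0) (\<lambda>x. 0) (\<lambda>x. 0)"
    by (simp add: integral_pair_def set_integrable_def set_lebesgue_integral_def)
  then show "(Zero H, Zero H) \<in> T_N b R1 R2"
    unfolding T_N_eq Zero_L2 by (intro relationI[where ?u2.0 = "\<lambda>x. 0"] zero_L2_fun) auto
  have comb: "(cls (\<lambda>x. c * u1 x + d * v1 x), cls (\<lambda>x. c * f x + d * g x)) \<in> relation ?Q"
    if u: "f \<in> L2_fun \<mu>2" "u1 \<in> L2_fun \<mu>2" "integral_pair b R1 R2 u1 u2 f" "?Q u1 u2"
    and v: "g \<in> L2_fun \<mu>2" "v1 \<in> L2_fun \<mu>2" "integral_pair b R1 R2 v1 v2 g" "?Q v1 v2" for u1 u2 f v1 v2 g c d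
  proof (rule relationI[where Q = ?Q, OF _ _ integral_pair_combine[OF u(3) v(3)]])
    have "((\<lambda>x. c * u2 x + d * v2 x) \<longlongrightarrow> c * 0 + d * 0) (at_end b)"
      using u v by (intro tendsto_intros) auto
    then show "?Q (\<lambda>x. c * u1 x + d * v1 x) (\<lambda>x. c * u2 x + d * v2 x)" using u v by simp
  qed (intro L2_fun_add L2_fun_scale u v)+
  fix U F V G assume UF: "(U, F) \<in> T_N b R1 R2" and VG: "(V, G) \<in> T_N b R1 R2"
  from UF obtain u1 u2 f where u: "U = cls u1" "F = cls f" "f \<in> L2_fun \<mu>2" "u1 \<in> L2_fun \<mu>2" "integral_pair b R1 R2 u1 u2 f" "?Q u1 u2"
    unfolding T_N_eq by (rule relationE)
  from VG obtain v1 v2 g where v: "V = cls v1" "G = cls g" "g \<in> L2_fun \<mu>2" "v1 \<in> L2_fun \<mu>2" "integral_pair b R1 R2 v1 v2 g" "?Q v1 v2"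
    unfolding T_N_eq by (rule relationE)
  show "(Add H U V, Add H F G) \<in> T_N b R1 R2"
    using comb[OF u(3-6) v(3-6), of 1 1] unfolding u(1,2) v(1,2) L2_ops_class(1)[OF u(4) v(4)] L2_ops_class(1)[OF u(3) v(3)] T_N_eq
    by simp
next
  let ?Q = "\<lambda>u1 u2 :: real \<Rightarrow> complex. u1 0 = 0 \<and> u2 0 = 0 \<and> (u2 \<longlongrightarrow> 0) (at_end b)"
  fix c U F assume UF: "(U, F) \<in> T_N b R1 R2"
  from UF obtain u1 u2 f where u: "U = cls u1" "F = cls f" "f \<in> L2_fun \<mu>2" "u1 \<in> L2_fun \<mu>2" "integral_pair b R1 R2 u1 u2 f" "?Q u1 u2"
    unfolding T_N_eq by (rule relationE)
  have p: "integral_pair b R1 R2 (\<lambda>x. c * u1 x) (\<lambda>x. c * u2 x) (\<lambda>x. c * f x)"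
    using integral_pair_combine[OF u(5) u(5), of c 0] by simp
  have "((\<lambda>x. c * u2 x) \<longlongrightarrow> c * 0) (at_end b)"
    using u by (intro tendsto_intros) auto
  then show "(Scale H c U, Scale H c F) \<in> T_N b R1 R2"
    unfolding u(1,2) L2_ops_class(2)[OF u(4) u(4)] L2_ops_class(2)[OF u(3) u(3)] T_N_eq
    by (intro relationI[where Q = ?Q, OF _ _ p] L2_fun_scale u) (use u in auto)
qed

lemma T_N_symmetric: "symmetric_rel H (T_N b R1 R2)"
  unfolding symmetric_rel_def adjoint_T_N by (auto simp: T_N_eq T_star_def relation_def)

lemma Inner_dirichlet:
  assumes u: "integral_pair b R1 R2 u1 u2 f" "f \<in> L2_fun \<mu>2" "(u2 \<longlongrightarrow> 0) (at_end b)" and 0: "u1 0 = 0 \<or> u2 0 = 0"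
  shows "(\<integral>t. f t * cnj (u1 t) \<partial>\<mu>2) = complex_of_real (dirichlet u2)"
proof -
  have "(\<integral>t. f t * cnj (u1 t) \<partial>\<mu>2) = cnj (\<integral>t. u1 t * cnj (f t) \<partial>\<mu>2)"
    by (subst Bochner_Integration.integral_cnj[symmetric]) (simp add: mult.commute)
  also have "(\<integral>t. u1 t * cnj (f t) \<partial>\<mu>2) = complex_of_real (dirichlet u2)"
    using dirichlet(1)[OF u] 0 by auto
  finally show ?thesis by simp
qed

lemma T_N_nonnegative: "nonnegative_rel H (T_N b R1 R2)"
  unfolding nonnegative_rel_def
proof clarify
  fix U F assume "(U, F) \<in> T_N b R1 R2"
  then obtain u1 u2 f where u: "U = cls u1" "F = cls f" "f \<in> L2_fun \<mu>2" "u1 \<in> L2_fun \<mu>2"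
      "integral_pair b R1 R2 u1 u2 f" "u1 0 = 0" "u2 0 = 0" "(u2 \<longlongrightarrow> 0) (at_end b)"
    by (rule T_NE)
  show "Inner H F U \<in> \<real>\<^sub>\<ge>\<^sub>0"
    using Inner_dirichlet[OF u(5,3,8)] dirichlet(3)[OF u(5,3,8)] u by (simp add: Inner_cls)
qed

text \<open>
  Surjectivity: the initial values are free, and the Neumann condition at \<open>b\<close> only prescribes the
  integral of \<open>f\<close>, which a constant \<open>f\<close> can meet.
\<close>

lemma boundary_triple_N:
  "boundary_triple H (T_N b R1 R2) (Gamma0_N b R1 R2) (Gamma1_N b R1 R2)"
  if "deficiency_indices H (T_N b R1 R2) 1 1"
  unfolding boundary_triple_def
proof (intro conjI T_N_symmetric that)
  let ?T = "adjoint_rel H (T_N b R1 R2)"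
  let ?G0 = "Gamma0_N b R1 R2" and ?G1 = "Gamma1_N b R1 R2"
  have add: "?G0 (Add H U V, Add H F G) = ?G0 (U, F) + ?G0 (V, G)" "?G1 (Add H U V, Add H F G) = ?G1 (U, F) + ?G1 (V, G)"
    if UF: "(U, F) \<in> ?T" and VG: "(V, G) \<in> ?T" for U F V G
  proof -
    from UF obtain u1 u2 f where u: "U = cls u1" "F = cls f" "f \<in> L2_fun \<mu>2" "u1 \<in> L2_fun \<mu>2" "integral_pair b R1 R2 u1 u2 f"
      by (rule T_starE)
    from VG obtain v1 v2 g where v: "V = cls v1" "G = cls g" "g \<in> L2_fun \<mu>2" "v1 \<in> L2_fun \<mu>2" "integral_pair b R1 R2 v1 v2 g"
      by (rule T_starE)
    have p: "integral_pair b R1 R2 (\<lambda>x. u1 x + v1 x) (\<lambda>x. u2 x + v2 x) (\<lambda>x. f x + g x)"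
      using integral_pair_combine[OF u(5) v(5), of 1 1] by simp
    show "?G0 (Add H U V, Add H F G) = ?G0 (U, F) + ?G0 (V, G)" "?G1 (Add H U V, Add H F G) = ?G1 (U, F) + ?G1 (V, G)"
      unfolding u(1,2) v(1,2) L2_ops_class(1)[OF u(4) v(4)] L2_ops_class(1)[OF u(3) v(3)]
        Gamma_N[OF u(5,3)] Gamma_N[OF v(5,3)] Gamma_N[OF p L2_fun_add[OF u(3) v(3)]] by simp_all
  qed
  have scale: "?G0 (Scale H c U, Scale H c F) = c * ?G0 (U, F)" "?G1 (Scale H c U, Scale H c F) = c * ?G1 (U, F)"
    if UF: "(U, F) \<in> ?T" for U F c
  proof -
    from UF obtain u1 u2 f where u: "U = cls u1" "F = cls f" "f \<in> L2_fun \<mu>2" "u1 \<in> L2_fun \<mu>2" "integral_pair b R1 R2 u1 u2 f"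
      by (rule T_starE)
    have p: "integral_pair b R1 R2 (\<lambda>x. c * u1 x) (\<lambda>x. c * u2 x) (\<lambda>x. c * f x)"
      using integral_pair_combine[OF u(5) u(5), of c 0] by simp
    show "?G0 (Scale H c U, Scale H c F) = c * ?G0 (U, F)" "?G1 (Scale H c U, Scale H c F) = c * ?G1 (U, F)"
      unfolding u(1,2) L2_ops_class(2)[OF u(4) u(4)] L2_ops_class(2)[OF u(3) u(3)]
        Gamma_N[OF u(5,3)] Gamma_N[OF p L2_fun_scale[OF u(3)]] by simp_all
  qed
  show "\<forall>\<Gamma>\<in>{?G0, ?G1}. (\<forall>(u, f)\<in>?T. \<forall>(v, g)\<in>?T. \<Gamma> (Add H u v, Add H f g) = \<Gamma> (u, f) + \<Gamma> (v, g)) \<and>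
        (\<forall>c. \<forall>(u, f)\<in>?T. \<Gamma> (Scale H c u, Scale H c f) = c * \<Gamma> (u, f))"
    using add scale by auto
  have "Inner H F V - Inner H U G = ?G1 (U, F) * cnj (?G0 (V, G)) - ?G0 (U, F) * cnj (?G1 (V, G))"
    if UF: "(U, F) \<in> ?T" and VG: "(V, G) \<in> ?T" for U F V G
  proof -
    from UF obtain u1 u2 f where u: "U = cls u1" "F = cls f" "f \<in> L2_fun \<mu>2" "u1 \<in> L2_fun \<mu>2" "integral_pair b R1 R2 u1 u2 f"
       "(u2 \<longlongrightarrow> 0) (at_end b)"
      by (rule T_starE)
    from VG obtain v1 v2 g where v: "V = cls v1" "G = cls g" "g \<in> L2_fun \<mu>2" "v1 \<in> L2_fun \<mu>2" "integral_pair b R1 R2 v1 v2 g"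
       "(v2 \<longlongrightarrow> 0) (at_end b)"
      by (rule T_starE)
    show ?thesis
      using green_cnj[OF u(5,3,6) v(5,3,6)]
      unfolding u(1,2) v(1,2) Inner_cls[OF u(3) v(4)] Inner_cls[OF u(4) v(3)] Gamma_N[OF u(5,3)] Gamma_N[OF v(5,3)]
      by (simp add: algebra_simps)
  qed
  then show "\<forall>(u, f)\<in>?T. \<forall>(v, g)\<in>?T. Inner H f v - Inner H u g = ?G1 (u, f) * cnj (?G0 (v, g)) - ?G0 (u, f) * cnj (?G1 (v, g))"
    by auto
  show "(\<lambda>w. (?G0 w, ?G1 w)) ` ?T = UNIV"
  proof (intro equalityI subsetI UNIV_I)
    fix y :: "complex \<times> complex"
    obtain y0 y1 where y: "y = (y0, y1)" by (cases y)
    define f where "f t = (y0 / complex_of_real mass) * 1" for t :: real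
    have fL: "f \<in> L2_fun \<mu>2" unfolding f_def[abs_def] by (intro L2_fun_scale one_L2)
    have f0: "(\<integral>t. f t \<partial>\<mu>2) = y0" using mass_pos by (simp add: f_def scaleR_conv_of_real)
    obtain u1 u2 where u: "(u1, u2, f) \<in> triples b R1 R2" "u1 0 = - y1" "u2 0 = y0"
      by (rule triple_exists[OF fL])
    then have up: "integral_pair b R1 R2 u1 u2 f" by (simp add: triples_iff)
    have ulim: "(u2 \<longlongrightarrow> 0) (at_end b)" using u2_tendsto_0_iff[OF up fL] u f0 by simp
    have uL: "u1 \<in> L2_fun \<mu>2" by (rule integral_pair_L2[OF up L2_integrable[OF fL]])
    have "(cls u1, cls f) \<in> ?T"
      unfolding adjoint_T_N T_star_def by (intro relationI[where ?u2.0 = u2] fL uL up ulim)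
    then show "y \<in> (\<lambda>w. (?G0 w, ?G1 w)) ` ?T"
      by (rule rev_image_eqI) (simp add: Gamma_N[OF up fL] u y)
  qed
qed

end

section \<open>The Weyl function\<close>

text \<open>
  The Cauchy--Schwarz inequality in its additive form with a free parameter \<open>t\<close>.
\<close>

lemma L2_AM_GM:
  assumes f: "f \<in> L2_fun M" and g: "g \<in> L2_fun M" and t: "0 < t"
  shows "2 * cmod (\<integral>x. f x * g x \<partial>M) \<le> t * (\<integral>x. (cmod (f x))\<^sup>2 \<partial>M) + (\<integral>x. (cmod (g x))\<^sup>2 \<partial>M) / t"
proof -
  have i: "integrable M (\<lambda>x. (cmod (f x))\<^sup>2)" "integrable M (\<lambda>x. (cmod (g x))\<^sup>2)"
    using f g by (simp_all add: L2_fun_def)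
  have "2 * cmod (\<integral>x. f x * g x \<partial>M) \<le> 2 * (\<integral>x. cmod (f x * g x) \<partial>M)"
    by (simp add: integral_norm_bound)
  also have "\<dots> = (\<integral>x. 2 * cmod (f x * g x) \<partial>M)" by simp
  also have "\<dots> \<le> (\<integral>x. t * (cmod (f x))\<^sup>2 + (cmod (g x))\<^sup>2 / t \<partial>M)"
  proof (rule integral_mono)
    show "integrable M (\<lambda>x. 2 * cmod (f x * g x))"
      by (intro integrable_mult_right integrable_norm L2_fun_mult_integrable f g)
    show "integrable M (\<lambda>x. t * (cmod (f x))\<^sup>2 + (cmod (g x))\<^sup>2 / t)" using i by auto
    fix x
    have "0 \<le> (t * cmod (f x) - cmod (g x))\<^sup>2" by simp
    then have "2 * cmod (f x) * cmod (g x) * t \<le> t\<^sup>2 * (cmod (f x))\<^sup>2 + (cmod (g x))\<^sup>2"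
      by (simp add: power2_diff power_mult_distrib mult_ac)
    then show "2 * cmod (f x * g x) \<le> t * (cmod (f x))\<^sup>2 + (cmod (g x))\<^sup>2 / t"
      using t by (simp add: norm_mult field_simps power2_eq_square)
  qed
  also have "\<dots> = t * (\<integral>x. (cmod (f x))\<^sup>2 \<partial>M) + (\<integral>x. (cmod (g x))\<^sup>2 \<partial>M) / t" using i by simp
  finally show ?thesis .
qed

lemma integral_norm_square: "(\<integral>x. f x * cnj (f x) \<partial>M) = complex_of_real (\<integral>x. (cmod (f x))\<^sup>2 \<partial>M)"
  unfolding complex_norm_square[symmetric] by (rule integral_complex_of_real)

text \<open>
  The distance of \<open>z N\<close> to the nonnegative half-line is proportional to \<open>N\<close>.
\<close>

lemma dist_nonneg_axis:
  assumes "z \<notin> \<real>\<^sub>\<ge>\<^sub>0"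
  shows "\<exists>d>0. \<forall>D\<ge>0. \<forall>N\<ge>0. d * N \<le> cmod (complex_of_real D - z * complex_of_real N)"
proof (cases "Im z = 0")
  case True
  then have "Re z < 0" using assms by (auto simp: complex_nonneg_Reals_iff)
  moreover have "- Re z * N \<le> cmod (complex_of_real D - z * complex_of_real N)" if "0 \<le> D" "0 \<le> N" for D N
    using complex_Re_le_cmod[of "complex_of_real D - z * complex_of_real N"] that by simp
  ultimately show ?thesis by (intro exI[of _ "- Re z"]) auto
next
  case False
  have "\<bar>Im z\<bar> * N \<le> cmod (complex_of_real D - z * complex_of_real N)" if "0 \<le> N" for D N
    using abs_Im_le_cmod[of "complex_of_real D - z * complex_of_real N"] that by (simp add: abs_mult)
  then show ?thesis using False by (intro exI[of _ "\<bar>Im z\<bar>"]) auto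
qed

context singular_limit_circle
begin

lemma c_sol:
  "integral_pair b R1 R2 (\<lambda>x. c1_sol b R1 R2 x z) (\<lambda>x. c2_sol b R1 R2 x z) (\<lambda>t. z * c1_sol b R1 R2 t z)"
  "c1_sol b R1 R2 0 z = 1" "c2_sol b R1 R2 0 z = 0"
  using system_solution[of 1 0 z] by (simp_all add: c1_sol_def c2_sol_def)

lemma s_sol:
  "integral_pair b R1 R2 (\<lambda>x. s1_sol b R1 R2 x z) (\<lambda>x. s2_sol b R1 R2 x z) (\<lambda>t. z * s1_sol b R1 R2 t z)"
  "s1_sol b R1 R2 0 z = 0" "s2_sol b R1 R2 0 z = 1"
  using system_solution[of 0 1 z] by (simp_all add: s1_sol_def s2_sol_def)

lemmas c_L2 = homogeneous_L2[OF c_sol(1)]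
lemmas s_L2 = homogeneous_L2[OF s_sol(1)]

definition "c_integral z = (\<integral>t. c1_sol b R1 R2 t z \<partial>\<mu>2)"
definition "s_integral z = (\<integral>t. s1_sol b R1 R2 t z \<partial>\<mu>2)"
definition "c2_end z = - z * c_integral z"
definition "s2_end z = 1 - z * s_integral z"

lemma c2_tendsto: "((\<lambda>x. c2_sol b R1 R2 x z) \<longlongrightarrow> c2_end z) (at_end b)"
  using u2_tendsto[OF c_sol(1) L2_fun_scale[OF c_L2]] by (simp add: c_sol c2_end_def c_integral_def)

lemma s2_tendsto: "((\<lambda>x. s2_sol b R1 R2 x z) \<longlongrightarrow> s2_end z) (at_end b)"
  using u2_tendsto[OF s_sol(1) L2_fun_scale[OF s_L2]] by (simp add: s_sol s2_end_def s_integral_def)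

lemma neumann_m_eq: "neumann_m b R1 R2 z = s2_end z / c2_end z"
  unfolding neumann_m_def
  by (simp add: tendsto_Lim[OF at_end_neq_bot[OF b_pos] c2_tendsto] tendsto_Lim[OF at_end_neq_bot[OF b_pos] s2_tendsto])

lemma zero_pair: "integral_pair b R1 R2 (\<lambda>x. 0) (\<lambda>x. 0) (\<lambda>x. 0)"
  by (simp add: integral_pair_def set_integrable_def set_lebesgue_integral_def)

lemma homogeneous_zero_class:
  assumes u: "integral_pair b R1 R2 u1 u2 (\<lambda>t. z * u1 t)" and 0: "cls u1 = cls (\<lambda>x. 0)"
  shows "u1 0 = 0" "u2 0 = 0"
proof -
  note L = homogeneous_L2[OF u]
  have "AE x in \<mu>2. u1 x = 0" using 0 by (simp add: L2_class_eq_iff L zero_L2_fun)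
  then have "cls (\<lambda>t. z * u1 t) = cls (\<lambda>x. 0)"
    by (subst L2_class_eq_iff) (auto simp: L L2_fun_scale zero_L2_fun elim!: AE_mp)
  from determined[OF u L2_fun_scale[OF L] zero_pair zero_L2_fun 0 this]
  show "u1 0 = 0" "u2 0 = 0" by simp_all
qed

lemma c_norm_pos: "0 < (\<integral>t. (cmod (c1_sol b R1 R2 t z))\<^sup>2 \<partial>\<mu>2)"
proof -
  have "(\<integral>t. (cmod (c1_sol b R1 R2 t z))\<^sup>2 \<partial>\<mu>2) \<noteq> 0"
  proof
    assume "(\<integral>t. (cmod (c1_sol b R1 R2 t z))\<^sup>2 \<partial>\<mu>2) = 0"
    then have "(\<integral>t. c1_sol b R1 R2 t z * cnj (c1_sol b R1 R2 t z) \<partial>\<mu>2) = 0" by (simp add: integral_norm_square)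
    then have "AE t in \<mu>2. c1_sol b R1 R2 t z = 0" by (rule L2_norm_zero[OF c_L2])
    then have "cls (\<lambda>x. c1_sol b R1 R2 x z) = cls (\<lambda>x. 0)"
      by (simp add: L2_class_eq_iff c_L2 zero_L2_fun)
    from homogeneous_zero_class(1)[OF c_sol(1) this] show False by (simp add: c_sol)
  qed
  moreover have "0 \<le> (\<integral>t. (cmod (c1_sol b R1 R2 t z))\<^sup>2 \<partial>\<mu>2)" by simp
  ultimately show ?thesis by linarith
qed

text \<open>
  If \<open>c\<^sub>2(b) = 0\<close> then \<open>z\<close> is real and nonnegative: it is the quotient of the Dirichlet form of \<open>c\<close> by its squared norm.
\<close>

lemma c2_end_nonzero:
  assumes z: "z \<notin> \<real>\<^sub>\<ge>\<^sub>0"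
  shows "c2_end z \<noteq> 0"
proof
  assume 0: "c2_end z = 0"
  let ?c1 = "\<lambda>x. c1_sol b R1 R2 x z" and ?c2 = "\<lambda>x. c2_sol b R1 R2 x z"
  let ?N = "\<integral>t. (cmod (?c1 t))\<^sup>2 \<partial>\<mu>2"
  have lim: "(?c2 \<longlongrightarrow> 0) (at_end b)" using c2_tendsto[of z] 0 by simp
  have "(\<integral>t. z * ?c1 t * cnj (?c1 t) \<partial>\<mu>2) = complex_of_real (dirichlet ?c2)"
    by (rule Inner_dirichlet[OF c_sol(1) L2_fun_scale[OF c_L2] lim]) (simp add: c_sol)
  then have "z * complex_of_real ?N = complex_of_real (dirichlet ?c2)"
    by (simp add: mult.assoc integral_norm_square del: of_real_power)
  moreover have "0 \<le> dirichlet ?c2" by (rule dirichlet(3)[OF c_sol(1) L2_fun_scale[OF c_L2] lim])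
  ultimately have "z = complex_of_real (dirichlet ?c2 / ?N)" "0 \<le> dirichlet ?c2 / ?N"
    using c_norm_pos[of z] by (simp_all add: field_simps)
  then show False using z by (metis nonneg_Reals_of_real_iff)
qed

definition "neumann_coefficient z = s2_end z / c2_end z"
definition "psi1 z x = s1_sol b R1 R2 x z - neumann_coefficient z * c1_sol b R1 R2 x z"
definition "psi2 z x = s2_sol b R1 R2 x z - neumann_coefficient z * c2_sol b R1 R2 x z"

lemma psi:
  shows "integral_pair b R1 R2 (psi1 z) (psi2 z) (\<lambda>t. z * psi1 z t)"
    "psi1 z 0 = - neumann_coefficient z" "psi2 z 0 = 1"
    "c2_end z \<noteq> 0 \<Longrightarrow> (psi2 z \<longlongrightarrow> 0) (at_end b)"
proof -
  show "integral_pair b R1 R2 (psi1 z) (psi2 z) (\<lambda>t. z * psi1 z t)"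
    using integral_pair_combine[OF s_sol(1) c_sol(1), of 1 z "- neumann_coefficient z" z]
    unfolding psi1_def[abs_def] psi2_def[abs_def] by (simp add: algebra_simps)
  show "psi1 z 0 = - neumann_coefficient z" "psi2 z 0 = 1"
    by (simp_all add: psi1_def psi2_def c_sol s_sol)
  assume "c2_end z \<noteq> 0"
  moreover have "(psi2 z \<longlongrightarrow> s2_end z - neumann_coefficient z * c2_end z) (at_end b)"
    unfolding psi2_def[abs_def] by (intro tendsto_intros c2_tendsto s2_tendsto)
  ultimately show "(psi2 z \<longlongrightarrow> 0) (at_end b)" by (simp add: neumann_coefficient_def)
qed

lemmas psi_L2 = homogeneous_L2[OF psi(1)]

lemma neumann_zero_unique:
  assumes c: "c2_end z \<noteq> 0" and u: "integral_pair b R1 R2 u1 u2 (\<lambda>t. z * u1 t)" "u2 0 = 0" "(u2 \<longlongrightarrow> 0) (at_end b)"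
    and x: "x \<in> Ico0 b"
  shows "u1 x = 0"
proof -
  let ?k = "u1 0"
  have p: "integral_pair b R1 R2 (\<lambda>x. 1 * u1 x + - ?k * c1_sol b R1 R2 x z) (\<lambda>x. 1 * u2 x + - ?k * c2_sol b R1 R2 x z)
      (\<lambda>t. z * (1 * u1 t + - ?k * c1_sol b R1 R2 t z))"
    using integral_pair_combine[OF u(1) c_sol(1), of 1 "- ?k" z] by (simp add: algebra_simps)
  have eq1: "u1 x = ?k * c1_sol b R1 R2 x z" if "x \<in> Ico0 b" for x
    using homogeneous_unique[OF p _ _ that] u(2) by (simp add: c_sol)
  have "u2 x = ?k * c2_sol b R1 R2 x z" if y: "x \<in> Ico0 b" for x
  proof -
    have "cum \<mu>2 (\<lambda>t. z * u1 t) x = cum \<mu>2 (\<lambda>t. ?k * (z * c1_sol b R1 R2 t z)) x"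
      by (rule S2.cum_cong[OF y]) (subst eq1, simp_all add: mult_ac)
    then show ?thesis using integral_pairD(4)[OF u(1) y] integral_pairD(4)[OF c_sol(1) y] u(2)
      by (simp add: S2.cum_scale c_sol)
  qed
  then have "eventually (\<lambda>x. u2 x = ?k * c2_sol b R1 R2 x z) (at_end b)"
    using eventually_at_end_Ico0[OF b_pos] by (auto elim: eventually_mono)
  then have "((\<lambda>x. ?k * c2_sol b R1 R2 x z) \<longlongrightarrow> 0) (at_end b)"
    using u(3) by (simp add: tendsto_cong)
  moreover have "((\<lambda>x. ?k * c2_sol b R1 R2 x z) \<longlongrightarrow> ?k * c2_end z) (at_end b)"
    by (intro tendsto_intros c2_tendsto)
  ultimately have "?k * c2_end z = 0" using tendsto_unique[OF at_end_neq_bot[OF b_pos]] by metis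
  then have "?k = 0" using c by simp
  with eq1[OF x] show ?thesis by simp
qed

lemma neumann_solution_multiple:
  assumes c: "c2_end z \<noteq> 0" and u: "integral_pair b R1 R2 u1 u2 (\<lambda>t. z * u1 t)" "(u2 \<longlongrightarrow> 0) (at_end b)"
    and x: "x \<in> Ico0 b"
  shows "u1 x = u2 0 * psi1 z x"
proof -
  have p: "integral_pair b R1 R2 (\<lambda>x. 1 * u1 x + - u2 0 * psi1 z x) (\<lambda>x. 1 * u2 x + - u2 0 * psi2 z x)
      (\<lambda>t. z * (1 * u1 t + - u2 0 * psi1 z t))"
    using integral_pair_combine[OF u(1) psi(1), of 1 "- u2 0" z] by (simp add: algebra_simps)
  have "((\<lambda>x. 1 * u2 x + - u2 0 * psi2 z x) \<longlongrightarrow> 1 * 0 + - u2 0 * 0) (at_end b)"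
    by (intro tendsto_intros u psi c)
  then show ?thesis
    using neumann_zero_unique[OF c p _ _ x] by (simp add: psi)
qed

lemma psi_class_nonzero: "cls (\<lambda>x. a * psi1 z x) = cls (\<lambda>x. 0) \<Longrightarrow> a = 0"
proof -
  have p: "integral_pair b R1 R2 (\<lambda>x. a * psi1 z x) (\<lambda>x. a * psi2 z x) (\<lambda>t. z * (a * psi1 z t))"
    using integral_pair_combine[OF psi(1) psi(1), of a z 0 z] by (simp add: algebra_simps)
  assume "cls (\<lambda>x. a * psi1 z x) = cls (\<lambda>x. 0)"
  from homogeneous_zero_class(2)[OF p this] show "a = 0" by (simp add: psi)
qed

lemma ker_T_star:
  assumes c: "c2_end z \<noteq> 0"
  shows "ker_rel H (shift_rel H T_star z) = {cls (\<lambda>x. a * psi1 z x) | a. True}"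
proof (intro equalityI subsetI)
  fix X assume "X \<in> ker_rel H (shift_rel H T_star z)"
  then obtain u1 u2 where u: "X = cls u1" "u1 \<in> L2_fun \<mu>2" "integral_pair b R1 R2 u1 u2 (\<lambda>t. z * u1 t)" "(u2 \<longlongrightarrow> 0) (at_end b)"
    unfolding T_star_def ker_relation by blast
  have "cls u1 = cls (\<lambda>x. u2 0 * psi1 z x)"
    by (rule L2_class_cong[OF u(2) L2_fun_scale[OF psi_L2]]) (use neumann_solution_multiple[OF c u(3,4)] in simp)
  then show "X \<in> {cls (\<lambda>x. a * psi1 z x) | a. True}" using u by blast
next
  fix X assume "X \<in> {cls (\<lambda>x. a * psi1 z x) | a. True}"
  then obtain a where a: "X = cls (\<lambda>x. a * psi1 z x)" by blast
  have p: "integral_pair b R1 R2 (\<lambda>x. a * psi1 z x) (\<lambda>x. a * psi2 z x) (\<lambda>t. z * (a * psi1 z t))"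
    using integral_pair_combine[OF psi(1) psi(1), of a z 0 z] by (simp add: algebra_simps)
  moreover have "((\<lambda>x. a * psi2 z x) \<longlongrightarrow> a * 0) (at_end b)" by (intro tendsto_intros psi c)
  ultimately show "X \<in> ker_rel H (shift_rel H T_star z)"
    unfolding T_star_def ker_relation a using L2_fun_scale[OF psi_L2, of a] by auto
qed

lemma deficiency_T_N: "deficiency_indices H (T_N b R1 R2) 1 1"
proof -
  have "has_dim H (ker_rel H (shift_rel H T_star z)) 1" if "z \<notin> \<real>\<^sub>\<ge>\<^sub>0" for z
    unfolding has_dim_def
  proof (intro exI conjI)
    note c = c2_end_nonzero[OF that]
    have lc: "lincomb H [a] [cls (psi1 z)] = cls (\<lambda>x. a * psi1 z x)" for a
      by (rule lincomb_single[OF psi_L2])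
    show "length [cls (psi1 z)] = 1" by simp
    show "set [cls (psi1 z)] \<subseteq> ker_rel H (shift_rel H T_star z)"
      unfolding ker_T_star[OF c] by (auto intro!: exI[of _ 1])
    show "lin_indep H [cls (psi1 z)]"
      unfolding lin_indep_def
    proof (intro allI impI)
      fix as assume "length as = length [cls (psi1 z)]" and 0: "lincomb H as [cls (psi1 z)] = Zero H"
      then obtain a where a: "as = [a]" by (cases as) auto
      have "cls (\<lambda>x. a * psi1 z x) = cls (\<lambda>x. 0)" using 0 by (simp only: a lc Zero_L2)
      from psi_class_nonzero[OF this] show "\<forall>a\<in>set as. a = 0" by (simp add: a)
    qed
    show "ker_rel H (shift_rel H T_star z) = {lincomb H as [cls (psi1 z)] |as. length as = 1}"
      unfolding ker_T_star[OF c]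
    proof (intro equalityI subsetI)
      fix X assume "X \<in> {cls (\<lambda>x. a * psi1 z x) | a. True}"
      then obtain a where "X = lincomb H [a] [cls (psi1 z)]" using lc by auto
      then show "X \<in> {lincomb H as [cls (psi1 z)] |as. length as = 1}"
        by (intro CollectI exI[of _ "[a]"]) simp
    next
      fix X assume "X \<in> {lincomb H as [cls (psi1 z)] |as. length as = 1}"
      then obtain as where as: "X = lincomb H as [cls (psi1 z)]" "length as = 1" by blast
      then obtain a where "as = [a]" by (cases as) auto
      with as lc show "X \<in> {cls (\<lambda>x. a * psi1 z x) | a. True}" by auto
    qed
  qed
  moreover have "\<i> \<notin> \<real>\<^sub>\<ge>\<^sub>0" "- \<i> \<notin> \<real>\<^sub>\<ge>\<^sub>0" by (simp_all add: complex_nonneg_Reals_iff)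
  ultimately show ?thesis unfolding deficiency_indices_def adjoint_T_N by blast
qed

text \<open>
  The defect elements are the multiples of \<open>\<psi>\<close>, and \<open>\<psi>\<close> has the boundary values \<open>\<Gamma>\<^sub>0 = 1\<close> and
  \<open>\<Gamma>\<^sub>1 = m\<close>.
\<close>

lemma m_N_eq:
  assumes c: "c2_end z \<noteq> 0"
  shows "m_N b R1 R2 z = neumann_coefficient z"
  unfolding m_N_def weyl_function_def
proof (rule the_equality, intro allI impI)
  fix U assume U: "(U, Scale H z U) \<in> adjoint_rel H (T_N b R1 R2)"
  then obtain u1 u2 f where u: "U = cls u1" "Scale H z U = cls f" "f \<in> L2_fun \<mu>2" "u1 \<in> L2_fun \<mu>2"
    "integral_pair b R1 R2 u1 u2 f" "(u2 \<longlongrightarrow> 0) (at_end b)" by (rule T_starE)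
  have "cls f = cls (\<lambda>x. z * u1 x)" using u(2) unfolding u(1) L2_ops_class(2)[OF u(4) u(4)] by simp
  then have "AE x in \<mu>2. f x = z * u1 x" by (simp add: L2_class_eq_iff u L2_fun_scale)
  then have p: "integral_pair b R1 R2 u1 u2 (\<lambda>x. z * u1 x)"
    by (intro integral_pair_AE[OF u(5)] L2_fun_measurable L2_fun_scale u)
  have "u1 0 = - u2 0 * neumann_coefficient z"
    using neumann_solution_multiple[OF c p u(6) Ico0_zero[OF b_pos]] by (simp add: psi)
  then show "neumann_coefficient z * Gamma0_N b R1 R2 (U, Scale H z U) = Gamma1_N b R1 R2 (U, Scale H z U)"
    unfolding u(2) unfolding u(1) Gamma_N[OF u(5,3)] by simp
next
  fix m assume m: "\<forall>U. (U, Scale H z U) \<in> adjoint_rel H (T_N b R1 R2) \<longrightarrow>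
    m * Gamma0_N b R1 R2 (U, Scale H z U) = Gamma1_N b R1 R2 (U, Scale H z U)"
  let ?U = "cls (psi1 z)"
  have S: "Scale H z ?U = cls (\<lambda>x. z * psi1 z x)" by (rule L2_ops_class(2)[OF psi_L2 psi_L2])
  have "(?U, Scale H z ?U) \<in> adjoint_rel H (T_N b R1 R2)"
    unfolding adjoint_T_N T_star_def S
    by (rule relationI[where ?u2.0 = "psi2 z"]) (intro L2_fun_scale psi_L2 psi c)+
  with m have "m * Gamma0_N b R1 R2 (?U, Scale H z ?U) = Gamma1_N b R1 R2 (?U, Scale H z ?U)" by blast
  then show "m = neumann_coefficient z"
    unfolding S Gamma_N[OF psi(1) L2_fun_scale[OF psi_L2]] by (simp add: psi)
qed

subsection \<open>The resolvent set of the Neumann extension\<close>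

lemma ker_Gamma0:
  "ker_bdry H (T_N b R1 R2) (Gamma0_N b R1 R2) = relation (\<lambda>u1 u2. (u2 \<longlongrightarrow> 0) (at_end b) \<and> u2 0 = 0)"
proof (intro equalityI subsetI)
  fix w assume w: "w \<in> ker_bdry H (T_N b R1 R2) (Gamma0_N b R1 R2)"
  obtain U F where UF: "w = (U, F)" by (cases w)
  with w have "(U, F) \<in> adjoint_rel H (T_N b R1 R2)" "Gamma0_N b R1 R2 (U, F) = 0" by (auto simp: ker_bdry_def)
  then obtain u1 u2 f where u: "U = cls u1" "F = cls f" "f \<in> L2_fun \<mu>2" "u1 \<in> L2_fun \<mu>2"
    "integral_pair b R1 R2 u1 u2 f" "(u2 \<longlongrightarrow> 0) (at_end b)" by (elim T_starE)
  then have "u2 0 = 0" using \<open>Gamma0_N b R1 R2 (U, F) = 0\<close> Gamma_N(1)[OF u(5,3)] by simp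
  then show "w \<in> relation (\<lambda>u1 u2. (u2 \<longlongrightarrow> 0) (at_end b) \<and> u2 0 = 0)"
    unfolding UF u(1,2) by (intro relationI[where ?u2.0 = u2] u conjI)
next
  fix w assume w: "w \<in> relation (\<lambda>u1 u2. (u2 \<longlongrightarrow> 0) (at_end b) \<and> u2 0 = 0)"
  obtain U F where UF: "w = (U, F)" by (cases w)
  with w obtain u1 u2 f where u: "U = cls u1" "F = cls f" "f \<in> L2_fun \<mu>2" "u1 \<in> L2_fun \<mu>2"
    "integral_pair b R1 R2 u1 u2 f" "(u2 \<longlongrightarrow> 0) (at_end b) \<and> u2 0 = 0" by (auto elim: relationE)
  have "(U, F) \<in> T_star" unfolding T_star_def u(1,2) by (rule relationI[where ?u2.0 = u2]) (use u in auto)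
  moreover have "Gamma0_N b R1 R2 (U, F) = 0" unfolding u(1,2) Gamma_N[OF u(5,3)] using u by simp
  ultimately show "w \<in> ker_bdry H (T_N b R1 R2) (Gamma0_N b R1 R2)"
    unfolding ker_bdry_def adjoint_T_N UF by simp
qed

abbreviation "A0 \<equiv> ker_bdry H (T_N b R1 R2) (Gamma0_N b R1 R2)"

lemma shift_A0E:
  assumes "(U, cls g) \<in> shift_rel H A0 z" "g \<in> L2_fun \<mu>2"
  obtains u1 u2 where "U = cls u1" "u1 \<in> L2_fun \<mu>2" "integral_pair b R1 R2 u1 u2 (\<lambda>t. z * u1 t + g t)"
    "(u2 \<longlongrightarrow> 0) (at_end b)" "u2 0 = 0"
  using assms unfolding ker_Gamma0 by (elim shift_relationE) auto

lemma resolvent_c2_end: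
  assumes z: "z \<in> resolvent_set H A0"
  shows "c2_end z \<noteq> 0"
proof
  assume 0: "c2_end z = 0"
  let ?c1 = "\<lambda>x. c1_sol b R1 R2 x z" and ?c2 = "\<lambda>x. c2_sol b R1 R2 x z"
  have lim: "(?c2 \<longlongrightarrow> 0) (at_end b)" using c2_tendsto[of z] 0 by simp
  have "(cls ?c1, cls (\<lambda>x. 0)) \<in> shift_rel H A0 z" unfolding ker_Gamma0
    by (rule shift_relationI[where ?u2.0 = ?c2]) (use lim c_sol[of z] c_L2 zero_L2_fun in auto)
  moreover have "(cls (\<lambda>x. 0), cls (\<lambda>x. 0)) \<in> shift_rel H A0 z" unfolding ker_Gamma0
    by (rule shift_relationI[where ?u2.0 = "\<lambda>x. 0"]) (use zero_pair zero_L2_fun in auto)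
  moreover have "cls (\<lambda>x. 0) \<in> Carrier H" using zero_L2_fun by (auto simp: Carrier_L2)
  ultimately have "cls ?c1 = cls (\<lambda>x. 0)" using z unfolding resolvent_set_def by blast
  from homogeneous_zero_class(1)[OF c_sol(1) this] show False by (simp add: c_sol)
qed

text \<open>
  Any solution of the inhomogeneous system with \<open>u\<^sub>2(0) = 0\<close> is corrected by a multiple of \<open>c\<close>, which
  keeps that condition and moves the value at \<open>b\<close>.
\<close>

lemma resolvent_solution_exists:
  assumes c: "c2_end z \<noteq> 0" and g: "g \<in> L2_fun \<mu>2"
  shows "\<exists>U. (U, cls g) \<in> shift_rel H A0 z"
proof -
  obtain u1 u2 where u: "integral_pair b R1 R2 u1 u2 (\<lambda>t. z * u1 t + g t)" "u1 0 = 0" "u2 0 = 0"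
    and uL: "u1 \<in> L2_fun \<mu>2"
    using solution_exists[OF g] by blast
  let ?c1 = "\<lambda>x. c1_sol b R1 R2 x z" and ?c2 = "\<lambda>x. c2_sol b R1 R2 x z"

  have fL: "(\<lambda>t. z * u1 t + g t) \<in> L2_fun \<mu>2" by (intro L2_fun_add L2_fun_scale uL g)
  obtain l where l: "(u2 \<longlongrightarrow> l) (at_end b)" using u2_tendsto[OF u(1) fL] by blast
  \<comment> \<open>chosen so that the value of the second component at \<open>b\<close> becomes zero\<close>
  define k where "k = - l / c2_end z"
  have p: "integral_pair b R1 R2 (\<lambda>x. 1 * u1 x + k * ?c1 x) (\<lambda>x. 1 * u2 x + k * ?c2 x)
     (\<lambda>t. z * (1 * u1 t + k * ?c1 t) + g t)"
    using integral_pair_combine[OF u(1) c_sol(1), of 1 k z] by (simp add: algebra_simps)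
  have "((\<lambda>x. 1 * u2 x + k * ?c2 x) \<longlongrightarrow> 1 * l + k * c2_end z) (at_end b)"
    by (intro tendsto_intros l c2_tendsto)
  then have "((\<lambda>x. 1 * u2 x + k * ?c2 x) \<longlongrightarrow> 0) (at_end b)" using c by (simp add: k_def)
  then have "(cls (\<lambda>x. 1 * u1 x + k * ?c1 x), cls g) \<in> shift_rel H A0 z" unfolding ker_Gamma0
    by (intro shift_relationI[OF p _ _ g] L2_fun_add L2_fun_scale uL c_L2) (simp add: u c_sol)
  then show ?thesis by blast
qed

lemma resolvent_solution_unique:
  assumes c: "c2_end z \<noteq> 0" and g: "g \<in> L2_fun \<mu>2"
    and U: "(U, cls g) \<in> shift_rel H A0 z" and V: "(V, cls g) \<in> shift_rel H A0 z"
  shows "U = V"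
proof -
  obtain u1 u2 where u: "U = cls u1" "u1 \<in> L2_fun \<mu>2" "integral_pair b R1 R2 u1 u2 (\<lambda>t. z * u1 t + g t)"
    "(u2 \<longlongrightarrow> 0) (at_end b)" "u2 0 = 0" by (rule shift_A0E[OF U g])
  obtain v1 v2 where v: "V = cls v1" "v1 \<in> L2_fun \<mu>2" "integral_pair b R1 R2 v1 v2 (\<lambda>t. z * v1 t + g t)"
    "(v2 \<longlongrightarrow> 0) (at_end b)" "v2 0 = 0" by (rule shift_A0E[OF V g])
  have p: "integral_pair b R1 R2 (\<lambda>x. 1 * u1 x + - 1 * v1 x) (\<lambda>x. 1 * u2 x + - 1 * v2 x)
     (\<lambda>t. z * (1 * u1 t + - 1 * v1 t))"
    using integral_pair_combine[OF u(3) v(3), of 1 "- 1"] by (simp add: algebra_simps)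
  have "((\<lambda>x. 1 * u2 x + - 1 * v2 x) \<longlongrightarrow> 1 * 0 + - 1 * 0) (at_end b)"
    by (intro tendsto_intros u v)
  then have "u1 x = v1 x" if "x \<in> Ico0 b" for x
    using neumann_zero_unique[OF c p _ _ that] u v by simp
  then show ?thesis unfolding u(1) v(1) by (intro L2_class_cong u v) simp
qed

text \<open>
  For \<open>g = f - z u\<close> the inner product with \<open>u\<close> is the Dirichlet form of \<open>u\<close> minus \<open>z\<close> times its
  squared norm, and the modulus of this difference is at least a multiple of the squared norm.
\<close>

lemma resolvent_bound:
  assumes z: "z \<notin> \<real>\<^sub>\<ge>\<^sub>0"
  shows "\<exists>K. \<forall>(U, G)\<in>shift_rel H A0 z. sqrt (Re (Inner H U U)) \<le> K * sqrt (Re (Inner H G G))"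
proof -
  obtain d where d: "0 < d" "\<And>D N. 0 \<le> D \<Longrightarrow> 0 \<le> N \<Longrightarrow> d * N \<le> cmod (complex_of_real D - z * complex_of_real N)"
    using dist_nonneg_axis[OF z] by blast
  have "sqrt (Re (Inner H U U)) \<le> 1 / d * sqrt (Re (Inner H G G))" if UG: "(U, G) \<in> shift_rel H A0 z" for U G
  proof -
    obtain F where F: "(U, F) \<in> A0" "G = Add H F (Scale H (- z) U)" using UG by (auto simp: shift_rel_def)
    from F(1) obtain u1 u2 f where u: "U = cls u1" "F = cls f" "f \<in> L2_fun \<mu>2" "u1 \<in> L2_fun \<mu>2"
      "integral_pair b R1 R2 u1 u2 f" "(u2 \<longlongrightarrow> 0) (at_end b) \<and> u2 0 = 0" unfolding ker_Gamma0 by (rule relationE)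
    define g where "g t = f t + - z * u1 t" for t
    have G: "G = cls g"
      unfolding F(2) u(1,2) L2_ops_class(2)[OF u(4) u(4)] L2_ops_class(1)[OF u(3) L2_fun_scale[OF u(4)]] g_def ..
    have gL: "g \<in> L2_fun \<mu>2" unfolding g_def[abs_def] by (intro L2_fun_add L2_fun_scale u)
    let ?N = "\<integral>t. (cmod (u1 t))\<^sup>2 \<partial>\<mu>2" and ?G = "\<integral>t. (cmod (g t))\<^sup>2 \<partial>\<mu>2"
    have "(\<integral>t. g t * cnj (u1 t) \<partial>\<mu>2) = (\<integral>t. f t * cnj (u1 t) - z * (u1 t * cnj (u1 t)) \<partial>\<mu>2)"
      by (intro Bochner_Integration.integral_cong refl) (simp add: g_def algebra_simps)
    also have "\<dots> = (\<integral>t. f t * cnj (u1 t) \<partial>\<mu>2) - z * (\<integral>t. u1 t * cnj (u1 t) \<partial>\<mu>2)"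
      using L2_fun_mult_integrable[OF u(3) L2_fun_cnj[OF u(4)]] L2_fun_mult_integrable[OF u(4) L2_fun_cnj[OF u(4)]]
      by simp
    also have "\<dots> = complex_of_real (dirichlet u2) - z * complex_of_real ?N"
      unfolding integral_norm_square using Inner_dirichlet[OF u(5,3)] u(6) by simp
    finally have "d * ?N \<le> cmod (\<integral>t. g t * cnj (u1 t) \<partial>\<mu>2)"
      using d(2)[of "dirichlet u2" ?N] dirichlet(3)[OF u(5,3)] u(6) by simp
    also have "2 * \<dots> = 2 * cmod (\<integral>t. cnj (u1 t) * g t \<partial>\<mu>2)" by (simp only: mult.commute)
    also have "\<dots> \<le> d * ?N + ?G / d"
      using L2_AM_GM[OF L2_fun_cnj[OF u(4)] gL d(1)] by simp
    finally have "?N \<le> ?G / d\<^sup>2" using d(1) by (simp add: field_simps power2_eq_square)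
    then have "sqrt ?N \<le> sqrt (?G / d\<^sup>2)" by (rule real_sqrt_le_mono)
    also have "\<dots> = 1 / d * sqrt ?G" using d(1) by (simp add: real_sqrt_divide)
    finally show ?thesis
      unfolding u(1) G Inner_cls[OF u(4) u(4)] Inner_cls[OF gL gL] integral_norm_square by simp
  qed
  then show ?thesis by blast
qed

lemma resolvent_A0:
  assumes z: "z \<notin> \<real>\<^sub>\<ge>\<^sub>0"
  shows "z \<in> resolvent_set H A0"
  unfolding resolvent_set_def
proof (intro CollectI conjI ballI resolvent_bound[OF z])
  note c = c2_end_nonzero[OF z]
  fix G assume "G \<in> Carrier H"
  then obtain g where g: "g \<in> L2_fun \<mu>2" "G = cls g" by (auto simp: Carrier_L2)
  then show "\<exists>!U. (U, G) \<in> shift_rel H A0 z"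
    using resolvent_solution_exists[OF c g(1)] resolvent_solution_unique[OF c g(1)] by blast
qed

text \<open>
  Divide numerator and denominator by \<open>R\<^sub>1\<close>: first components are asymptotic to the boundary value of
  the second one times \<open>R\<^sub>1\<close>.
\<close>

lemma titchmarsh_weyl_eq:
  assumes c: "c2_end z \<noteq> 0"
  shows "titchmarsh_weyl b R1 R2 z = neumann_coefficient z"
proof -
  let ?s = "\<lambda>x. s1_sol b R1 R2 x z / R1 x" and ?c = "\<lambda>x. c1_sol b R1 R2 x z / R1 x"
  have "((\<lambda>x. ?s x / ?c x) \<longlongrightarrow> s2_end z / c2_end z) (at_end b)"
    by (intro tendsto_divide c ratio_tendsto[OF s_sol(1) s2_tendsto R1_unbounded] ratio_tendsto[OF c_sol(1) c2_tendsto R1_unbounded])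
  moreover have "eventually (\<lambda>x. 1 \<le> R1 x) (at_end b)" using R1_unbounded by (simp add: filterlim_at_top)
  then have "eventually (\<lambda>x. ?s x / ?c x = s1_sol b R1 R2 x z / c1_sol b R1 R2 x z) (at_end b)"
    by eventually_elim auto
  ultimately have "((\<lambda>x. s1_sol b R1 R2 x z / c1_sol b R1 R2 x z) \<longlongrightarrow> s2_end z / c2_end z) (at_end b)"
    by (rule Lim_transform_eventually)
  then show ?thesis unfolding titchmarsh_weyl_def neumann_coefficient_def
    by (rule tendsto_Lim[OF at_end_neq_bot[OF b_pos]])
qed

end

section \<open>The Stieltjes class and the limits of the Weyl function\<close>

text \<open>
  The energy representation of a Weyl function: a Dirichlet form minus \<open>cnj z\<close> times a squared norm.
\<close>

lemma stieltjes_classI: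
  assumes "F holomorphic_on (- \<real>\<^sub>\<ge>\<^sub>0)" and "\<And>z. z \<notin> \<real> \<Longrightarrow> F (cnj z) = cnj (F z)"
    and repr: "\<And>z. z \<notin> \<real>\<^sub>\<ge>\<^sub>0 \<Longrightarrow> \<exists>D\<ge>0. \<exists>N\<ge>0. F z = complex_of_real D - cnj z * complex_of_real N"
  shows "F \<in> stieltjes_class"
  unfolding stieltjes_class_def
proof (intro CollectI conjI allI impI assms)
  fix z :: complex assume z: "0 < Im z"
  then have "z \<notin> \<real>\<^sub>\<ge>\<^sub>0" by (auto simp: complex_nonneg_Reals_iff)
  then obtain D N where "0 \<le> N" "F z = complex_of_real D - cnj z * complex_of_real N"
    using repr by blast
  then show "0 \<le> Im (F z)" using z by simp
next
  fix x :: real assume x: "x < 0"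
  then have "complex_of_real x \<notin> \<real>\<^sub>\<ge>\<^sub>0" by simp
  then obtain D N where DN: "0 \<le> D" "0 \<le> N" "F (complex_of_real x) = complex_of_real D - cnj (complex_of_real x) * complex_of_real N"
    using repr by blast
  then have "F (complex_of_real x) = complex_of_real (D - x * N)" by simp
  moreover have "0 \<le> D - x * N" using DN x by (simp add: mult_nonpos_nonneg order_trans[of _ 0])
  ultimately show "F (complex_of_real x) \<in> \<real>\<^sub>\<ge>\<^sub>0" by (simp only: nonneg_Reals_of_real_iff)
qed

context singular_limit_circle
begin

definition "psi_dirichlet z = dirichlet (psi2 z)"
definition "psi_norm z = (\<integral>t. (cmod (psi1 z t))\<^sup>2 \<partial>\<mu>2)"

lemma psi_norm_nonneg: "0 \<le> psi_norm z"
  by (simp add: psi_norm_def)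

lemma psi_dirichlet_nonneg: "c2_end z \<noteq> 0 \<Longrightarrow> 0 \<le> psi_dirichlet z"
  unfolding psi_dirichlet_def by (rule dirichlet(3)[OF psi(1) L2_fun_scale[OF psi_L2] psi(4)])

text \<open>
  The energy of \<open>\<psi>\<close> with its own conjugate: here \<open>f = z \<psi>\<^sub>1\<close> and the boundary term at \<open>0\<close> is \<open>m\<close>.
\<close>

lemma neumann_coefficient_energy:
  assumes c: "c2_end z \<noteq> 0"
  shows "neumann_coefficient z = complex_of_real (psi_dirichlet z) - cnj z * complex_of_real (psi_norm z)"
proof -
  have "(\<integral>t. psi1 z t * cnj (z * psi1 z t) \<partial>\<mu>2) = (\<integral>t. cnj z * (psi1 z t * cnj (psi1 z t)) \<partial>\<mu>2)"
    by (intro Bochner_Integration.integral_cong refl) simp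
  also have "\<dots> = cnj z * complex_of_real (psi_norm z)"
    unfolding psi_norm_def integral_norm_square[symmetric] by (rule integral_mult_right_zero)
  finally show ?thesis
    using dirichlet(1)[OF psi(1) L2_fun_scale[OF psi_L2] psi(4)[OF c]]
    by (simp add: psi_dirichlet_def psi)
qed

text \<open>
  The Neumann condition fixes the mean of \<open>\<psi>\<^sub>1\<close> to be \<open>1 / (z R\<^sub>2(b))\<close>; its part orthogonal to the
  constants contributes a nonnegative amount to the norm.
\<close>

lemma psi_norm_ge:
  assumes c: "c2_end z \<noteq> 0" and z: "z \<noteq> 0"
  shows "1 / ((cmod z)\<^sup>2 * mass) \<le> psi_norm z"
proof -
  have "1 = z * (\<integral>t. psi1 z t \<partial>\<mu>2)"
    using u2_tendsto_0_iff[OF psi(1) L2_fun_scale[OF psi_L2]] psi(3,4)[of z] c by simp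
  then have mean: "(\<integral>t. psi1 z t \<partial>\<mu>2) = 1 / z" using z by (simp add: field_simps)
  \<comment> \<open>the mean value of \<open>\<psi>\<^sub>1\<close>, so that \<open>f\<close> is the part of \<open>\<psi>\<^sub>1\<close> orthogonal to the constants\<close>
  define k where "k = 1 / (z * complex_of_real mass)"
  define f where "f t = psi1 z t + - k * 1" for t
  have fL: "f \<in> L2_fun \<mu>2" unfolding f_def[abs_def] by (intro L2_fun_add L2_fun_scale psi_L2 one_L2)
  note i = L2_integrable[OF psi_L2[of z]]
  have i2: "integrable \<mu>2 (\<lambda>t. psi1 z t * cnj (psi1 z t))" by (intro L2_fun_mult_integrable L2_fun_cnj psi_L2)
  have "complex_of_real (\<integral>t. (cmod (f t))\<^sup>2 \<partial>\<mu>2) = (\<integral>t. f t * cnj (f t) \<partial>\<mu>2)"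
    by (rule integral_norm_square[symmetric])
  also have "\<dots> = (\<integral>t. psi1 z t * cnj (psi1 z t) - cnj k * psi1 z t - k * cnj (psi1 z t) + k * cnj k \<partial>\<mu>2)"
    by (intro Bochner_Integration.integral_cong refl) (simp add: f_def algebra_simps)
  also have "\<dots> = complex_of_real (psi_norm z) - cnj k * (1 / z) - k * cnj (1 / z) + k * cnj k * mass"
    using i i2 by (simp add: integral_norm_square psi_norm_def[symmetric] mean scaleR_conv_of_real mult_ac del: of_real_power)
  also have "\<dots> = complex_of_real (psi_norm z) - complex_of_real (1 / ((cmod z)\<^sup>2 * mass))"
  proof -
    have "complex_of_real ((cmod z)\<^sup>2) = z * cnj z" by (rule complex_norm_square)
    then have "complex_of_real (1 / ((cmod z)\<^sup>2 * mass)) = 1 / (z * cnj z * mass)" by (simp only: of_real_divide of_real_mult of_real_1)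
    then show ?thesis using z mass_pos by (simp add: k_def field_simps)
  qed
  finally have "(\<integral>t. (cmod (f t))\<^sup>2 \<partial>\<mu>2) = psi_norm z - 1 / ((cmod z)\<^sup>2 * mass)"
    by (simp only: of_real_diff[symmetric] of_real_eq_iff)
  moreover have "0 \<le> (\<integral>t. (cmod (f t))\<^sup>2 \<partial>\<mu>2)" by simp
  ultimately show ?thesis by simp
qed

lemma integrals_holomorphic:
  "c_integral holomorphic_on A" "s_integral holomorphic_on A"
  unfolding c_integral_def[abs_def] s_integral_def[abs_def]
  by (rule integral_homogeneous_holomorphic[OF c_sol], rule integral_homogeneous_holomorphic[OF s_sol])

lemma ends_holomorphic: "c2_end holomorphic_on A" "s2_end holomorphic_on A"
  unfolding c2_end_def[abs_def] s2_end_def[abs_def] by (intro holomorphic_intros integrals_holomorphic)+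

lemma ends_cnj: "c2_end (cnj z) = cnj (c2_end z)" "s2_end (cnj z) = cnj (s2_end z)"
proof -
  have eq: "u1 x = cnj (v1 x)"
    if u: "integral_pair b R1 R2 u1 u2 (\<lambda>t. cnj z * u1 t)" and v: "integral_pair b R1 R2 v1 v2 (\<lambda>t. z * v1 t)"
    and 0: "u1 0 = cnj (v1 0)" "u2 0 = cnj (v2 0)" and x: "x \<in> Ico0 b" for u1 u2 v1 v2 x
  proof (rule solution_unique(1)[OF _ _ _ _ x])
    show "integral_pair b R1 R2 u1 u2 (\<lambda>t. cnj z * u1 t + 0)" using u by simp
    show "integral_pair b R1 R2 (\<lambda>x. cnj (v1 x)) (\<lambda>x. cnj (v2 x)) (\<lambda>t. cnj z * cnj (v1 t) + 0)"
      using integral_pair_cnj[OF v] by simp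
  qed (use 0 in auto)
  have "c_integral (cnj z) = (\<integral>t. cnj (c1_sol b R1 R2 t z) \<partial>\<mu>2)" unfolding c_integral_def
    by (rule Bochner_Integration.integral_cong[OF refl], rule eq[OF c_sol(1) c_sol(1)]) (simp_all add: c_sol)
  then show "c2_end (cnj z) = cnj (c2_end z)" by (simp add: c2_end_def c_integral_def)
  have "s_integral (cnj z) = (\<integral>t. cnj (s1_sol b R1 R2 t z) \<partial>\<mu>2)" unfolding s_integral_def
    by (rule Bochner_Integration.integral_cong[OF refl], rule eq[OF s_sol(1) s_sol(1)]) (simp_all add: s_sol)
  then show "s2_end (cnj z) = cnj (s2_end z)" by (simp add: s2_end_def s_integral_def)
qed

lemma m_N_eq': "z \<notin> \<real>\<^sub>\<ge>\<^sub>0 \<Longrightarrow> m_N b R1 R2 z = neumann_coefficient z"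
  by (intro m_N_eq c2_end_nonzero)

lemma m_N_holomorphic: "m_N b R1 R2 holomorphic_on (- \<real>\<^sub>\<ge>\<^sub>0)"
proof -
  have "(\<lambda>z. s2_end z / c2_end z) holomorphic_on (- \<real>\<^sub>\<ge>\<^sub>0)"
    by (intro holomorphic_intros ends_holomorphic) (use c2_end_nonzero in auto)
  then show ?thesis
    by (rule holomorphic_transform) (simp add: m_N_eq' neumann_coefficient_def)
qed

lemma m_N_cnj: "z \<notin> \<real> \<Longrightarrow> m_N b R1 R2 (cnj z) = cnj (m_N b R1 R2 z)"
proof -
  assume "z \<notin> \<real>"
  then have "z \<notin> \<real>\<^sub>\<ge>\<^sub>0" "cnj z \<notin> \<real>\<^sub>\<ge>\<^sub>0" by (auto simp: complex_is_Real_iff complex_nonneg_Reals_iff)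
  then show ?thesis by (simp add: m_N_eq' neumann_coefficient_def ends_cnj)
qed

lemma m_N_stieltjes: "m_N b R1 R2 \<in> stieltjes_class"
proof (rule stieltjes_classI[OF m_N_holomorphic m_N_cnj])
  fix z :: complex assume z: "z \<notin> \<real>\<^sub>\<ge>\<^sub>0"
  note c = c2_end_nonzero[OF z]
  show "\<exists>D\<ge>0. \<exists>N\<ge>0. m_N b R1 R2 z = complex_of_real D - cnj z * complex_of_real N"
    using neumann_coefficient_energy[OF c] psi_dirichlet_nonneg[OF c] psi_norm_nonneg[of z] m_N_eq'[OF z] by metis
qed

definition "m_reduced z = m_N b R1 R2 z + 1 / (complex_of_real mass * z)"

lemma m_reduced_stieltjes: "m_reduced \<in> stieltjes_class"
proof (rule stieltjes_classI)
  show "m_reduced holomorphic_on - \<real>\<^sub>\<ge>\<^sub>0"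
    unfolding m_reduced_def[abs_def] using mass_pos
    by (intro holomorphic_intros m_N_holomorphic) auto
  show "m_reduced (cnj z) = cnj (m_reduced z)" if "z \<notin> \<real>" for z
    by (simp add: m_reduced_def m_N_cnj that)
  fix z :: complex assume z: "z \<notin> \<real>\<^sub>\<ge>\<^sub>0"
  note c = c2_end_nonzero[OF z]
  have z0: "z \<noteq> 0" using z by auto
  let ?N = "psi_norm z - 1 / ((cmod z)\<^sup>2 * mass)"
  have "complex_of_real ((cmod z)\<^sup>2) = z * cnj z" by (rule complex_norm_square)
  then have "cnj z * complex_of_real (1 / ((cmod z)\<^sup>2 * mass)) = cnj z * (1 / (z * cnj z * mass))" by (simp only: of_real_divide of_real_mult of_real_1)
  also have "\<dots> = 1 / (complex_of_real mass * z)" using z0 mass_pos by (simp add: field_simps)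
  finally have "m_reduced z = complex_of_real (psi_dirichlet z) - cnj z * complex_of_real ?N"
    using neumann_coefficient_energy[OF c] m_N_eq'[OF z] by (simp add: m_reduced_def algebra_simps del: of_real_divide of_real_mult)
  moreover have "0 \<le> ?N" using psi_norm_ge[OF c z0] by simp
  ultimately show "\<exists>D\<ge>0. \<exists>N\<ge>0. m_reduced z = complex_of_real D - cnj z * complex_of_real N"
    using psi_dirichlet_nonneg[OF c] by blast
qed

lemma c_integral_0: "c_integral 0 = complex_of_real mass"
proof -
  have 2: "c2_sol b R1 R2 x 0 = 0" if "x \<in> Ico0 b" for x
    using integral_pairD(4)[OF c_sol(1)[of 0] that] by (simp add: c_sol cum_def)
  have "c1_sol b R1 R2 x 0 = 1" if x: "x \<in> Ico0 b" for x
  proof -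
    have "cum \<mu>1 (\<lambda>x. c2_sol b R1 R2 x 0) x = cum \<mu>1 (\<lambda>x. 0) x" by (rule S1.cum_cong[OF x 2])
    then show ?thesis using integral_pairD(3)[OF c_sol(1)[of 0] x] by (simp add: c_sol cum_def)
  qed
  then have "c_integral 0 = (\<integral>t. 1 \<partial>\<mu>2)"
    unfolding c_integral_def by (intro Bochner_Integration.integral_cong refl) simp
  then show ?thesis by (simp add: scaleR_conv_of_real)
qed

text \<open>
  \<open>c\<^sub>2(b,z)\<close> has the factor \<open>-z\<close>, so \<open>z m(z)\<close> is \<open>-s\<^sub>2(b,z)\<close> divided by the integral of
  \<open>c\<^sub>1\<close>. At \<open>z = 0\<close> these are continuous with the values \<open>-1\<close> and \<open>R\<^sub>2(b)\<close>.
\<close>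

lemma m_reduced_tendsto:
  "((\<lambda>y::real. complex_of_real y * m_reduced (\<i> * complex_of_real y)) \<longlongrightarrow> 0) (at 0)"
proof -
  have cont: "isCont c_integral 0" "isCont s2_end 0"
    using integrals_holomorphic(1)[of UNIV] ends_holomorphic(2)[of UNIV]
    by (auto dest!: holomorphic_on_imp_continuous_on simp: continuous_on_eq_continuous_at)
  have lim0: "((\<lambda>y::real. \<i> * complex_of_real y) \<longlongrightarrow> 0) (at 0)"
    by (auto intro!: tendsto_eq_intros)
  have lim: "((\<lambda>y::real. - s2_end (\<i> * complex_of_real y) / (\<i> * c_integral (\<i> * complex_of_real y)) + 1 / (complex_of_real mass * \<i>))
     \<longlongrightarrow> - s2_end 0 / (\<i> * c_integral 0) + 1 / (complex_of_real mass * \<i>)) (at 0)"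
    using mass_pos by (intro tendsto_intros isCont_tendsto_compose[OF cont(1) lim0] isCont_tendsto_compose[OF cont(2) lim0])
      (simp add: c_integral_0)
  have limit_0: "- s2_end 0 / (\<i> * c_integral 0) + 1 / (complex_of_real mass * \<i>) = 0"
    by (simp add: c_integral_0 s2_end_def field_simps)
  have "eventually (\<lambda>y::real. - s2_end (\<i> * complex_of_real y) / (\<i> * c_integral (\<i> * complex_of_real y)) + 1 / (complex_of_real mass * \<i>)
     = complex_of_real y * m_reduced (\<i> * complex_of_real y)) (at 0)"
    unfolding eventually_at_filter
  proof (intro always_eventually allI impI)
    fix y :: real assume y: "y \<noteq> 0"
    then have z: "\<i> * complex_of_real y \<notin> \<real>\<^sub>\<ge>\<^sub>0" by (simp add: complex_nonneg_Reals_iff)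
    have "c_integral (\<i> * complex_of_real y) \<noteq> 0" using c2_end_nonzero[OF z] by (auto simp: c2_end_def)
    then show "- s2_end (\<i> * complex_of_real y) / (\<i> * c_integral (\<i> * complex_of_real y)) + 1 / (complex_of_real mass * \<i>)
     = complex_of_real y * m_reduced (\<i> * complex_of_real y)"
      using y mass_pos unfolding m_reduced_def m_N_eq'[OF z] neumann_coefficient_def c2_end_def
      by (simp add: field_simps)
  qed
  with lim[unfolded limit_0] show ?thesis by (rule Lim_transform_eventually)
qed

subsection \<open>The limit at minus infinity\<close>

definition "left_end = Inf (supp_dR b R2)"

lemma R2_pos_right_of_supp:
  assumes x: "x \<in> supp_dR b R2" and y: "y \<in> Ico0 b" "x < y"
  shows "0 < R2 y"
proof -
  have xI: "x \<in> Ico0 b" using x by (simp add: supp_dR_def)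
  have "0 < emeasure \<mu>2 (ball x (y - x) \<inter> Ico0 b)" using x y by (simp add: supp_dR_def)
  also have "\<dots> \<le> emeasure \<mu>2 {0..<y}"
    using y by (intro emeasure_mono S2.Ico_sets) (auto simp: dist_real_def Ico0_def)
  also have "\<dots> = ennreal (R2 y)" using S2.emeasure_Ico[OF y(1), of 0] y by (simp add: Ico0_nonneg S2.zero)
  finally show ?thesis by simp
qed

text \<open>
  The last zero \<open>s\<close> of \<open>R\<^sub>2\<close> before \<open>y\<close> is attained by left continuity, and every interval to the right
  of it has positive measure.
\<close>

lemma supp_left_of_R2_pos:
  assumes y: "y \<in> Ico0 b" "0 < R2 y"
  shows "\<exists>x\<in>supp_dR b R2. x < y"
proof -
  let ?Z = "{t \<in> {0..y}. R2 t = 0}"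
  define s where "s = Sup ?Z"
  have y0: "0 \<le> y" using y(1) by (rule Ico0_nonneg)
  have Z0: "0 \<in> ?Z" using y0 S2.zero by simp
  have bdd: "bdd_above ?Z" by (rule bdd_aboveI[of _ y]) auto
  have s0: "0 \<le> s" unfolding s_def by (rule cSup_upper[OF Z0 bdd])
  have sy: "s \<le> y" unfolding s_def using Z0 by (intro cSup_least) auto
  have sI: "s \<in> Ico0 b" by (rule Ico0_down[OF y(1) s0 sy])
  have below: "R2 t = 0" if t: "0 \<le> t" "t < s" for t
  proof -
    obtain w where w: "w \<in> ?Z" "t < w" using t(2) less_cSup_iff[of ?Z t] Z0 bdd unfolding s_def by blast
    then have wI: "w \<in> Ico0 b" using y(1) by (auto intro: Ico0_down)
    have "R2 t \<le> R2 w" using w t wI by (intro S2.mono Ico0_down[OF wI]) auto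
    then show ?thesis using w S2.nonneg[OF Ico0_down[OF wI t(1)]] by auto
  qed
  have Rs: "R2 s = 0"
  proof (cases "s = 0")
    case False
    then have pos: "0 < s" using s0 by simp
    have "(R2 \<longlongrightarrow> R2 s) (at_left s)"
      using R2 pos sI by (auto simp: stieltjes_integrator_def continuous_within)
    moreover have "eventually (\<lambda>t. R2 t = 0) (at_left s)"
      unfolding eventually_at_left[OF pos] using below by (intro exI[of _ 0]) (auto simp: pos)
    then have "(R2 \<longlongrightarrow> 0) (at_left s)" by (rule tendsto_eventually)
    ultimately show ?thesis by (rule tendsto_unique[OF trivial_limit_at_left_real])
  qed (simp add: S2.zero)
  have "s < y" using sy Rs y(2) by (cases "s = y") auto
  moreover have "s \<in> supp_dR b R2"
    unfolding supp_dR_def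
  proof (intro CollectI conjI sI allI impI)
    fix e :: real assume e: "0 < e"
    define w where "w = min y (s + e / 2)"
    have w: "s < w" "w \<le> y" "w < s + e" using \<open>s < y\<close> e by (auto simp: w_def)
    have wI: "w \<in> Ico0 b" using y(1) w s0 by (intro Ico0_down[OF y(1)]) auto
    have "R2 w \<noteq> 0"
    proof
      assume "R2 w = 0"
      then have "w \<le> s" unfolding s_def using w s0 by (intro cSup_upper bdd) auto
      then show False using w by simp
    qed
    then have "0 < ennreal (R2 w - R2 s)" using S2.nonneg[OF wI] Rs by simp
    also have "\<dots> = emeasure \<mu>2 {s..<w}" using S2.emeasure_Ico[OF wI s0] w by simp
    also have "\<dots> \<le> emeasure \<mu>2 (ball s e \<inter> Ico0 b)"
      using w s0 wI by (intro emeasure_mono S2.borel_Int_sets) (auto simp: dist_real_def intro: Ico0_down)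
    finally show "0 < emeasure \<mu>2 (ball s e \<inter> Ico0 b)" .
  qed
  ultimately show ?thesis by blast
qed

lemma left_end:
  shows "left_end \<in> Ico0 b" "R2 left_end = 0" "y \<in> Ico0 b \<Longrightarrow> left_end < y \<Longrightarrow> 0 < R2 y"
proof -
  have "\<exists>y\<in>Ico0 b. 0 < R2 y"
  proof -
    have "eventually (\<lambda>y. 0 < R2 y) (at_end b)"
      using S2.R_end_finite(2)[OF F2.finite_measure_axioms] mass_pos by (intro order_tendstoD)
    then show ?thesis unfolding eventually_at_end[OF b_pos] by blast
  qed
  then obtain y0 where "y0 \<in> Ico0 b" "0 < R2 y0" by blast
  from supp_left_of_R2_pos[OF this] obtain x0 where x0: "x0 \<in> supp_dR b R2" by blast
  have x0I: "x0 \<in> Ico0 b" using x0 by (simp add: supp_dR_def)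
  have bdd: "bdd_below (supp_dR b R2)" by (rule bdd_belowI[of _ 0]) (auto simp: supp_dR_def Ico0_def)
  have ne: "supp_dR b R2 \<noteq> {}" using x0 by blast
  have "0 \<le> left_end" unfolding left_end_def
    by (rule cInf_greatest[OF ne]) (simp add: supp_dR_def Ico0_def)
  moreover have "left_end \<le> x0" unfolding left_end_def by (rule cInf_lower[OF x0 bdd])
  ultimately show aI: "left_end \<in> Ico0 b" by (intro Ico0_down[OF x0I])
  show "R2 left_end = 0"
  proof (rule ccontr)
    assume "R2 left_end \<noteq> 0"
    then have "0 < R2 left_end" using S2.nonneg[OF aI] by simp
    then obtain x where x: "x \<in> supp_dR b R2" "x < left_end" using supp_left_of_R2_pos[OF aI] by blast
    then show False using cInf_lower[OF x(1) bdd] by (simp add: left_end_def)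
  qed
  assume y: "y \<in> Ico0 b" "left_end < y"
  then obtain x where "x \<in> supp_dR b R2" "x < y"
    using cInf_less_iff[of "supp_dR b R2" y] x0 bdd unfolding left_end_def by blast
  then show "0 < R2 y" using R2_pos_right_of_supp y by blast
qed

text \<open>
  Since \<open>\<psi>\<^sub>2 = 1\<close> up to the left end of the support, the Dirichlet form of \<open>\<psi>\<close> is at least the
  measure of that interval.
\<close>

lemma psi_dirichlet_ge:
  assumes c: "c2_end z \<noteq> 0"
  shows "R_plus R1 left_end \<le> psi_dirichlet z"
proof -
  let ?a = left_end
  obtain x where x: "x \<in> Ico0 b" "?a < x" by (rule Ico0_next[OF left_end(1)])
  have a0: "0 \<le> ?a" by (rule Ico0_nonneg[OF left_end(1)])
  have psi2: "psi2 z y = 1" if y: "0 \<le> y" "y \<le> ?a" for y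
  proof -
    have yI: "y \<in> Ico0 b" by (rule Ico0_down[OF left_end(1) y])
    have "R2 y = 0" using S2.mono[OF yI left_end(1) y(2)] S2.nonneg[OF yI] left_end(2) by simp
    then have "{0..<y} \<in> null_sets \<mu>2"
      using S2.emeasure_Ico[OF yI order_refl y(1)] yI S2.zero by (auto simp: null_sets_def)
    then have "AE t in \<mu>2. t \<notin> {0..<y}" by (rule AE_not_in)
    then have "cum \<mu>2 (\<lambda>t. z * psi1 z t) y = 0"
      unfolding cum_def set_lebesgue_integral_def
      by (intro integral_eq_zero_AE) (auto elim!: AE_mp simp: indicator_def)
    then show ?thesis using integral_pairD(4)[OF psi(1) yI] by (simp add: psi)
  qed
  have aS: "{0..?a} \<in> sets \<mu>1"
    using x by (intro S1.borel_sets) (auto intro: Ico0_down[OF left_end(1)])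
  have fin: "emeasure \<mu>1 {0..?a} < \<infinity>" using S1.emeasure_Icc[OF left_end(1)] by simp
  have "R_plus R1 ?a = measure \<mu>1 {0..?a}"
    using S1.emeasure_Icc[OF left_end(1)] S1.right_limit(3)[OF left_end(1)] S1.nonneg[OF left_end(1)]
    by (simp add: measure_def)
  also have "\<dots> = (\<integral>t. indicator {0..?a} t \<partial>\<mu>1)"
    using aS sets.sets_into_space[OF aS] by (simp add: Int_absorb2)
  also have "\<dots> \<le> (LINT t:{0..<x}|\<mu>1. (cmod (psi2 z t))\<^sup>2)"
    unfolding set_lebesgue_integral_def
  proof (rule integral_mono)
    show "integrable \<mu>1 (indicat_real {0..?a})" by (rule integrable_real_indicator[OF aS fin])
    show "integrable \<mu>1 (\<lambda>t. indicat_real {0..<x} t *\<^sub>R (cmod (psi2 z t))\<^sup>2)"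
      by (rule dirichlet_integrable[OF psi(1) x(1)])
    fix t show "indicat_real {0..?a} t \<le> indicat_real {0..<x} t *\<^sub>R (cmod (psi2 z t))\<^sup>2"
      using psi2[of t] x(2) by (auto simp: indicator_def)
  qed
  also have "\<dots> \<le> psi_dirichlet z"
    unfolding psi_dirichlet_def by (rule dirichlet(2)[OF psi(1) L2_fun_scale[OF psi_L2] psi(4)[OF c] x(1)])
  finally show ?thesis .
qed

text \<open>
  The test function of the variational bound: the flux \<open>v\<^sub>2\<close> starts at \<open>1\<close>, decreases at the
  rate of \<open>R\<^sub>2\<close> and has vanished from \<open>y\<close> on.
\<close>

lemma absorbing_flux:
  assumes y: "y \<in> Ico0 b" "0 < R2 y"
  shows "\<exists>v1 v2 f. integral_pair b R1 R2 v1 v2 f \<and> f \<in> L2_fun \<mu>2 \<and> (v2 \<longlongrightarrow> 0) (at_end b) \<and> v2 0 = 1 \<and>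
    dirichlet v2 \<le> R1 y \<and> (\<integral>s. (cmod (f s))\<^sup>2 \<partial>\<mu>2) = 1 / R2 y"
proof -
  define f where "f s = complex_of_real (indicator {0..<y} s / R2 y)" for s
  have yS: "{0..<y} \<in> sets \<mu>2" using y by simp
  have my: "measure \<mu>2 {0..<y} = R2 y" using S2.measure_Ico[OF y(1), of 0] y by (simp add: Ico0_nonneg S2.zero)
  have fin: "emeasure \<mu>2 {0..<y} < \<infinity>" by (rule S2.fin[OF y(1)])
  have sq: "(cmod (f s))\<^sup>2 = indicator {0..<y} s / (R2 y)\<^sup>2" for s
    unfolding f_def norm_of_real by (simp add: indicator_def power_divide)
  have i: "integrable \<mu>2 (indicat_real {0..<y})" by (rule integrable_real_indicator[OF yS fin])
  have fm: "f \<in> borel_measurable \<mu>2" unfolding f_def[abs_def] using yS by measurable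
  have fL: "f \<in> L2_fun \<mu>2" unfolding L2_fun_def using fm i by (simp add: sq)
  have ind: "(\<integral>s. indicator {0..<y} s \<partial>\<mu>2) = R2 y"
    using my sets.sets_into_space[OF yS] by (simp add: Int_absorb2)
  have f2: "(\<integral>s. (cmod (f s))\<^sup>2 \<partial>\<mu>2) = 1 / R2 y"
  proof -
    have "(\<integral>s. (cmod (f s))\<^sup>2 \<partial>\<mu>2) = R2 y / (R2 y)\<^sup>2" by (simp only: sq integral_divide_zero ind)
    then show ?thesis using y(2) by (simp add: power2_eq_square)
  qed
  have "(\<integral>s. f s \<partial>\<mu>2) = complex_of_real ((\<integral>s. indicator {0..<y} s \<partial>\<mu>2) / R2 y)"
    unfolding f_def by (subst integral_complex_of_real) simp
  then have f1: "(\<integral>s. f s \<partial>\<mu>2) = 1" unfolding ind using y(2) by simp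
  obtain v1 v2 where v: "(v1, v2, f) \<in> triples b R1 R2" "v1 0 = 0" "v2 0 = 1"
    by (rule triple_exists[OF fL])
  then have vp: "integral_pair b R1 R2 v1 v2 f" by (simp add: triples_iff)
  have vlim: "(v2 \<longlongrightarrow> 0) (at_end b)" using u2_tendsto_0_iff[OF vp fL] v f1 by simp
  have v2: "v2 x = complex_of_real (1 - R2 (min x y) / R2 y)" if x: "x \<in> Ico0 b" for x
  proof -
    have m: "min x y \<in> Ico0 b" using x y by (auto simp: min_def)
    have "cum \<mu>2 f x = complex_of_real (\<integral>s. indicator {0..<min x y} s / R2 y \<partial>\<mu>2)"
      unfolding cum_def set_lebesgue_integral_def
      by (subst integral_complex_of_real[symmetric])
        (intro Bochner_Integration.integral_cong refl, auto simp: f_def indicator_def)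
    also have "(\<integral>s. indicator {0..<min x y} s / R2 y \<partial>\<mu>2) = R2 (min x y) / R2 y"
      using S2.measure_Ico[OF m order_refl Ico0_nonneg[OF m]] Ico0_subset[OF m]
      by (simp add: S2.zero Int_absorb2)
    finally show ?thesis using integral_pairD(4)[OF vp x] v by simp
  qed
  have v2_le: "cmod (v2 x) \<le> 1" "y \<le> x \<Longrightarrow> v2 x = 0" if x: "x \<in> Ico0 b" for x
  proof -
    have m: "min x y \<in> Ico0 b" using x y by (auto simp: min_def)
    have "0 \<le> R2 (min x y) / R2 y" "R2 (min x y) / R2 y \<le> 1"
      using S2.nonneg[OF m] S2.mono[OF m y(1)] y(2) by auto
    then show "cmod (v2 x) \<le> 1" unfolding v2[OF x] norm_of_real by simp
    show "y \<le> x \<Longrightarrow> v2 x = 0" unfolding v2[OF x] using y(2) by (simp add: min_absorb2)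
  qed
  have Dv: "dirichlet v2 \<le> R1 y"
  proof (rule tendsto_upperbound[OF dirichlet(4)[OF vp fL vlim] _ at_end_neq_bot[OF b_pos]])
    show "eventually (\<lambda>x. (LINT t:{0..<x}|\<mu>1. (cmod (v2 t))\<^sup>2) \<le> R1 y) (at_end b)"
      using eventually_at_end_Ico0[OF b_pos]
    proof eventually_elim
      case (elim x)
      have "(LINT t:{0..<x}|\<mu>1. (cmod (v2 t))\<^sup>2) \<le> (\<integral>t. indicator {0..<y} t \<partial>\<mu>1)"
        unfolding set_lebesgue_integral_def
      proof (rule integral_mono[OF dirichlet_integrable[OF vp elim]])
        show "integrable \<mu>1 (indicat_real {0..<y})"
          by (rule integrable_real_indicator[OF S1.Ico_sets[OF y(1)] S1.fin[OF y(1)]])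
        fix t assume "t \<in> space \<mu>1"
        then have t: "t \<in> Ico0 b" by simp
        have "(cmod (v2 t))\<^sup>2 \<le> 1" using v2_le(1)[OF t] by (simp add: power_le_one)
        then show "indicat_real {0..<x} t *\<^sub>R (cmod (v2 t))\<^sup>2 \<le> indicat_real {0..<y} t"
          using v2_le(2)[OF t] Ico0_nonneg[OF t] by (auto simp: indicator_def)
      qed
      also have "\<dots> = R1 y"
        using S1.measure_Ico[OF y(1), of 0] y sets.sets_into_space[OF S1.Ico_sets[OF y(1)]]
        by (simp add: Ico0_nonneg S1.zero Int_absorb2)
      finally show ?case .
    qed
  qed
  show ?thesis using vp fL vlim v(3) Dv f2 by blast
qed

text \<open>
  \<open>\<psi>\<close> minimizes the Dirichlet form of \<open>v\<^sub>2\<close> plus \<open>1/t\<close> times the squared norm of the density \<open>f\<close>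
  among all fluxes \<open>v\<^sub>2\<close> with \<open>v\<^sub>2(0) = 1\<close> and \<open>v\<^sub>2(b) = 0\<close>. The minimum \<open>m\<close> is bounded by means of the mixed
  energy of \<open>\<psi>\<close> and \<open>v\<close>, which is \<open>m\<close> up to the integral of \<open>\<psi>\<^sub>1 f\<close>.
\<close>

lemma energy_le:
  assumes t: "0 < t" and y: "y \<in> Ico0 b" "0 < R2 y"
  shows "psi_dirichlet (- complex_of_real t) + t * psi_norm (- complex_of_real t) \<le> R1 y + 1 / (t * R2 y)"
proof -
  let ?z = "- complex_of_real t"
  have "?z \<notin> \<real>\<^sub>\<ge>\<^sub>0" using t by (simp add: complex_nonneg_Reals_iff)
  note c = c2_end_nonzero[OF this]
  obtain v1 v2 f where vp: "integral_pair b R1 R2 v1 v2 f" and fL: "f \<in> L2_fun \<mu>2" and vlim: "(v2 \<longlongrightarrow> 0) (at_end b)"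
    and v0: "v2 0 = 1" and Dv: "dirichlet v2 \<le> R1 y" and f2: "(\<integral>s. (cmod (f s))\<^sup>2 \<partial>\<mu>2) = 1 / R2 y"
    using absorbing_flux[OF y] by blast
  let ?I = "\<integral>s. psi1 ?z s * f s \<partial>\<mu>2"
  have "(cum \<mu>1 (\<lambda>s. psi2 ?z s * v2 s) \<longlongrightarrow> ?I + neumann_coefficient ?z) (at_end b)"
    using energy_tendsto[OF psi(1) L2_fun_scale[OF psi_L2] vp fL vlim] by (simp add: psi v0)
  then have "2 * Re (?I + neumann_coefficient ?z) \<le> psi_dirichlet ?z + dirichlet v2"
    unfolding psi_dirichlet_def
    by (rule Re_energy_le[OF psi(1) L2_fun_scale[OF psi_L2] psi(4)[OF c] vp fL vlim])
  moreover have "- 2 * Re ?I \<le> t * psi_norm ?z + 1 / (t * R2 y)"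
  proof -
    have "- 2 * Re ?I \<le> 2 * cmod ?I" using abs_Re_le_cmod[of ?I] by linarith
    also have "\<dots> \<le> t * psi_norm ?z + (\<integral>s. (cmod (f s))\<^sup>2 \<partial>\<mu>2) / t"
      unfolding psi_norm_def by (rule L2_AM_GM[OF psi_L2 fL t])
    finally show ?thesis by (simp add: f2 mult.commute)
  qed
  moreover have "Re (neumann_coefficient ?z) = psi_dirichlet ?z + t * psi_norm ?z"
    unfolding neumann_coefficient_energy[OF c] by simp
  ultimately show ?thesis using Dv by simp
qed

lemma m_N_at_bot:
  "((\<lambda>t::real. m_N b R1 R2 (complex_of_real t)) \<longlongrightarrow> complex_of_real (R_plus R1 left_end)) at_bot"
proof -
  define r where "r t = psi_dirichlet (complex_of_real t) - t * psi_norm (complex_of_real t)" for t :: real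
  have m: "m_N b R1 R2 (complex_of_real t) = complex_of_real (r t)" if "t < 0" for t
  proof -
    have z: "complex_of_real t \<notin> \<real>\<^sub>\<ge>\<^sub>0" using that by simp
    show ?thesis unfolding m_N_eq'[OF z] neumann_coefficient_energy[OF c2_end_nonzero[OF z]] by (simp add: r_def)
  qed
  have low: "R_plus R1 left_end \<le> r t" if "t < 0" for t
  proof -
    have z: "complex_of_real t \<notin> \<real>\<^sub>\<ge>\<^sub>0" using that by simp
    have "0 \<le> - t * psi_norm (complex_of_real t)" using that psi_norm_nonneg by (intro mult_nonneg_nonneg) auto
    then show ?thesis using psi_dirichlet_ge[OF c2_end_nonzero[OF z]] by (simp add: r_def)
  qed
  have "(r \<longlongrightarrow> R_plus R1 left_end) at_bot"
  proof (rule order_tendstoI)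
    fix e assume e: "e < R_plus R1 left_end"
    show "eventually (\<lambda>t. e < r t) at_bot"
      unfolding eventually_at_bot_dense by (intro exI[of _ 0] allI impI less_le_trans[OF e] low)
  next
    fix e assume e: "R_plus R1 left_end < e"
    have "eventually (\<lambda>y. R1 y < e) (at_right left_end)"
      using S1.right_limit(1)[OF left_end(1)] e by (rule order_tendstoD)
    then have "eventually (\<lambda>y. R1 y < e \<and> y \<in> Ico0 b \<and> left_end < y) (at_right left_end)"
      using eventually_at_right_Ico0[OF left_end(1)] by eventually_elim simp
    then obtain y where y: "R1 y < e" "y \<in> Ico0 b" "left_end < y"
      using eventually_happens'[OF trivial_limit_at_right_real] by blast
    have Ry: "0 < R2 y" by (rule left_end(3)[OF y(2,3)])
    \<comment> \<open>solves \<open>R\<^sub>1(y) + 1/(T R\<^sub>2(y)) = e\<close>\<close>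
    define T where "T = 1 / (R2 y * (e - R1 y))"
    have T: "0 < T" using Ry y(1) by (simp add: T_def)
    have "r t < e" if "t < - T" for t
    proof -
      have t: "0 < - t" "T < - t" using that T by auto
      have "r t \<le> R1 y + 1 / (- t * R2 y)"
        using energy_le[OF t(1) y(2) Ry] by (simp add: r_def)
      also have "1 / (- t * R2 y) < 1 / (T * R2 y)"
        using t T Ry by (intro divide_strict_left_mono mult_strict_right_mono mult_pos_pos) auto
      also have "1 / (T * R2 y) = e - R1 y" using Ry y(1) by (simp add: T_def)
      finally show ?thesis by simp
    qed
    then show "eventually (\<lambda>t. r t < e) at_bot" unfolding eventually_at_bot_dense by blast
  qed
  then have "((\<lambda>t. complex_of_real (r t)) \<longlongrightarrow> complex_of_real (R_plus R1 left_end)) at_bot"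
    by (rule tendsto_of_real)
  moreover have "eventually (\<lambda>t. complex_of_real (r t) = m_N b R1 R2 (complex_of_real t)) at_bot"
    unfolding eventually_at_bot_dense using m by (intro exI[of _ 0]) simp
  ultimately show ?thesis by (rule Lim_transform_eventually)
qed

end

lemma standing_assumptions_separation:
  assumes b: "0 < b" and R2: "stieltjes_integrator b R2" and st: "standing_assumptions b R1 R2"
    and ae: "AE x in dR b R2. p + q * complex_of_real (R1 x) = 0"
  shows "p = 0 \<and> q = 0"
proof -
  obtain b0 where b0: "0 < b0" "b0 \<le> b" "(\<lambda>x. 1) \<in> L2_fun (dR b0 R2)"
    "(\<lambda>x. complex_of_real (R1 x)) \<in> L2_fun (dR b0 R2)"
    "lin_indep (L2 (dR b0 R2)) [L2_class (dR b0 R2) (\<lambda>x. 1), L2_class (dR b0 R2) (\<lambda>x. complex_of_real (R1 x))]"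
    using st unfolding standing_assumptions_def by blast
  have "AE x in dR b0 R2. p * 1 + q * complex_of_real (R1 x) = 0"
  proof -
    have I: "Ico0 b0 \<subseteq> Ico0 b" using b0(2) by (auto simp: Ico0_def)
    interpret stieltjes b R2 using b R2 by unfold_locales
    have "Ico0 b0 \<inter> space (dR b R2) \<in> sets (dR b R2)"
      using borel_Int_sets[of "Ico0 b0"] by (simp add: Ico0_def)
    then show ?thesis unfolding dR_shorten[OF b0(1,2) R2]
      by (subst AE_restrict_space_iff) (use ae in \<open>auto elim!: AE_mp\<close>)
  qed
  then have "lincomb (L2 (dR b0 R2)) [p, q] [L2_class (dR b0 R2) (\<lambda>x. 1), L2_class (dR b0 R2) (\<lambda>x. complex_of_real (R1 x))]
     = Zero (L2 (dR b0 R2))"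
    unfolding lincomb_pair[OF b0(3,4)] Zero_L2
    by (subst L2_class_eq_iff) (intro L2_fun_add L2_fun_scale b0 zero_L2_fun)+
  then have "\<forall>a\<in>set [p, q]. a = 0"
    using b0(5)[unfolded lin_indep_def, THEN spec, of "[p, q]"] by simp
  then show ?thesis by simp
qed

theorem proposition3p6:
  fixes b :: ereal and R1 R2 :: "real \<Rightarrow> real"
  assumes "0 < b"
    and "stieltjes_integrator b R1" and "stieltjes_integrator b R2"
    and "standing_assumptions b R1 R2"
    and "\<not> regular_system b R1 R2"
    and "limit_circle b R1 R2"
  shows
    "(linear_relation (L2 (dR b R2)) (T_N b R1 R2) \<and>
      symmetric_rel (L2 (dR b R2)) (T_N b R1 R2) \<and>
      nonnegative_rel (L2 (dR b R2)) (T_N b R1 R2) \<and>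
      deficiency_indices (L2 (dR b R2)) (T_N b R1 R2) 1 1)
   \<and> boundary_triple (L2 (dR b R2)) (T_N b R1 R2) (Gamma0_N b R1 R2) (Gamma1_N b R1 R2)
   \<and> (\<forall>z \<in> resolvent_set (L2 (dR b R2)) (ker_bdry (L2 (dR b R2)) (T_N b R1 R2) (Gamma0_N b R1 R2)).
        m_N b R1 R2 z = neumann_m b R1 R2 z)
   \<and> (- \<real>\<^sub>\<ge>\<^sub>0 \<subseteq> resolvent_set (L2 (dR b R2)) (ker_bdry (L2 (dR b R2)) (T_N b R1 R2) (Gamma0_N b R1 R2)) \<and>
      (\<forall>z \<in> - \<real>\<^sub>\<ge>\<^sub>0. m_N b R1 R2 z = titchmarsh_weyl b R1 R2 z) \<and>
      m_N b R1 R2 \<in> stieltjes_class \<and>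
      ((\<lambda>t::real. m_N b R1 R2 (complex_of_real t))
         \<longlongrightarrow> complex_of_real (R_plus R1 (Inf (supp_dR b R2)))) at_bot)
   \<and> (\<exists>mt \<in> stieltjes_class.
        (\<forall>z \<in> - \<real>\<^sub>\<ge>\<^sub>0.
           m_N b R1 R2 z = - 1 / (complex_of_real (real_of_ereal (R_end b R2)) * z) + mt z) \<and>
        ((\<lambda>y::real. complex_of_real y * mt (\<i> * complex_of_real y)) \<longlongrightarrow> 0) (at 0))"
proof -
  interpret I: integral_system b R1 R2
    using assms(1-4) by unfold_locales (auto simp: standing_assumptions_def)
  interpret L: limit_circle_system b R1 R2
    by (rule I.limit_circle_imp_system[OF assms(6)])
  have R2_end: "R_end b R2 = ereal (measure (dR b R2) (Ico0 b))"
    by (rule I.S2.R_end_finite(1)[OF L.F2.finite_measure_axioms])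
  have "R_end b R1 = \<infinity>"
    using assms(5) unfolding regular_system_def R2_end by (cases "R_end b R1") auto
  then have R1_end: "filterlim R1 at_top (at_end b)" by (rule I.S1.R_end_infinite)
  interpret N: singular_limit_circle b R1 R2
    by unfold_locales (rule standing_assumptions_separation[OF assms(1,3,4)] R1_end | assumption)+
  show ?thesis
  proof (intro conjI)
    show "\<forall>z \<in> resolvent_set (L2 (dR b R2)) (ker_bdry (L2 (dR b R2)) (T_N b R1 R2) (Gamma0_N b R1 R2)).
        m_N b R1 R2 z = neumann_m b R1 R2 z"
      using N.resolvent_c2_end N.m_N_eq by (simp add: N.neumann_m_eq N.neumann_coefficient_def)
    show "\<forall>z \<in> - \<real>\<^sub>\<ge>\<^sub>0. m_N b R1 R2 z = titchmarsh_weyl b R1 R2 z"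
      using N.m_N_eq' N.titchmarsh_weyl_eq N.c2_end_nonzero by simp
    show "- \<real>\<^sub>\<ge>\<^sub>0 \<subseteq> resolvent_set (L2 (dR b R2)) (ker_bdry (L2 (dR b R2)) (T_N b R1 R2) (Gamma0_N b R1 R2))"
      using N.resolvent_A0 by auto
    show "((\<lambda>t::real. m_N b R1 R2 (complex_of_real t))
         \<longlongrightarrow> complex_of_real (R_plus R1 (Inf (supp_dR b R2)))) at_bot"
      using N.m_N_at_bot by (simp add: N.left_end_def)
    show "\<exists>mt \<in> stieltjes_class.
        (\<forall>z \<in> - \<real>\<^sub>\<ge>\<^sub>0.
           m_N b R1 R2 z = - 1 / (complex_of_real (real_of_ereal (R_end b R2)) * z) + mt z) \<and>
        ((\<lambda>y::real. complex_of_real y * mt (\<i> * complex_of_real y)) \<longlongrightarrow> 0) (at 0)"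
      using N.m_reduced_stieltjes N.m_reduced_tendsto
      by (intro bexI[of _ N.m_reduced]) (auto simp: N.m_reduced_def R2_end)
  qed (rule N.T_N_linear N.T_N_symmetric N.T_N_nonnegative N.deficiency_T_N N.m_N_stieltjes
      N.boundary_triple_N[OF N.deficiency_T_N])+
qed

end
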